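(* Let $\varrho(N)$, $N\ge1$, be a sequence of probability measures on $\hat U(N)$ such that for every finite $r\in\mathbb{N}$ one has $$\lim_{N\to\infty}N\left(\frac1N\log S^{U(N)}_{\varrho(N)}(u_1,\dots,u_r,1^{N-r})-\sum_{i=1}^r\Psi(u_i)\right)=\sum_{i=1}^r\Phi(u_i),$$ where $\Psi,\Phi$ are analytic functions in a complex neighborhood of $1$ and the convergence is uniform in a complex neighborhood of $1^r$. Then, for every $k\in\mathbb{N}$, we have $$\lim_{N\to\infty}N\left(\frac1N\sum_{\lambda\in\hat U(N)}\varrho(N)[\lambda]\sum_{i=1}^N\left(\frac{\lambda_i+N-i}{N}\right)^k-\mathbf{m}_k\right)=\sum_{\pi\in \mathrm{NC}(k)}\ \sum_{V\in\pi}\boldsymbol{\kappa}^{(1)}_{|V|}\prod_{W\in\pi,\ W\ne V}\boldsymbol{\kappa}^{(0)}_{|W|},$$ where $$\mathbf{m}_k=\sum_{m=0}^{k}\frac{k!}{m!\,(m+1)!\,(k-m)!}\left.\frac{d^m}{dx^m}\left(x^k(\Psi'(x))^{k-m}\right)\right|_{x=1}$$ and for every $n\in\mathbb{N}$ $$\boldsymbol{\kappa}^{(0)}_n=\frac{1}{(n-1)!}\left.\frac{d^n}{du^n}\left(\Psi(e^u)+\log\left(\frac{e^u-1}{u}\right)\right)\right|_{u=0},\qquad \boldsymbol{\kappa}^{(1)}_n=\frac{1}{(n-1)!}\left.\frac{d^n}{du^n}\left(\Phi(e^u)-\frac12u\right)\right|_{u=0}.$$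
   Context: $\mathbb{N}=\{1,2,\dots\}$; $1^m$ denotes $m$ ones $(1,\dots,1)$. $\mathrm{NC}(k)$ is the set of non-crossing partitions of $\{1,\dots,k\}$; elements $V\in\pi$ are the blocks of $\pi$ and $|V|$ is the cardinality of $V$. $\hat U(N)$ is the set of signatures of length $N$: $N$-tuples of integers $\lambda=(\lambda_1\ge\dots\ge\lambda_N)$. For $\lambda\in\hat U(N)$ the (rational) Schur function is $$\boldsymbol{\chi}^{\lambda}(u_1,\dots,u_N)=\frac{\det\left(u_i^{\lambda_j+N-j}\right)_{i,j=1}^N}{\prod_{1\le i<j\le N}(u_i-u_j)},$$ a symmetric Laurent polynomial. For a probability measure $\varrho$ on $\hat U(N)$ the Schur generating function is the symmetric Laurent power series $$S^{U(N)}_{\varrho}(u_1,\dots,u_N)=\sum_{\lambda\in\hat U(N)}\varrho(\lambda)\frac{\boldsymbol{\chi}^{\lambda}(u_1,\dots,u_N)}{\boldsymbol{\chi}^{\lambda}(1^N)}.$$ The hypothesis implicitly includes that this series converges near $1^N$, and that the logarithm (the branch equal to $0$ at $u=1$) is well defined there. The function $\log((e^u-1)/u)$ is extended analytically to $u=0$ with value $0$. *)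

theory Defs
  imports
    "HOL-Complex_Analysis.Complex_Analysis"
    "HOL-Probability.Probability_Mass_Function"
    "HOL-Library.Disjoint_Sets"
    "Jordan_Normal_Form.Determinant"
begin

text \<open>Indices are shifted to start from 0: the entry \<open>\<lambda>\<^sub>i\<close> of a signature is \<open>l ! (i - 1)\<close> and
  the variable \<open>u\<^sub>i\<close> is \<open>u (i - 1)\<close>. In particular the exponent \<open>\<lambda>\<^sub>j + N - j\<close> becomes
  \<open>l ! j + N - 1 - j\<close>.\<close>

definition signatures :: "nat \<Rightarrow> int list set" where
  "signatures N = {l. length l = N \<and> sorted_wrt (\<ge>) l}"

definition laurent_poly :: "nat \<Rightarrow> ((nat \<Rightarrow> complex) \<Rightarrow> complex) \<Rightarrow> bool" where
  "laurent_poly N f \<longleftrightarrow>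
     (\<exists>(A :: (nat \<Rightarrow> int) set) c. finite A \<and>
        f = (\<lambda>u. \<Sum>\<alpha>\<in>A. c \<alpha> * (\<Prod>i<N. u i powi \<alpha> i)))"

text \<open>The quotient of determinants only makes sense at pairwise distinct nonzero arguments. The
  rational Schur function is the Laurent polynomial that agrees with the quotient there; this
  gives it a value at arguments such as \<open>1\<^sup>N\<close> as well.\<close>

definition schur :: "nat \<Rightarrow> int list \<Rightarrow> (nat \<Rightarrow> complex) \<Rightarrow> complex" where
  "schur N l = (THE f. laurent_poly N f \<and>
     (\<forall>u. inj_on u {..<N} \<and> (\<forall>i<N. u i \<noteq> 0) \<longrightarrow>
        f u = Determinant.det
                (Matrix.mat N N (\<lambda>(i, j). u i powi (l ! j + int N - 1 - int j)))
              / (\<Prod>j<N. \<Prod>i<j. u i - u j)))"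

definition sgf_term :: "nat \<Rightarrow> int list pmf \<Rightarrow> (nat \<Rightarrow> complex) \<Rightarrow> int list \<Rightarrow> complex" where
  "sgf_term N \<rho> u l = of_real (pmf \<rho> l) * (schur N l u / schur N l (\<lambda>_. 1))"

definition sgf_converges :: "nat \<Rightarrow> int list pmf \<Rightarrow> (nat \<Rightarrow> complex) \<Rightarrow> bool" where
  "sgf_converges N \<rho> u \<longleftrightarrow> sgf_term N \<rho> u summable_on signatures N"

definition sgf :: "nat \<Rightarrow> int list pmf \<Rightarrow> (nat \<Rightarrow> complex) \<Rightarrow> complex" where
  "sgf N \<rho> u = (\<Sum>\<^sub>\<infinity>l\<in>signatures N. sgf_term N \<rho> u l)"

definition polydisc :: "nat \<Rightarrow> real \<Rightarrow> (nat \<Rightarrow> complex) set" where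
  "polydisc r \<epsilon> = {..<r} \<rightarrow>\<^sub>E ball 1 \<epsilon>"

text \<open>The point \<open>(u\<^sub>1, \<dots>, u\<^sub>r, 1, 1, \<dots>)\<close>.\<close>

definition pad_ones :: "nat \<Rightarrow> (nat \<Rightarrow> complex) \<Rightarrow> nat \<Rightarrow> complex" where
  "pad_ones r u = (\<lambda>i. if i < r then u i else 1)"

text \<open>\<open>L\<close> is the branch of \<open>log S(u\<^sub>1, \<dots>, u\<^sub>r, 1\<^sup>N\<^sup>-\<^sup>r)\<close> on the polydisc that vanishes at \<open>1\<^sup>r\<close>. The
  polydisc is connected, so these conditions determine \<open>L\<close> on it. The principal logarithm
  \<open>Ln\<close> would not do, since \<open>log S\<close> is of order \<open>N\<close>.\<close>

definition is_log_sgf ::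
    "nat \<Rightarrow> real \<Rightarrow> nat \<Rightarrow> int list pmf \<Rightarrow> ((nat \<Rightarrow> complex) \<Rightarrow> complex) \<Rightarrow> bool" where
  "is_log_sgf r \<epsilon> N \<rho> L \<longleftrightarrow>
     continuous_on (polydisc r \<epsilon>) L \<and> L (\<lambda>i\<in>{..<r}. 1) = 0 \<and>
     (\<forall>u\<in>polydisc r \<epsilon>. sgf_converges N \<rho> (pad_ones r u) \<and>
        exp (L u) = sgf N \<rho> (pad_ones r u))"

definition noncrossing_partitions :: "nat \<Rightarrow> nat set set set" where
  "noncrossing_partitions k = {\<pi>. partition_on {1..k} \<pi> \<and>
     \<not> (\<exists>V\<in>\<pi>. \<exists>W\<in>\<pi>. V \<noteq> W \<and>
          (\<exists>a b c d. a < b \<and> b < c \<and> c < d \<and> a \<in> V \<and> c \<in> V \<and> b \<in> W \<and> d \<in> W))}"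

definition power_sum :: "nat \<Rightarrow> nat \<Rightarrow> int list \<Rightarrow> real" where
  "power_sum N k l = (\<Sum>i<N. (of_int (l ! i + int N - 1 - int i) / of_nat N) ^ k)"

definition limit_moment :: "(complex \<Rightarrow> complex) \<Rightarrow> nat \<Rightarrow> complex" where
  "limit_moment \<Psi> k =
     (\<Sum>m=0..k. fact k / (fact m * fact (m + 1) * fact (k - m)) *
        (deriv ^^ m) (\<lambda>x. x ^ k * deriv \<Psi> x ^ (k - m)) 1)"

text \<open>The principal branch is the right one near \<open>u = 0\<close>, where the argument is close to 1.\<close>

definition log_expm1_div :: "complex \<Rightarrow> complex" where
  "log_expm1_div u = (if u = 0 then 0 else Ln ((exp u - 1) / u))"

definition kappa0 :: "(complex \<Rightarrow> complex) \<Rightarrow> nat \<Rightarrow> complex" where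
  "kappa0 \<Psi> n = 1 / fact (n - 1) * (deriv ^^ n) (\<lambda>u. \<Psi> (exp u) + log_expm1_div u) 0"

definition kappa1 :: "(complex \<Rightarrow> complex) \<Rightarrow> nat \<Rightarrow> complex" where
  "kappa1 \<Phi> n = 1 / fact (n - 1) * (deriv ^^ n) (\<lambda>u. \<Phi> (exp u) - u / 2) 0"

end

theory Submission imports Defs begin

text \<open>
  Write \<open>l\<^sub>j = \<lambda>\<^sub>j + N - j\<close> and \<open>(z)\<^sub>m\<close> for the falling factorial, and let \<open>V\<close> be the Vandermonde
  product. The proof has three parts.

  An exact formula. The numerator of the rational Schur function \<open>s\<close> of \<open>\<lambda>\<close> is an alternating sum
  of monomials with exponents \<open>l\<^sub>1, \<dots>, l\<^sub>N\<close> in some order, so \<open>\<Sum>\<^sub>i u\<^sub>i\<^sup>m \<partial>\<^sub>i\<^sup>m\<close> multiplies it by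
  \<open>\<Sum>\<^sub>j (l\<^sub>j)\<^sub>m\<close>. Since the numerator is \<open>V s\<close>, the Leibniz rule expresses this through the derivatives
  of \<open>s\<close> and the quotients \<open>\<partial>\<^sub>i\<^sup>j V / V = j! \<Sum>\<^sub>B \<Prod>\<^sub>a 1 / (u\<^sub>i - u\<^sub>a)\<close>, where \<open>B\<close> runs over the sets of \<open>j\<close>
  indices different from \<open>i\<close> and \<open>a\<close> over \<open>B\<close>. Collecting the pairs \<open>(i, B)\<close> with the same \<open>D = B \<union> {i}\<close>
  gives divided differences over \<open>D\<close> of the family \<open>u\<^sub>i\<^sup>m \<partial>\<^sub>i\<^bsup>m-j\<^esup> s\<close>. As \<open>s\<close> is symmetric, such a
  divided difference is a Laurent polynomial, and its value at \<open>1\<^sup>N\<close> depends only on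
  \<open>s(u\<^sub>1, \<dots>, u\<^bsub>j+1\<^esub>, 1, \<dots>, 1)\<close>: it is a fixed linear functional \<open>bracket\<close> of this function. So
  \<open>\<Sum>\<^sub>j (l\<^sub>j)\<^sub>m\<close> is a sum of \<open>m + 1\<close> brackets with weights \<open>j! C(m, j) C(N, j+1)\<close>
  (\<open>gt_schur_eigen_expansion\<close>), and the expectation of \<open>\<Sum>\<^sub>j (l\<^sub>j)\<^sub>m\<close> is the same combination of brackets
  of the Schur generating function \<open>S\<^sub>N\<close> (\<open>falling_moment_has_sum\<close>).

  Asymptotics of the brackets. Let \<open>n\<close> be the number of derivatives in the bracket. The hypothesis
  says \<open>S\<^sub>N = exp (N a + b + o(1))\<close> with \<open>a = \<Sum>\<^sub>i \<Psi>(u\<^sub>i)\<close> and \<open>b = \<Sum>\<^sub>i \<Phi>(u\<^sub>i)\<close>. Multiplication by a symmetric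
  function commutes with divided differences, and each derivative lowers the order of vanishing at
  the base point by at most one; hence the bracket annihilates \<open>a\<^sup>q f\<close> if \<open>q > n\<close>, and also
  \<open>a\<^sup>n f\<close> if \<open>f\<close> vanishes at the base point (\<open>blim_power_vanish\<close>). Therefore the bracket of
  \<open>exp (N a) w\<close> is a polynomial in \<open>N\<close> of degree \<open>n\<close> whose top coefficient involves only the value of
  \<open>w\<close> at the base point, and the error \<open>o(1)\<close> in the exponent contributes \<open>o(N\<^bsup>n-1\<^esup>)\<close>
  (\<open>blim_exp_perturb\<close>). To the required precision \<open>S\<^sub>N\<close> may thus be replaced by the product of the
  one-variable functions \<open>exp (N \<Psi>(u\<^sub>i) + \<Phi>(u\<^sub>i))\<close>, and the bracket of such a product is a coefficient
  of a power series in one variable (\<open>blim_prod\<close>). Its two leading terms in \<open>N\<close>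
  (\<open>bracket_sum_expansion\<close>), together with those of \<open>C(N, j+1)\<close> and of the expansion of \<open>z\<^sup>k\<close> in falling
  factorials, give the limit as a coefficient of a series in \<open>\<Psi>'\<close>, \<open>\<Psi>''\<close> and \<open>\<Phi>'\<close> at \<open>1\<close>.

  Combinatorics. The sum over non-crossing partitions is the derivative at \<open>\<epsilon> = 0\<close> of the sum of
  \<open>\<Prod>\<^sub>W \<kappa>\<^bsub>|W|\<^esub>\<close> with \<open>\<kappa> = \<kappa>\<^sup>0 + \<epsilon> \<kappa>\<^sup>1\<close>. Cutting a partition at the second element of its first block shows
  that the generating functions satisfy \<open>M(x) = K(x M(x))\<close>, so Lagrange inversion yields the
  \<open>k\<close>-th moment as a coefficient of \<open>K\<^bsup>k+1\<^esup>\<close> (\<open>ncw_lagrange\<close>) and the derivative as a coefficient of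
  \<open>C\<^sup>k B\<close>, where \<open>C\<close> and \<open>B\<close> are the series of \<open>\<kappa>\<^sup>0\<close> and \<open>\<kappa>\<^sup>1\<close> (\<open>nc_first_order\<close>). Reading the
  coefficient as a residue and substituting \<open>x = e\<^sup>u - 1\<close> turns it into a coefficient in \<open>\<Psi>'\<close> and \<open>\<Phi>'\<close>
  at \<open>1\<close>; the term \<open>- u/2\<close> in \<open>\<kappa>\<^sup>1\<close> becomes a correction (\<open>nc_series_change_variable\<close>) that on the
  other side is produced by the second-order terms of the binomial coefficients and by \<open>\<Psi>''\<close>
  (\<open>second_order_coefficient\<close>).
\<close>

section \<open>Laurent polynomials near the base point\<close>

definition torus :: "nat \<Rightarrow> (nat \<Rightarrow> complex) set" where
  "torus N = {u. \<forall>i<N. u i \<noteq> 0}"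

text \<open>The values of these functions matter only at points whose coordinates are all nonzero. The class is generated inductively rather than described by monomials because the facts needed below
  (division by \<open>u\<^sub>a - u\<^sub>b\<close>, derivatives, substitutions, bounds) all follow by structural induction. The
  rule \<open>cong\<close> leaves the values off the torus free, so that a formula that is a Laurent polynomial
  only on the torus still belongs to the class.\<close>

inductive laurent :: "nat \<Rightarrow> ((nat \<Rightarrow> complex) \<Rightarrow> complex) \<Rightarrow> bool" for N where
  const: "laurent N (\<lambda>u. c)"
| var: "i < N \<Longrightarrow> laurent N (\<lambda>u. u i)"
| inv: "i < N \<Longrightarrow> laurent N (\<lambda>u. inverse (u i))"
| add: "laurent N f \<Longrightarrow> laurent N g \<Longrightarrow> laurent N (\<lambda>u. f u + g u)"
| mult: "laurent N f \<Longrightarrow> laurent N g \<Longrightarrow> laurent N (\<lambda>u. f u * g u)"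
| cong: "laurent N f \<Longrightarrow> (\<And>u. u \<in> torus N \<Longrightarrow> g u = f u) \<Longrightarrow> laurent N g"

lemmas laurent_intros = laurent.const laurent.var laurent.inv laurent.add laurent.mult

lemma torus_upd: "u \<in> torus N \<Longrightarrow> z \<noteq> 0 \<Longrightarrow> u(i := z) \<in> torus N"
  by (auto simp: torus_def)

lemma torus_upd_eq: "u \<in> torus N \<Longrightarrow> b < N \<Longrightarrow> u(a := u b) \<in> torus N"
  by (auto simp: torus_def)

lemma torus_one [simp]: "(\<lambda>_. 1) \<in> torus N"
  by (auto simp: torus_def)

lemma laurent_cmult: "laurent N f \<Longrightarrow> laurent N (\<lambda>u. c * f u)"
  by (intro laurent.mult laurent.const)

lemma laurent_diff: "laurent N f \<Longrightarrow> laurent N g \<Longrightarrow> laurent N (\<lambda>u. f u - g u)"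
  using laurent.add[OF _ laurent_cmult[of N g "-1"], of f] by simp

lemma laurent_sum: "(\<And>x. x \<in> A \<Longrightarrow> laurent N (f x)) \<Longrightarrow> laurent N (\<lambda>u. \<Sum>x\<in>A. f x u)"
  by (induction A rule: infinite_finite_induct) (auto intro: laurent.const laurent.add)

lemma laurent_prod: "(\<And>x. x \<in> A \<Longrightarrow> laurent N (f x)) \<Longrightarrow> laurent N (\<lambda>u. \<Prod>x\<in>A. f x u)"
  by (induction A rule: infinite_finite_induct) (auto intro: laurent.const laurent.mult)

lemma laurent_power: "laurent N f \<Longrightarrow> laurent N (\<lambda>u. f u ^ n)"
  by (induction n) (auto intro: laurent.const laurent.mult)

lemma laurent_powi: "i < N \<Longrightarrow> laurent N (\<lambda>u. u i powi n)"
  unfolding power_int_def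
  by (cases "0 \<le> n") (simp_all add: laurent_power laurent.var laurent.inv)

lemma laurent_subst:
  "laurent N f \<Longrightarrow> a < N \<Longrightarrow> b < N \<Longrightarrow> laurent N (\<lambda>u. f (u(a := u b)))"
proof (induction rule: laurent.induct)
  case (cong f g)
  then show ?case
    by (intro laurent.cong[OF cong.IH] cong.hyps(2) torus_upd_eq) auto
next
  case (var i)
  then show ?case by (cases "i = a") (simp_all add: laurent.var)
next
  case (inv i)
  then show ?case by (cases "i = a") (simp_all add: laurent.inv)
next
  case (add f g)
  then show ?case by (intro laurent.add)
next
  case (mult f g)
  then show ?case by (intro laurent.mult)
qed (rule laurent.const)

lemma laurent_compose_index:
  "laurent N f \<Longrightarrow> (\<And>i. i < N \<Longrightarrow> \<pi> i < N) \<Longrightarrow> laurent N (\<lambda>u. f (u \<circ> \<pi>))"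
proof (induction rule: laurent.induct)
  case (cong f g)
  show ?case
    by (rule laurent.cong[OF cong.IH]) (use cong in \<open>auto simp: torus_def\<close>)
qed (auto intro: laurent_intros)

lemma laurent_pad_ones: "laurent N f \<Longrightarrow> laurent r (\<lambda>u. f (pad_ones r u))"
proof (induction rule: laurent.induct)
  case (var i)
  then show ?case by (cases "i < r") (auto simp: pad_ones_def intro: laurent_intros)
next
  case (inv i)
  then show ?case by (cases "i < r") (auto simp: pad_ones_def intro: laurent_intros)
next
  case (cong f g)
  show ?case
    by (rule laurent.cong[OF cong.IH]) (use cong in \<open>auto simp: torus_def pad_ones_def\<close>)
qed (auto intro: laurent_intros)

text \<open>The factor theorem for \<open>u\<^sub>a - u\<^sub>b\<close>. The product case is the discrete product rule.\<close>

lemma laurent_div: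
  "laurent N f \<Longrightarrow> a < N \<Longrightarrow> b < N \<Longrightarrow>
     \<exists>h. laurent N h \<and> (\<forall>u\<in>torus N. f u - f (u(a := u b)) = (u a - u b) * h u)"
proof (induction rule: laurent.induct)
  case (const c)
  show ?case by (rule exI[of _ "\<lambda>_. 0"]) (auto intro: laurent.const)
next
  case (var i)
  show ?case by (rule exI[of _ "\<lambda>_. if i = a then 1 else 0"]) (auto intro: laurent.const)
next
  case (inv i)
  have "laurent N (\<lambda>u. if i = a then - (inverse (u a) * inverse (u b)) else 0)"
    using laurent_cmult[OF laurent.mult[OF laurent.inv[OF inv(2)] laurent.inv[OF inv(3)]], of "-1"]
    by (cases "i = a") (simp_all add: laurent.const)
  then show ?case
    by (rule exI[of _ "\<lambda>u. if i = a then - (inverse (u a) * inverse (u b)) else 0", OF conjI])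
       (use inv in \<open>auto simp: torus_def field_simps\<close>)
next
  case (add f g)
  then obtain h k where "laurent N h" "laurent N k"
    "\<forall>u\<in>torus N. f u - f (u(a := u b)) = (u a - u b) * h u"
    "\<forall>u\<in>torus N. g u - g (u(a := u b)) = (u a - u b) * k u" by blast
  then have "\<forall>u\<in>torus N. f u + g u - (f (u(a := u b)) + g (u(a := u b))) = (u a - u b) * (h u + k u)"
    by (simp only: add_diff_add distrib_left) simp
  with laurent.add[OF \<open>laurent N h\<close> \<open>laurent N k\<close>] show ?case by blast
next
  case (mult f g)
  then obtain h k where hk: "laurent N h" "laurent N k"
    "\<And>u. u\<in>torus N \<Longrightarrow> f u - f (u(a := u b)) = (u a - u b) * h u"
    "\<And>u. u\<in>torus N \<Longrightarrow> g u - g (u(a := u b)) = (u a - u b) * k u" by blast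
  have "f u * g u - f (u(a := u b)) * g (u(a := u b))
      = (u a - u b) * (h u * g u + f (u(a := u b)) * k u)" if "u \<in> torus N" for u
  proof -
    have "f u * g u - f (u(a := u b)) * g (u(a := u b))
      = (f u - f (u(a := u b))) * g u + f (u(a := u b)) * (g u - g (u(a := u b)))"
      by (simp add: algebra_simps)
    also have "\<dots> = (u a - u b) * (h u * g u + f (u(a := u b)) * k u)"
      unfolding hk(3,4)[OF that] by (simp add: algebra_simps)
    finally show ?thesis .
  qed
  moreover have "laurent N (\<lambda>u. h u * g u + f (u(a := u b)) * k u)"
    using mult hk laurent_subst[of N f a b] by (intro laurent_intros) auto
  ultimately show ?case by blast
next
  case (cong f g)
  then obtain h where "laurent N h" 
    "\<forall>u\<in>torus N. f u - f (u(a := u b)) = (u a - u b) * h u" by blast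
  moreover have "g u - g (u(a := u b)) = f u - f (u(a := u b))" if "u \<in> torus N" for u
    by (simp only: cong.hyps(2)[OF that] cong.hyps(2)[OF torus_upd_eq[OF that cong.prems(2)]])
  ultimately show ?case by (metis (no_types))
qed

lemma laurent_holo:
  "laurent N f \<Longrightarrow> u \<in> torus N \<Longrightarrow> (\<lambda>z. f (u(i := z))) holomorphic_on -{0}"
proof (induction rule: laurent.induct)
  case (var j)
  then show ?case by (cases "i = j") (auto intro!: holomorphic_intros)
next
  case (inv j)
  then show ?case by (cases "i = j") (auto intro!: holomorphic_intros)
next
  case (cong f g)
  then show ?case
    by (intro holomorphic_transform[OF cong.IH[OF cong.prems]] cong.hyps(2)[symmetric] torus_upd) auto
qed (auto intro!: holomorphic_intros)

lemma laurent_line: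
  "laurent N f \<Longrightarrow> (\<lambda>t. f (\<lambda>i. 1 + c i * t)) holomorphic_on {t. \<forall>i<N. 1 + c i * t \<noteq> 0}"
proof (induction rule: laurent.induct)
  case (cong f g)
  then show ?case
    by (intro holomorphic_transform[OF cong.IH]) (auto simp: torus_def)
qed (auto intro!: holomorphic_intros)

text \<open>A derivative along one coordinate, so that one-variable complex analysis applies to it directly.\<close>

definition partial :: "nat \<Rightarrow> ((nat \<Rightarrow> complex) \<Rightarrow> complex) \<Rightarrow> (nat \<Rightarrow> complex) \<Rightarrow> complex" where
  "partial i f u = deriv (\<lambda>z. f (u(i := z))) (u i)"

lemma partial_upd: "(partial i ^^ n) f (u(i := z)) = (deriv ^^ n) (\<lambda>z. f (u(i := z))) z"
proof (induction n arbitrary: z)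
  case (Suc n)
  have "(\<lambda>w. (partial i ^^ n) f (u(i := w))) = (deriv ^^ n) (\<lambda>z. f (u(i := z)))"
    by (rule ext, rule Suc)
  moreover have "(partial i ^^ Suc n) f (u(i := z)) = deriv (\<lambda>w. (partial i ^^ n) f (u(i := w))) z"
    by (simp add: partial_def)
  ultimately show ?case by (simp only: funpow.simps o_apply)
qed auto

lemma partial_iter: "(partial i ^^ n) f u = (deriv ^^ n) (\<lambda>z. f (u(i := z))) (u i)"
  using partial_upd[where n=n and z="u i" and i=i and f=f and u=u] by simp

lemma laurent_differentiable:
  assumes "laurent N f" "u \<in> torus N" "i < N"
  shows "(\<lambda>z. f (u(i := z))) field_differentiable at (u i)"
  by (rule holomorphic_on_imp_differentiable_at[OF laurent_holo[OF assms(1,2)]])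
     (use assms in \<open>auto simp: torus_def\<close>)

lemma partial_cong:
  assumes "u \<in> torus N" "i < N" "\<And>u. u \<in> torus N \<Longrightarrow> g u = f u"
  shows "partial i g u = partial i f u"
  unfolding partial_def
proof (rule deriv_cong_ev)
  have "\<forall>\<^sub>F z in nhds (u i). z \<in> -{0}"
    by (rule eventually_nhds_in_open) (use assms in \<open>auto simp: torus_def\<close>)
  then show "\<forall>\<^sub>F x in nhds (u i). g (u(i := x)) = f (u(i := x))"
    by eventually_elim (use assms in \<open>auto simp: torus_upd\<close>)
qed auto

lemma partial_add:
  assumes "laurent N f" "laurent N g" "u \<in> torus N" "i < N"
  shows "partial i (\<lambda>u. f u + g u) u = partial i f u + partial i g u"
  unfolding partial_def using assms by (intro deriv_add laurent_differentiable)

lemma partial_mult: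
  assumes "laurent N f" "laurent N g" "u \<in> torus N" "i < N"
  shows "partial i (\<lambda>u. f u * g u) u = f u * partial i g u + partial i f u * g u"
  unfolding partial_def using assms
  by (subst deriv_mult) (auto intro!: laurent_differentiable)

lemma laurent_partial: "laurent N f \<Longrightarrow> i < N \<Longrightarrow> laurent N (partial i f)"
proof (induction rule: laurent.induct)
  case (const c)
  show ?case by (rule laurent.cong[OF laurent.const[of N 0]]) (auto simp: partial_def)
next
  case (var j)
  show ?case
    by (rule laurent.cong[OF laurent.const[of N "if i = j then 1 else 0"]])
       (auto simp: partial_def)
next
  case (inv j)
  have "partial i (\<lambda>u. inverse (u j)) u = (if i = j then -1 else 0) * (inverse (u j) * inverse (u j))"
    if "u \<in> torus N" for u
  proof (cases "i = j")
    case True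
    have "((\<lambda>z. inverse z) has_field_derivative - (inverse (u j) * inverse (u j))) (at (u j))"
      using that inv by (auto intro!: derivative_eq_intros simp: torus_def)
    then show ?thesis using True by (auto simp: partial_def DERIV_imp_deriv)
  qed (auto simp: partial_def)
  then show ?case
    by (rule laurent.cong[OF laurent_cmult[OF laurent.mult[OF laurent.inv[OF inv(1)] laurent.inv[OF inv(1)]]]])
next
  case (add f g)
  show ?case
    by (rule laurent.cong[OF laurent.add[OF add.IH(1,2)]])
       (use add.prems partial_add[OF add.hyps(1,2) _ add.prems] in simp_all)
next
  case (mult f g)
  have "laurent N (\<lambda>u. f u * partial i g u + partial i f u * g u)"
    using mult by (intro laurent_intros) auto
  then show ?case
    by (rule laurent.cong) (rule partial_mult[OF mult.hyps(1,2) _ mult.prems])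
next
  case (cong f g)
  show ?case
    by (rule laurent.cong[OF cong.IH[OF cong.prems]])
       (rule partial_cong[OF _ cong.prems cong.hyps(2)])
qed

text \<open>Quotients by differences of coordinates only make sense at points with distinct coordinates.
  This is what transports identities between such quotients to the base point \<open>(1, \<dots>, 1)\<close>.\<close>

lemma laurent_identity:
  assumes f: "laurent N f" and 0: "\<And>u. u \<in> torus N \<Longrightarrow> inj_on u {..<N} \<Longrightarrow> f u = 0"
    and u: "u \<in> torus N"
  shows "f u = 0"
proof -
  \<comment> \<open>Injectivity is dropped one coordinate at a time: a small change of coordinate \<open>j\<close> makes it
    different from the later ones, and \<open>f\<close> is continuous in it.\<close>
  have "\<forall>u\<in>torus N. inj_on u {j..<N} \<longrightarrow> f u = 0" if "j \<le> N" for j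
    using that
  proof (induction j)
    case 0
    then show ?case using assms(2) by (auto simp: atLeast0LessThan)
  next
    case (Suc j)
    show ?case
    proof (intro ballI impI)
      fix u assume u: "u \<in> torus N" "inj_on u {Suc j..<N}"
      let ?S = "insert 0 (u ` {Suc j..<N})"
      have "\<not> (u j) islimpt ?S" by (rule islimpt_finite) auto
      then have "\<forall>\<^sub>F z in at (u j). z \<notin> ?S" by (simp add: islimpt_iff_eventually)
      then have "\<forall>\<^sub>F z in at (u j). f (u(j := z)) = 0"
      proof eventually_elim
        case (elim z)
        have "{j..<N} = insert j {Suc j..<N}" using Suc.prems by auto
        then have "inj_on (u(j := z)) {j..<N}"
          using elim u(2) by (auto simp: inj_on_def)
        then show ?case using Suc elim u by (auto simp: torus_upd)
      qed
      then have "((\<lambda>z. f (u(j := z))) \<longlongrightarrow> 0) (at (u j))"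
        by (rule tendsto_eventually)
      moreover have "isCont (\<lambda>z. f (u(j := z))) (u j)"
        using laurent_differentiable[OF f u(1), of j] Suc.prems
          field_differentiable_imp_continuous_at by auto
      ultimately show "f u = 0"
        unfolding isCont_def using tendsto_unique[OF trivial_limit_at] by fastforce
    qed
  qed
  from this[of N] u show ?thesis by auto
qed

lemma laurent_eqI:
  assumes "laurent N f" "laurent N g" "\<And>u. u \<in> torus N \<Longrightarrow> inj_on u {..<N} \<Longrightarrow> f u = g u"
    and "u \<in> torus N"
  shows "f u = g u"
  using laurent_identity[OF laurent_diff[OF assms(1,2)] _ assms(4)] assms(3) by auto

section \<open>Divided differences of equivariant families\<close>

abbreviation swap :: "nat \<Rightarrow> nat \<Rightarrow> nat \<Rightarrow> nat" where
  "swap a b \<equiv> Transposition.transpose a b"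

text \<open>Permuting the coordinates permutes the members of the family. The typical example is
  \<open>u\<^sub>i\<^sup>m \<partial>\<^sub>i\<^sup>n f\<close> for symmetric \<open>f\<close>. Transpositions generate, so they are enough.\<close>

definition equivariant :: "nat \<Rightarrow> (nat \<Rightarrow> (nat \<Rightarrow> complex) \<Rightarrow> complex) \<Rightarrow> bool" where
  "equivariant N F \<longleftrightarrow> (\<forall>i<N. laurent N (F i)) \<and>
     (\<forall>a<N. \<forall>b<N. \<forall>i<N. \<forall>u\<in>torus N. F i (u \<circ> swap a b) = F (swap a b i) u)"

definition sym_laurent :: "nat \<Rightarrow> ((nat \<Rightarrow> complex) \<Rightarrow> complex) \<Rightarrow> bool" where
  "sym_laurent N f \<longleftrightarrow> laurent N f \<and> (\<forall>a<N. \<forall>b<N. \<forall>u\<in>torus N. f (u \<circ> swap a b) = f u)"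

text \<open>For \<open>F i u = h (u i)\<close> this is the classical divided difference of \<open>h\<close> at the nodes \<open>u i\<close>, \<open>i \<in> I\<close>.\<close>

definition divdiff :: "nat set \<Rightarrow> (nat \<Rightarrow> (nat \<Rightarrow> complex) \<Rightarrow> complex) \<Rightarrow> (nat \<Rightarrow> complex) \<Rightarrow> complex" where
  "divdiff I F u = (\<Sum>i\<in>I. F i u / (\<Prod>a\<in>I - {i}. u i - u a))"

lemma swap_less: "a < N \<Longrightarrow> b < N \<Longrightarrow> i < N \<Longrightarrow> swap a b i < (N::nat)"
  by (auto simp: Transposition.transpose_def)

lemma torus_swap: "u \<in> torus N \<Longrightarrow> a < N \<Longrightarrow> b < N \<Longrightarrow> u \<circ> swap a b \<in> torus N"
  using swap_less by (auto simp: torus_def)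

lemma divdiff_swap:
  assumes "equivariant N F" "I \<subseteq> {..<N}" "a < N" "b < N" "u \<in> torus N"
  shows "divdiff I F (u \<circ> swap a b) = divdiff (swap a b ` I) F u"
proof -
  have inj: "inj_on (swap a b) A" for A by (rule inj_on_subset[of _ UNIV]) auto
  have "divdiff (swap a b ` I) F u =
        (\<Sum>i\<in>I. F (swap a b i) u / (\<Prod>a'\<in>swap a b ` I - {swap a b i}. u (swap a b i) - u a'))"
    unfolding divdiff_def by (subst sum.reindex) (auto intro: inj)
  also have "\<dots> = divdiff I F (u \<circ> swap a b)"
    unfolding divdiff_def
  proof (intro sum.cong refl arg_cong2[where f="(/)"])
    fix i assume i: "i \<in> I"
    show "F (swap a b i) u = F i (u \<circ> swap a b)"
      using assms i by (auto simp: equivariant_def)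
    have "swap a b ` I - {swap a b i} = swap a b ` (I - {i})"
      using image_set_diff[OF inj[of UNIV], of I "{i}"] by simp
    then show "(\<Prod>a'\<in>swap a b ` I - {swap a b i}. u (swap a b i) - u a') =
               (\<Prod>a'\<in>I - {i}. (u \<circ> swap a b) i - (u \<circ> swap a b) a')"
      by (simp add: prod.reindex inj)
  qed
  finally show ?thesis by simp
qed

text \<open>The recursion of classical divided differences. It is a partial fraction identity in the nodes,
  so it holds for arbitrary families \<open>F\<close>.\<close>

lemma divdiff_rec:
  assumes fin: "finite I" and inj: "inj_on u I" and pq: "p \<in> I" "q \<in> I" "p \<noteq> q"
  shows "(u p - u q) * divdiff I F u = divdiff (I - {q}) F u - divdiff (I - {p}) F u"
proof -
  define J where "J = I - {p, q}"
  have I: "I = insert p (insert q J)" and J: "p \<notin> J" "q \<notin> J" "finite J"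
    using pq fin by (auto simp: J_def)
  have ne: "u i \<noteq> u j" if "i \<in> I" "j \<in> I" "i \<noteq> j" for i j
    using inj that by (auto simp: inj_on_def)
  have IpJ: "I - {q} = insert p J" "I - {p} = insert q J" using I J pq by auto
  define D where "D i = (\<Prod>a\<in>J - {i}. u i - u a)" for i
  have D0: "D i \<noteq> 0" if "i \<in> I" for i
    unfolding D_def using ne that I J by (auto simp: J(3))
  have e1: "(\<Prod>a\<in>I - {i}. u i - u a) = (u i - u p) * ((u i - u q) * D i)" if "i \<in> J" for i
  proof -
    have "I - {i} = insert p (insert q (J - {i}))" using that I J by auto
    then show ?thesis using J pq by (simp add: D_def)
  qed
  have e2: "(\<Prod>a\<in>insert p J - {i}. u i - u a) = (u i - u p) * D i" if "i \<in> J" for i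
  proof -
    have "insert p J - {i} = insert p (J - {i})" using that J by auto
    then show ?thesis using J pq by (simp add: D_def)
  qed
  have e3: "(\<Prod>a\<in>insert q J - {i}. u i - u a) = (u i - u q) * D i" if "i \<in> J" for i
  proof -
    have "insert q J - {i} = insert q (J - {i})" using that J by auto
    then show ?thesis using J pq by (simp add: D_def)
  qed
  have e4: "insert p J - {p} = J - {p}" "insert q J - {q} = J - {q}" 
    "I - {p} = insert q (J - {p})" "I - {q} = insert p (J - {q})"
    using I J pq by auto
  have "divdiff I F u = F p u / ((u p - u q) * D p) + F q u / ((u q - u p) * D q)
        + (\<Sum>i\<in>J. F i u / ((u i - u p) * ((u i - u q) * D i)))"
    unfolding divdiff_def using J pq e1
    by (subst (1) I) (simp add: e4 D_def)
  moreover have "divdiff (I - {q}) F u = F p u / D p + (\<Sum>i\<in>J. F i u / ((u i - u p) * D i))"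
    unfolding divdiff_def IpJ using J e2 by (simp add: e4 D_def)
  moreover have "divdiff (I - {p}) F u = F q u / D q + (\<Sum>i\<in>J. F i u / ((u i - u q) * D i))"
    unfolding divdiff_def IpJ using J e3 by (simp add: e4 D_def)
  moreover have "(u p - u q) * (F p u / ((u p - u q) * D p)) = F p u / D p"
    using ne[OF pq] by simp
  moreover have "(u p - u q) * (F q u / ((u q - u p) * D q)) = - (F q u / D q)"
    using ne[OF pq] D0 pq by (simp add: field_simps)
  moreover have "(u p - u q) * (\<Sum>i\<in>J. F i u / ((u i - u p) * ((u i - u q) * D i))) =
      (\<Sum>i\<in>J. F i u / ((u i - u p) * D i)) - (\<Sum>i\<in>J. F i u / ((u i - u q) * D i))"
    unfolding sum_distrib_left sum_subtractf[symmetric]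
  proof (rule sum.cong)
    fix i assume i: "i \<in> J"
    then have "u i \<noteq> u p" "u i \<noteq> u q" "D i \<noteq> 0" using ne I J D0 by auto
    then show "(u p - u q) * (F i u / ((u i - u p) * ((u i - u q) * D i))) =
        F i u / ((u i - u p) * D i) - F i u / ((u i - u q) * D i)"
      by (simp add: divide_simps) (simp add: algebra_simps)
  qed auto
  ultimately show ?thesis by (simp only: distrib_left) simp
qed

text \<open>By the recursion it has to be shown that \<open>u\<^sub>p - u\<^sub>q\<close> divides the difference of the two smaller
  divided differences. The transposition of \<open>p\<close> and \<open>q\<close> exchanges them by equivariance, so they agree
  where \<open>u\<^sub>p = u\<^sub>q\<close>.\<close>

lemma divdiff_laurent:
  assumes F: "equivariant N F"
  shows "I \<subseteq> {..<N} \<Longrightarrow> I \<noteq> {} \<Longrightarrow>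
    \<exists>g. laurent N g \<and> (\<forall>u\<in>torus N. inj_on u I \<longrightarrow> g u = divdiff I F u)"
proof (induction "card I" arbitrary: I rule: less_induct)
  case less
  have fin: "finite I" using less.prems finite_subset by blast
  show ?case
  proof (cases "\<exists>p q. p \<in> I \<and> q \<in> I \<and> p \<noteq> q")
    case False
    then obtain i where "I = {i}" using less.prems by (metis ex_in_conv insertCI insertE is_singletonI' is_singleton_def)
    then show ?thesis using F less.prems by (auto simp: equivariant_def divdiff_def)
  next
    case True
    then obtain p q where pq: "p \<in> I" "q \<in> I" "p \<noteq> q" by auto
    then have N: "p < N" "q < N" using less.prems by auto
    have ex: "\<exists>g. laurent N g \<and> (\<forall>u\<in>torus N. inj_on u (I - {x}) \<longrightarrow> g u = divdiff (I - {x}) F u)"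
      if "x = p \<or> x = q" for x
    proof (rule less.hyps)
      show "card (I - {x}) < card I"
        by (rule card_Diff1_less) (use that pq fin in auto)
    qed (use that pq less.prems in auto)
    obtain g1 where g1: "laurent N g1" "\<And>u. u\<in>torus N \<Longrightarrow> inj_on u (I - {q}) \<Longrightarrow> g1 u = divdiff (I - {q}) F u"
      using ex[of q] by auto
    obtain g2 where g2: "laurent N g2" "\<And>u. u\<in>torus N \<Longrightarrow> inj_on u (I - {p}) \<Longrightarrow> g2 u = divdiff (I - {p}) F u"
      using ex[of p] by auto
    let ?s = "swap p q"
    have im: "?s ` (I - {p}) = I - {q}"
      using pq by (auto simp: Transposition.transpose_def image_iff)
    have g12: "g1 u = g2 (u \<circ> ?s)" if "u \<in> torus N" for u
    proof (rule laurent_eqI[OF g1(1) _ _ that])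
      show "laurent N (\<lambda>u. g2 (u \<circ> ?s))"
        by (rule laurent_compose_index[OF g2(1)]) (use N swap_less in auto)
      fix u assume u: "u \<in> torus N" "inj_on u {..<N}"
      have "inj_on (u \<circ> ?s) {..<N}"
        using u(2) N by (intro comp_inj_on inj_on_subset[OF u(2)])
          (auto simp: swap_less intro: inj_on_subset[of _ UNIV])
      then have "g2 (u \<circ> ?s) = divdiff (I - {p}) F (u \<circ> ?s)"
        using less.prems by (intro g2(2) torus_swap u N) (meson Diff_subset inj_on_subset order_trans)
      also have "\<dots> = divdiff (I - {q}) F u"
        using divdiff_swap[OF F _ N u(1), of "I - {p}"] less.prems im by auto
      also have "\<dots> = g1 u"
        using u less.prems by (intro g1(2)[symmetric]) (meson Diff_subset inj_on_subset order_trans)+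
      finally show "g1 u = g2 (u \<circ> ?s)" ..
    qed
    obtain h where h: "laurent N h"
      "\<And>u. u\<in>torus N \<Longrightarrow> g1 u - g2 u - (g1 (u(p := u q)) - g2 (u(p := u q))) = (u p - u q) * h u"
      using laurent_div[OF laurent_diff[OF g1(1) g2(1)] N] by auto
    have "h u = divdiff I F u" if u: "u \<in> torus N" "inj_on u I" for u
    proof -
      have "u(p := u q) \<circ> ?s = u(p := u q)"
        by (auto simp: Transposition.transpose_def fun_eq_iff)
      then have "g1 (u(p := u q)) = g2 (u(p := u q))"
        using g12[of "u(p := u q)"] u torus_upd_eq N by auto
      then have "(u p - u q) * h u = g1 u - g2 u" using h(2)[OF u(1)] by simp
      also have "\<dots> = divdiff (I - {q}) F u - divdiff (I - {p}) F u"
        using g1(2)[OF u(1) inj_on_subset[OF u(2)]] g2(2)[OF u(1) inj_on_subset[OF u(2)]] by simp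
      also have "\<dots> = (u p - u q) * divdiff I F u"
        using divdiff_rec[OF fin u(2) pq] by simp
      finally show ?thesis using u(2) pq by (auto simp: inj_on_def)
    qed
    with h(1) show ?thesis by auto
  qed
qed

text \<open>The value at the base point of the Laurent polynomial that extends the divided difference. It
  does not depend on the choice, since a Laurent polynomial is determined on the torus by its values
  at points with distinct coordinates.\<close>

definition ddval :: "nat \<Rightarrow> nat set \<Rightarrow> (nat \<Rightarrow> (nat \<Rightarrow> complex) \<Rightarrow> complex) \<Rightarrow> complex" where
  "ddval N I F = (SOME g. laurent N g \<and>
     (\<forall>u\<in>torus N. inj_on u {..<N} \<longrightarrow> g u = divdiff I F u)) (\<lambda>_. 1)"

lemma ddval_eq:
  assumes "laurent N g" "\<And>u. u\<in>torus N \<Longrightarrow> inj_on u {..<N} \<Longrightarrow> g u = divdiff I F u"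
  shows "ddval N I F = g (\<lambda>_. 1)"
proof -
  let ?P = "\<lambda>g. laurent N g \<and> (\<forall>u\<in>torus N. inj_on u {..<N} \<longrightarrow> g u = divdiff I F u)"
  have "?P g" using assms by auto
  then have P: "?P (SOME g. ?P g)" by (rule someI[of ?P])
  show ?thesis unfolding ddval_def
    by (rule laurent_eqI[OF conjunct1[OF P] assms(1) _ torus_one]) (use assms(2) P in auto)
qed

lemma ddval_obtain:
  assumes "equivariant N F" "I \<subseteq> {..<N}" "I \<noteq> {}"
  obtains g where "laurent N g" "\<And>u. u\<in>torus N \<Longrightarrow> inj_on u I \<Longrightarrow> g u = divdiff I F u"
    "ddval N I F = g (\<lambda>_. 1)"
proof -
  obtain g where g: "laurent N g" "\<And>u. u\<in>torus N \<Longrightarrow> inj_on u I \<Longrightarrow> g u = divdiff I F u"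
    using divdiff_laurent[OF assms] by auto
  have "ddval N I F = g (\<lambda>_. 1)"
    by (rule ddval_eq[OF g(1)], rule g(2)) (use assms(2) in \<open>auto elim: inj_on_subset\<close>)
  then show ?thesis using that g by blast
qed

lemma sym_laurent_D: "sym_laurent N f \<Longrightarrow> laurent N f"
  by (simp add: sym_laurent_def)

lemma sym_laurent_const: "sym_laurent N (\<lambda>u. c)"
  by (simp add: sym_laurent_def laurent.const)

lemma sym_laurent_add: "sym_laurent N f \<Longrightarrow> sym_laurent N g \<Longrightarrow> sym_laurent N (\<lambda>u. f u + g u)"
  by (simp add: sym_laurent_def laurent.add)

lemma sym_laurent_mult: "sym_laurent N f \<Longrightarrow> sym_laurent N g \<Longrightarrow> sym_laurent N (\<lambda>u. f u * g u)"
  by (simp add: sym_laurent_def laurent.mult)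

lemma sym_laurent_cmult: "sym_laurent N f \<Longrightarrow> sym_laurent N (\<lambda>u. c * f u)"
  by (intro sym_laurent_mult sym_laurent_const)

lemma sym_laurent_diff: "sym_laurent N f \<Longrightarrow> sym_laurent N g \<Longrightarrow> sym_laurent N (\<lambda>u. f u - g u)"
  by (simp add: sym_laurent_def laurent_diff)

lemma sym_laurent_power: "sym_laurent N f \<Longrightarrow> sym_laurent N (\<lambda>u. f u ^ n)"
  by (simp add: sym_laurent_def laurent_power)

lemma sym_laurent_sum:
  "(\<And>x. x \<in> A \<Longrightarrow> sym_laurent N (f x)) \<Longrightarrow> sym_laurent N (\<lambda>u. \<Sum>x\<in>A. f x u)"
  by (auto simp: sym_laurent_def intro!: laurent_sum)

lemma bij_betw_swap: "a < N \<Longrightarrow> b < N \<Longrightarrow> bij_betw (swap a b) {..<N} {..<N}"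
  by (rule bij_betw_byWitness[where f'="swap a b"]) (auto simp: swap_less)

lemma laurent_poly_in: "i < N \<Longrightarrow> laurent N (\<lambda>u. poly p (u i))"
  by (induction p) (auto intro!: laurent_intros)

lemma sym_laurent_sum_poly: "sym_laurent N (\<lambda>u. \<Sum>i<N. poly p (u i))"
proof -
  have "(\<Sum>i<N. poly p (u (swap a b i))) = (\<Sum>i<N. poly p (u i))" if "a < N" "b < N" for a b u
    using bij_betw_swap[OF that] by (rule sum.reindex_bij_betw)
  then show ?thesis
    by (auto simp: sym_laurent_def intro!: laurent_sum laurent_poly_in)
qed

lemma sym_laurent_prod_poly: "sym_laurent N (\<lambda>u. \<Prod>i<N. poly p (u i))"
proof -
  have "(\<Prod>i<N. poly p (u (swap a b i))) = (\<Prod>i<N. poly p (u i))" if "a < N" "b < N" for a b u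
    using bij_betw_swap[OF that] by (rule prod.reindex_bij_betw)
  then show ?thesis
    by (auto simp: sym_laurent_def intro!: laurent_prod laurent_poly_in)
qed

lemma equivariant_laurent: "equivariant N F \<Longrightarrow> i < N \<Longrightarrow> laurent N (F i)"
  by (simp add: equivariant_def)

lemma equivariant_sym: "sym_laurent N f \<Longrightarrow> equivariant N (\<lambda>i. f)"
  by (simp add: sym_laurent_def equivariant_def)

lemma equivariant_add:
  "equivariant N F \<Longrightarrow> equivariant N G \<Longrightarrow> equivariant N (\<lambda>i u. F i u + G i u)"
  by (simp add: equivariant_def laurent.add swap_less)

lemma equivariant_mult:
  "equivariant N F \<Longrightarrow> equivariant N G \<Longrightarrow> equivariant N (\<lambda>i u. F i u * G i u)"
  by (simp add: equivariant_def laurent.mult swap_less)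

lemma equivariant_cong:
  assumes "equivariant N F" "\<And>i u. i < N \<Longrightarrow> u \<in> torus N \<Longrightarrow> G i u = F i u"
  shows "equivariant N G"
  unfolding equivariant_def
proof (intro conjI allI impI ballI)
  fix i assume "i < N"
  then show "laurent N (G i)"
    using assms by (intro laurent.cong[OF equivariant_laurent[OF assms(1)]]) auto
next
  fix a b i u assume *: "a < N" "b < N" "i < N" "u \<in> torus N"
  show "G i (u \<circ> swap a b) = G (swap a b i) u"
    using * assms torus_swap[OF *(4,1,2)] swap_less[OF *(1-3)] by (simp add: equivariant_def)
qed

lemma equivariant_power_var: "equivariant N (\<lambda>i u. u i ^ m)"
  by (auto simp: equivariant_def intro!: laurent_power laurent.var)

lemma equivariant_partial:
  assumes F: "equivariant N F"
  shows "equivariant N (\<lambda>i. partial i (F i))"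
  unfolding equivariant_def
proof (intro conjI allI impI ballI)
  fix i assume "i < N"
  then show "laurent N (partial i (F i))"
    using F by (intro laurent_partial) (auto simp: equivariant_def)
next
  fix a b i u assume *: "a < N" "b < N" "i < N" "u \<in> torus N"
  let ?s = "swap a b"
  have ne: "u (?s i) \<noteq> 0" using * swap_less[OF *(1-3)] by (auto simp: torus_def)
  have "partial i (F i) (u \<circ> ?s) = deriv (\<lambda>z. F i ((u \<circ> ?s)(i := z))) (u (?s i))"
    by (simp add: partial_def)
  also have "\<dots> = deriv (\<lambda>z. F (?s i) (u(?s i := z))) (u (?s i))"
  proof (rule deriv_cong_ev)
    have "\<forall>\<^sub>F z in nhds (u (?s i)). z \<in> -{0}"
      by (rule eventually_nhds_in_open) (use ne in auto)
    then show "\<forall>\<^sub>F z in nhds (u (?s i)). F i ((u \<circ> ?s)(i := z)) = F (?s i) (u(?s i := z))"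
    proof eventually_elim
      case (elim z)
      have "(u \<circ> ?s)(i := z) = u(?s i := z) \<circ> ?s"
        by (auto simp: fun_eq_iff Transposition.transpose_def)
      then show ?case
        using F * elim torus_upd[OF *(4), of z "?s i"] by (simp add: equivariant_def)
    qed
  qed auto
  finally show "partial i (F i) (u \<circ> ?s) = partial (?s i) (F (?s i)) u"
    by (simp add: partial_def)
qed

lemma equivariant_partial_iter:
  "equivariant N F \<Longrightarrow> equivariant N (\<lambda>i. (partial i ^^ n) (F i))"
proof (induction n)
  case (Suc n)
  then show ?case using equivariant_partial[of N "\<lambda>i. (partial i ^^ n) (F i)"] by simp
qed simp

lemma laurent_partial_iter: "laurent N f \<Longrightarrow> i < N \<Longrightarrow> laurent N ((partial i ^^ n) f)"
  by (induction n) (auto intro: laurent_partial)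

lemma ddval_cong:
  assumes "\<And>i u. i \<in> I \<Longrightarrow> u \<in> torus N \<Longrightarrow> F i u = G i u"
  shows "ddval N I F = ddval N I G"
proof -
  have "divdiff I F u = divdiff I G u" if "u \<in> torus N" for u
    using assms that by (auto simp: divdiff_def intro!: sum.cong)
  then show ?thesis by (simp add: ddval_def cong: conj_cong ball_cong)
qed

lemma ddval_add:
  assumes "equivariant N F" "equivariant N G" "I \<subseteq> {..<N}" "I \<noteq> {}"
  shows "ddval N I (\<lambda>i u. F i u + G i u) = ddval N I F + ddval N I G"
proof -
  obtain f where f: "laurent N f" "\<And>u. u\<in>torus N \<Longrightarrow> inj_on u I \<Longrightarrow> f u = divdiff I F u"
    "ddval N I F = f (\<lambda>_. 1)" using ddval_obtain[OF assms(1,3,4)] by metis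
  obtain g where g: "laurent N g" "\<And>u. u\<in>torus N \<Longrightarrow> inj_on u I \<Longrightarrow> g u = divdiff I G u"
    "ddval N I G = g (\<lambda>_. 1)" using ddval_obtain[OF assms(2,3,4)] by metis
  show ?thesis unfolding f(3) g(3)
  proof (rule ddval_eq)
    fix u assume "u \<in> torus N" and inj: "inj_on u {..<N}"
    then show "f u + g u = divdiff I (\<lambda>i u. F i u + G i u) u"
      using f(2)[of u] g(2)[of u] inj_on_subset[OF inj assms(3)]
      by (simp add: divdiff_def add_divide_distrib sum.distrib)
  qed (use f g in \<open>intro laurent.add\<close>)
qed

text \<open>A symmetric factor does not depend on the index \<open>i\<close>, so it can be taken out of the sum that
  defines the divided difference.\<close>

lemma ddval_sym_mult:
  assumes "sym_laurent N a" "equivariant N F" "I \<subseteq> {..<N}" "I \<noteq> {}"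
  shows "ddval N I (\<lambda>i u. a u * F i u) = a (\<lambda>_. 1) * ddval N I F"
proof -
  obtain f where f: "laurent N f" "\<And>u. u\<in>torus N \<Longrightarrow> inj_on u I \<Longrightarrow> f u = divdiff I F u"
    "ddval N I F = f (\<lambda>_. 1)" using ddval_obtain[OF assms(2,3,4)] by metis
  show ?thesis unfolding f(3)
  proof (rule ddval_eq)
    fix u assume "u \<in> torus N" and inj: "inj_on u {..<N}"
    then show "a u * f u = divdiff I (\<lambda>i u. a u * F i u) u"
      using f(2)[of u] inj_on_subset[OF inj assms(3)]
      by (simp add: divdiff_def sum_distrib_left)
  qed (rule laurent.mult[OF sym_laurent_D[OF assms(1)] f(1)])
qed

lemma ddval_swap:
  assumes "equivariant N F" "I \<subseteq> {..<N}" "I \<noteq> {}" "a < N" "b < N"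
  shows "ddval N (swap a b ` I) F = ddval N I F"
proof -
  obtain f where f: "laurent N f" "\<And>u. u\<in>torus N \<Longrightarrow> inj_on u I \<Longrightarrow> f u = divdiff I F u"
    "ddval N I F = f (\<lambda>_. 1)" using ddval_obtain[OF assms(1-3)] by metis
  have "ddval N (swap a b ` I) F = f ((\<lambda>_. 1) \<circ> swap a b)"
  proof (rule ddval_eq)
    show "laurent N (\<lambda>u. f (u \<circ> swap a b))"
      by (rule laurent_compose_index[OF f(1)]) (use assms swap_less in auto)
    fix u assume u: "u \<in> torus N" "inj_on u {..<N}"
    have "inj_on (u \<circ> swap a b) I"
      using u(2) assms by (intro comp_inj_on inj_on_subset[OF u(2)])
        (auto simp: swap_less intro: inj_on_subset[of _ UNIV])
    then show "f (u \<circ> swap a b) = divdiff (swap a b ` I) F u"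
      using divdiff_swap[OF assms(1,2,4,5) u(1)] f(2) torus_swap[OF u(1)] assms by simp
  qed
  also have "(\<lambda>_. 1::complex) \<circ> swap a b = (\<lambda>_. 1)" by auto
  finally show ?thesis by (simp add: f(3))
qed

section \<open>Orders of vanishing and the bracket functional\<close>

text \<open>The \<open>k\<close>-th power of the ideal generated by the symmetric Laurent polynomials that vanish at the
  base point, inside the module of equivariant families.\<close>

inductive ideal_pow :: "nat \<Rightarrow> nat \<Rightarrow> (nat \<Rightarrow> (nat \<Rightarrow> complex) \<Rightarrow> complex) \<Rightarrow> bool" for N where
  base: "equivariant N F \<Longrightarrow> ideal_pow N 0 F"
| step: "sym_laurent N a \<Longrightarrow> a (\<lambda>_. 1) = 0 \<Longrightarrow> ideal_pow N k F \<Longrightarrow>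
           ideal_pow N (Suc k) (\<lambda>i u. a u * F i u)"
| add: "ideal_pow N k F \<Longrightarrow> ideal_pow N k G \<Longrightarrow> ideal_pow N k (\<lambda>i u. F i u + G i u)"
| cong: "ideal_pow N k F \<Longrightarrow> (\<And>i u. i < N \<Longrightarrow> u \<in> torus N \<Longrightarrow> G i u = F i u) \<Longrightarrow> ideal_pow N k G"

lemma ideal_pow_equivariant: "ideal_pow N k F \<Longrightarrow> equivariant N F"
proof (induction rule: ideal_pow.induct)
  case (step a k F)
  then show ?case by (intro equivariant_mult[OF equivariant_sym])
next
  case (cong k F G)
  then show ?case by (intro equivariant_cong[OF cong.IH])
qed (auto intro: equivariant_add)

lemma ideal_pow_ddval:
  "ideal_pow N k F \<Longrightarrow> 0 < k \<Longrightarrow> I \<subseteq> {..<N} \<Longrightarrow> I \<noteq> {} \<Longrightarrow> ddval N I F = 0"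
proof (induction rule: ideal_pow.induct)
  case (step a k F)
  then show ?case using ddval_sym_mult[OF step.hyps(1) ideal_pow_equivariant[OF step.hyps(3)]] by simp
next
  case (add k F G)
  then show ?case using ddval_add[OF add.hyps(1,2)[THEN ideal_pow_equivariant]] by simp
next
  case (cong k F G)
  then show ?case using ddval_cong[of I N G F] by auto
qed auto

lemma ideal_pow_mult:
  "ideal_pow N k F \<Longrightarrow> equivariant N G \<Longrightarrow> ideal_pow N k (\<lambda>i u. F i u * G i u)"
proof (induction rule: ideal_pow.induct)
  case (base F)
  then show ?case by (intro ideal_pow.base equivariant_mult)
next
  case (step a k F)
  show ?case
    by (rule ideal_pow.cong[OF ideal_pow.step[OF step.hyps(1,2) step.IH[OF step.prems]]])
       (simp add: mult.assoc)
next
  case (add k F F')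
  show ?case
    by (rule ideal_pow.cong[OF ideal_pow.add[OF add.IH(1)[OF add.prems] add.IH(2)[OF add.prems]]])
       (simp add: distrib_right)
next
  case (cong k F F')
  show ?case
    by (rule ideal_pow.cong[OF cong.IH[OF cong.prems]]) (use cong.hyps(2) in auto)
qed

text \<open>By the product rule, a derivative removes at most one of the vanishing factors.\<close>

lemma ideal_pow_partial: "ideal_pow N k F \<Longrightarrow> ideal_pow N (k - 1) (\<lambda>i. partial i (F i))"
proof (induction rule: ideal_pow.induct)
  case (base F)
  show ?case using ideal_pow.base[OF equivariant_partial[OF base]] by simp
next
  case (step a k F)
  note F = ideal_pow_equivariant[OF step.hyps(3)]
  have a: "equivariant N (\<lambda>i. a)" by (rule equivariant_sym[OF step.hyps(1)])
  have 1: "ideal_pow N k (\<lambda>i u. F i u * partial i a u)"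
    by (rule ideal_pow_mult[OF step.hyps(3) equivariant_partial[OF a]])
  have 2: "ideal_pow N k (\<lambda>i u. a u * partial i (F i) u)"
  proof (cases k)
    case 0
    then show ?thesis
      using ideal_pow.base[OF equivariant_mult[OF a equivariant_partial[OF F]]] by simp
  next
    case (Suc k')
    then show ?thesis using ideal_pow.step[OF step.hyps(1,2) step.IH] by simp
  qed
  show ?case
  proof (rule ideal_pow.cong)
    show "ideal_pow N (Suc k - 1) (\<lambda>i u. a u * partial i (F i) u + F i u * partial i a u)"
      using ideal_pow.add[OF 2 1] by simp
    fix i u assume "i < N" "u \<in> torus N"
    then show "partial i (\<lambda>u. a u * F i u) u = a u * partial i (F i) u + F i u * partial i a u"
      using partial_mult[OF sym_laurent_D[OF step.hyps(1)] equivariant_laurent[OF F]] by simp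
  qed
next
  case (add k F G)
  show ?case
  proof (rule ideal_pow.cong[OF ideal_pow.add[OF add.IH]])
    fix i u assume "i < N" "u \<in> torus N"
    then show "partial i (\<lambda>u. F i u + G i u) u = partial i (F i) u + partial i (G i) u"
      using partial_add[OF equivariant_laurent[OF ideal_pow_equivariant[OF add.hyps(1)]]
          equivariant_laurent[OF ideal_pow_equivariant[OF add.hyps(2)]]] by blast
  qed
next
  case (cong k F G)
  show ?case
    by (rule ideal_pow.cong[OF cong.IH])
       (rule partial_cong[OF _ _ cong.hyps(2)])
qed

lemma ideal_pow_partial_iter:
  "ideal_pow N k F \<Longrightarrow> ideal_pow N (k - n) (\<lambda>i. (partial i ^^ n) (F i))"
proof (induction n)
  case (Suc n)
  have "k - Suc n = k - n - 1" by simp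
  then show ?case using ideal_pow_partial[OF Suc.IH[OF Suc.prems]]
    by (simp only: funpow.simps o_apply)
qed simp

lemma ideal_pow_power:
  assumes "sym_laurent N a" "a (\<lambda>_. 1) = 0" "ideal_pow N k F"
  shows "ideal_pow N (q + k) (\<lambda>i u. a u ^ q * F i u)"
proof (induction q)
  case (Suc q)
  show ?case
    using ideal_pow.step[OF assms(1,2) Suc.IH] by (simp add: mult.assoc)
qed (use assms in simp)

text \<open>The linear functional through which the expected power sums depend on the Schur generating
  function in \<open>r\<close> variables.\<close>

definition bracket :: "nat \<Rightarrow> nat \<Rightarrow> nat \<Rightarrow> ((nat \<Rightarrow> complex) \<Rightarrow> complex) \<Rightarrow> complex" where
  "bracket r m n f = ddval r {..<r} (\<lambda>i u. u i ^ m * (partial i ^^ n) f u)"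

lemma bracket_family: "sym_laurent r f \<Longrightarrow> equivariant r (\<lambda>i u. u i ^ m * (partial i ^^ n) f u)"
  by (intro equivariant_mult equivariant_power_var equivariant_partial_iter[OF equivariant_sym])

text \<open>More vanishing factors than derivatives: at least one factor survives and annihilates the
  divided difference at the base point.\<close>

lemma bracket_ideal:
  assumes "ideal_pow r k (\<lambda>i. f)" "n < k" "r > 0"
  shows "bracket r m n f = 0"
proof -
  have "ideal_pow r (k - n) (\<lambda>i u. (partial i ^^ n) f u * u i ^ m)"
    using ideal_pow_mult[OF ideal_pow_partial_iter[OF assms(1)] equivariant_power_var] .
  then have "ddval r {..<r} (\<lambda>i u. (partial i ^^ n) f u * u i ^ m) = 0"
    using assms(2,3) by (intro ideal_pow_ddval[where k="k-n"]) (auto simp: lessThan_empty_iff)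
  then show ?thesis by (simp add: bracket_def mult.commute)
qed

lemma bracket_power_gt:
  assumes "sym_laurent r a" "a (\<lambda>_. 1) = 0" "sym_laurent r f" "n < q" "r > 0"
  shows "bracket r m n (\<lambda>u. a u ^ q * f u) = 0"
  using ideal_pow_power[OF assms(1,2) ideal_pow.base[OF equivariant_sym[OF assms(3)]], of q]
    bracket_ideal[OF _ assms(4,5)] by simp

text \<open>Here the last vanishing factor is supplied by \<open>f\<close> instead of by a further power of \<open>a\<close>.\<close>

lemma bracket_power_eq:
  assumes "sym_laurent r a" "a (\<lambda>_. 1) = 0" "sym_laurent r f" "f (\<lambda>_. 1) = 0" "r > 0"
  shows "bracket r m n (\<lambda>u. a u ^ n * f u) = 0"
proof -
  have "ideal_pow r 1 (\<lambda>i u. f u * 1)"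
    using ideal_pow.step[OF assms(3,4) ideal_pow.base[OF equivariant_sym[OF sym_laurent_const[of r 1]]]]
    by simp
  then have "ideal_pow r 1 (\<lambda>i. f)" by simp
  from ideal_pow_power[OF assms(1,2) this, of n] show ?thesis
    by (intro bracket_ideal[OF _ _ assms(5)]) auto
qed

lemma partial_iter_add:
  assumes "laurent N f" "laurent N g" "i < N"
  shows "u \<in> torus N \<Longrightarrow>
    (partial i ^^ n) (\<lambda>u. f u + g u) u = (partial i ^^ n) f u + (partial i ^^ n) g u"
proof (induction n arbitrary: u)
  case (Suc n)
  have "partial i ((partial i ^^ n) (\<lambda>u. f u + g u)) u
      = partial i (\<lambda>u. (partial i ^^ n) f u + (partial i ^^ n) g u) u"
    by (rule partial_cong[OF Suc.prems assms(3) Suc.IH])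
  also have "\<dots> = partial i ((partial i ^^ n) f) u + partial i ((partial i ^^ n) g) u"
    by (rule partial_add[OF laurent_partial_iter[OF assms(1,3)] laurent_partial_iter[OF assms(2,3)] Suc.prems assms(3)])
  finally show ?case by simp
qed simp

lemma partial_iter_cmult:
  assumes "laurent N f" "i < N"
  shows "u \<in> torus N \<Longrightarrow> (partial i ^^ n) (\<lambda>u. c * f u) u = c * (partial i ^^ n) f u"
proof (induction n arbitrary: u)
  case (Suc n)
  have "partial i ((partial i ^^ n) (\<lambda>u. c * f u)) u = partial i (\<lambda>u. c * (partial i ^^ n) f u) u"
    by (rule partial_cong[OF Suc.prems assms(2) Suc.IH])
  also have "\<dots> = c * partial i ((partial i ^^ n) f) u"
    using partial_mult[OF laurent.const laurent_partial_iter[OF assms, of n] Suc.prems assms(2), of c]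
    by (simp add: partial_def)
  finally show ?case by simp
qed simp

lemma bracket_add:
  assumes "sym_laurent r f" "sym_laurent r g" "r > 0"
  shows "bracket r m n (\<lambda>u. f u + g u) = bracket r m n f + bracket r m n g"
  unfolding bracket_def
  using assms partial_iter_add[OF assms(1,2)[THEN sym_laurent_D]]
  by (subst ddval_add[OF bracket_family[OF assms(1)] bracket_family[OF assms(2)], symmetric])
     (auto intro!: ddval_cong simp: lessThan_empty_iff distrib_left)

lemma bracket_cmult:
  assumes "sym_laurent r f" "r > 0"
  shows "bracket r m n (\<lambda>u. c * f u) = c * bracket r m n f"
  unfolding bracket_def
  using assms partial_iter_cmult[OF sym_laurent_D[OF assms(1)]]
  by (subst ddval_sym_mult[OF sym_laurent_const bracket_family[OF assms(1)], symmetric])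
     (auto intro!: ddval_cong simp: lessThan_empty_iff)

lemma bracket_diff:
  assumes "sym_laurent r f" "sym_laurent r g" "r > 0"
  shows "bracket r m n (\<lambda>u. f u - g u) = bracket r m n f - bracket r m n g"
  using bracket_add[OF assms(1) sym_laurent_cmult[OF assms(2), of "-1"] assms(3)]
    bracket_cmult[OF assms(2,3), of m n "-1"] by simp

lemma bracket_sum:
  assumes "finite A" "\<And>x. x \<in> A \<Longrightarrow> sym_laurent r (f x)" "r > 0"
  shows "bracket r m n (\<lambda>u. \<Sum>x\<in>A. f x u) = (\<Sum>x\<in>A. bracket r m n (f x))"
  using assms(1,2)
proof (induction A rule: finite_induct)
  case empty
  then show ?case using bracket_cmult[OF sym_laurent_const[of r 0] assms(3), of m n 0] by simp
next
  case (insert x A)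
  then show ?case
    using bracket_add[OF insert.prems[of x] sym_laurent_sum[of A r f] assms(3)] by simp
qed

section \<open>Rational Schur functions by the branching rule\<close>

definition strict_dec :: "nat \<Rightarrow> (nat \<Rightarrow> int) \<Rightarrow> bool" where
  "strict_dec N l \<longleftrightarrow> (\<forall>j. Suc j < N \<longrightarrow> l (Suc j) < l j)"

text \<open>In the shifted exponents \<open>l\<^sub>j = \<lambda>\<^sub>j + N - j\<close>, the usual interlacing
  \<open>\<lambda>\<^bsub>j+1\<^esub> \<le> \<mu>\<^sub>j \<le> \<lambda>\<^sub>j\<close> of signatures reads \<open>l\<^bsub>j+1\<^esub> \<le> p\<^sub>j < l\<^sub>j\<close>.\<close>

definition interlacing :: "nat \<Rightarrow> (nat \<Rightarrow> int) \<Rightarrow> (nat \<Rightarrow> int) set" where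
  "interlacing N l = PiE {..<N} (\<lambda>j. {l (Suc j)..<l j})"

text \<open>The rational Schur function as the generating function of Gelfand-Tsetlin patterns, by
  recursion on the number of variables (branching rule). In contrast to the quotient of determinants
  it makes sense when coordinates coincide and shows that the coefficients are nonnegative.\<close>

primrec gt_schur :: "nat \<Rightarrow> (nat \<Rightarrow> int) \<Rightarrow> (nat \<Rightarrow> complex) \<Rightarrow> complex" where
  "gt_schur 0 l u = 1"
| "gt_schur (Suc N) l u = (\<Sum>p\<in>interlacing N l.
     gt_schur N p u * u N powi (l N + (\<Sum>j<N. l j - 1 - p j)))"

definition vdm :: "nat \<Rightarrow> (nat \<Rightarrow> complex) \<Rightarrow> complex" where
  "vdm N u = (\<Prod>j<N. \<Prod>i<j. u i - u j)"

definition alt_mat :: "nat \<Rightarrow> (nat \<Rightarrow> int) \<Rightarrow> (nat \<Rightarrow> complex) \<Rightarrow> complex mat" where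
  "alt_mat N l u = Matrix.mat N N (\<lambda>(i, j). u i powi l j)"

lemma finite_interlacing [simp]: "finite (interlacing N l)"
  by (auto simp: interlacing_def intro: finite_PiE)

lemma strict_dec_interlacing: "strict_dec (Suc N) l \<Longrightarrow> p \<in> interlacing N l \<Longrightarrow> strict_dec N p"
  unfolding strict_dec_def
proof (intro allI impI)
  fix j assume "p \<in> interlacing N l" "Suc j < N"
  then have "p (Suc j) < l (Suc j)" "l (Suc j) \<le> p j"
    by (auto simp: interlacing_def PiE_iff)
  then show "p (Suc j) < p j" by simp
qed

lemma geometric_powi:
  fixes x w :: complex
  assumes "x \<noteq> 0" "w \<noteq> 0" "b \<le> a"
  shows "x powi a - w powi (a - b) * x powi b = (x - w) * (\<Sum>p\<in>{b..<a}. x powi p * w powi (a - 1 - p))"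
proof -
  have "x powi (b + int n) - w powi (int n) * x powi b =
     (x - w) * (\<Sum>p\<in>{b..<b + int n}. x powi p * w powi (b + int n - 1 - p))" for n
  proof (induction n)
    case (Suc n)
    have set: "{b..<b + int (Suc n)} = insert (b + int n) {b..<b + int n}" by auto
    have "(\<Sum>p\<in>{b..<b + int (Suc n)}. x powi p * w powi (b + int (Suc n) - 1 - p)) =
       x powi (b + int n) + (\<Sum>p\<in>{b..<b + int n}. w * (x powi p * w powi (b + int n - 1 - p)))"
      unfolding set
    proof (subst sum.insert)
      show "x powi (b + int n) * w powi (b + int (Suc n) - 1 - (b + int n)) +
            (\<Sum>p\<in>{b..<b + int n}. x powi p * w powi (b + int (Suc n) - 1 - p)) =
            x powi (b + int n) + (\<Sum>p\<in>{b..<b + int n}. w * (x powi p * w powi (b + int n - 1 - p)))"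
      proof (intro arg_cong2[where f="(+)"] sum.cong refl)
        fix p
        have "w powi (b + int (Suc n) - 1 - p) = w * w powi (b + int n - 1 - p)"
          using power_int_add_1'[OF disjI1[OF assms(2)], of "b + int n - 1 - p"]
          by (simp add: algebra_simps)
        then show "x powi p * w powi (b + int (Suc n) - 1 - p) = w * (x powi p * w powi (b + int n - 1 - p))"
          by simp
      qed simp
    qed auto
    then have "(x - w) * (\<Sum>p\<in>{b..<b + int (Suc n)}. x powi p * w powi (b + int (Suc n) - 1 - p)) =
       (x - w) * x powi (b + int n) + w * ((x - w) * (\<Sum>p\<in>{b..<b + int n}. x powi p * w powi (b + int n - 1 - p)))"
      by (simp add: sum_distrib_left algebra_simps)
    also have "\<dots> = (x - w) * x powi (b + int n) + w * (x powi (b + int n) - w powi (int n) * x powi b)"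
      by (simp only: Suc)
    also have "\<dots> = x powi (b + int (Suc n)) - w powi (int (Suc n)) * x powi b"
    proof -
      have "x powi (b + int (Suc n)) = x * x powi (b + int n)"
        using power_int_add_1'[OF disjI1[OF assms(1)], of "b + int n"] by (simp add: algebra_simps)
      moreover have "w powi int (Suc n) = w * w powi int n"
        by (simp only: power_int_of_nat power_Suc)
      ultimately show ?thesis by (simp add: algebra_simps)
    qed
    finally show ?case by simp
  qed simp
  from this[of "nat (a - b)"] assms(3) show ?thesis by simp
qed

text \<open>Linearity in the rows and multilinearity in the columns.\<close>

lemma det_col_sums:
  fixes a :: "nat \<Rightarrow> complex" and g :: "nat \<Rightarrow> nat \<Rightarrow> int \<Rightarrow> complex"
  assumes "\<And>j. j < n \<Longrightarrow> finite (S j)"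
  shows "Determinant.det (Matrix.mat n n (\<lambda>(i, j). a i * (\<Sum>p\<in>S j. g i j p))) =
    (\<Prod>i<n. a i) * (\<Sum>p\<in>PiE {..<n} S. Determinant.det (Matrix.mat n n (\<lambda>(i, j). g i j (p j))))"
proof -
  have "Determinant.det (Matrix.mat n n (\<lambda>(i, j). a i * (\<Sum>p\<in>S j. g i j p))) =
     (\<Sum>\<sigma> | \<sigma> permutes {0..<n}. signof \<sigma> * (\<Prod>j<n. a (\<sigma> j) * (\<Sum>p\<in>S j. g (\<sigma> j) j p)))"
    by (subst det_col[of _ n])
       (auto intro!: sum.cong prod.cong dest: permutes_in_image)
  also have "\<dots> = (\<Sum>\<sigma> | \<sigma> permutes {0..<n}. signof \<sigma> * ((\<Prod>i<n. a i) * (\<Sum>p\<in>PiE {..<n} S. \<Prod>j<n. g (\<sigma> j) j (p j))))"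
  proof (intro sum.cong refl arg_cong2[where f="(*)"])
    fix \<sigma> assume "\<sigma> \<in> {\<sigma>. \<sigma> permutes {0..<n}}"
    then have "\<sigma> permutes {..<n}" by (simp add: atLeast0LessThan)
    then have "(\<Prod>j<n. a (\<sigma> j)) = (\<Prod>i<n. a i)"
      by (intro prod.reindex_bij_betw permutes_imp_bij)
    moreover have "(\<Prod>j<n. \<Sum>p\<in>S j. g (\<sigma> j) j p) = (\<Sum>p\<in>PiE {..<n} S. \<Prod>j<n. g (\<sigma> j) j (p j))"
      by (rule prod_sum_PiE) (use assms in auto)
    ultimately show "(\<Prod>j<n. a (\<sigma> j) * (\<Sum>p\<in>S j. g (\<sigma> j) j p)) = (\<Prod>i<n. a i) * (\<Sum>p\<in>PiE {..<n} S. \<Prod>j<n. g (\<sigma> j) j (p j))"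
      by (simp add: prod.distrib)
  qed
  also have "\<dots> = (\<Prod>i<n. a i) * (\<Sum>p\<in>PiE {..<n} S. \<Sum>\<sigma> | \<sigma> permutes {0..<n}. signof \<sigma> * (\<Prod>j<n. g (\<sigma> j) j (p j)))"
    by (subst sum.swap) (simp add: sum_distrib_left algebra_simps)
  also have "(\<Sum>p\<in>PiE {..<n} S. \<Sum>\<sigma> | \<sigma> permutes {0..<n}. signof \<sigma> * (\<Prod>j<n. g (\<sigma> j) j (p j))) =
     (\<Sum>p\<in>PiE {..<n} S. Determinant.det (Matrix.mat n n (\<lambda>(i, j). g i j (p j))))"
    by (intro sum.cong refl, subst det_col[of _ n])
       (auto intro!: sum.cong prod.cong dest: permutes_in_image)
  finally show ?thesis .
qed

text \<open>Column operations turn the last row into \<open>(0, \<dots>, 0, w\<^bsup>l\<^sub>N\<^esup>)\<close> with \<open>w = u\<^sub>N\<close>, and in the remaining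
  minor each entry is a geometric sum with the factor \<open>u\<^sub>i - w\<close>. The summation indices of the
  geometric sums are the interlacing exponents.\<close>

lemma det_alt_mat_Suc:
  assumes u: "u \<in> torus (Suc N)" and l: "strict_dec (Suc N) l"
  shows "Determinant.det (alt_mat (Suc N) l u) = (\<Prod>i<N. u i - u N) *
    (\<Sum>p\<in>interlacing N l. Determinant.det (alt_mat N p u) * u N powi (l N + (\<Sum>j<N. l j - 1 - p j)))"
proof -
  define w where "w = u N"
  have nz: "u i \<noteq> 0" if "i \<le> N" for i using u that by (auto simp: torus_def)
  have w: "w \<noteq> 0" using nz by (auto simp: w_def)
  define A where "A = alt_mat (Suc N) l u"
  \<comment> \<open>Multiplication by \<open>L\<close> subtracts \<open>w powi (l j - l (Suc j))\<close> times column \<open>j + 1\<close> from column \<open>j\<close>.\<close>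
  define L where "L = Matrix.mat (Suc N) (Suc N)
    (\<lambda>(i, j). if i = j then 1 else if i = Suc j then - (w powi (l j - l (Suc j))) else 0 :: complex)"
  have A: "A \<in> carrier_mat (Suc N) (Suc N)" and L: "L \<in> carrier_mat (Suc N) (Suc N)"
    by (auto simp: A_def L_def alt_mat_def)
  have "Determinant.det L = prod_list (diag_mat L)"
    by (rule det_lower_triangular[OF _ L]) (auto simp: L_def)
  also have "diag_mat L = map (\<lambda>i. 1) [0..<Suc N]"
    unfolding diag_mat_def by (intro map_cong) (auto simp: L_def)
  also have "prod_list \<dots> = 1" by (simp add: map_replicate_const)
  finally have detL: "Determinant.det L = 1" .
  have AL: "(A * L) $$ (i, j) = u i powi l j - (if j < N then w powi (l j - l (Suc j)) * u i powi l (Suc j) else 0)"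
    if ij: "i \<le> N" "j \<le> N" for i j
  proof -
    have "(A * L) $$ (i, j) = (\<Sum>k<Suc N. A $$ (i, k) * L $$ (k, j))"
      using ij A L by (simp add: scalar_prod_def A_def L_def alt_mat_def atLeast0LessThan)
    also have "\<dots> = (\<Sum>k<Suc N. (if k = j then u i powi l j else 0) +
        (if k = Suc j then - (w powi (l j - l (Suc j)) * u i powi l (Suc j)) else 0))"
      by (intro sum.cong refl) (use ij in \<open>auto simp: A_def L_def alt_mat_def\<close>)
    also have "\<dots> = u i powi l j - (if j < N then w powi (l j - l (Suc j)) * u i powi l (Suc j) else 0)"
      using ij by (simp add: sum.distrib)
    finally show ?thesis .
  qed
  have ALc: "A * L \<in> carrier_mat (Suc N) (Suc N)" using A L by simp
  have lastrow: "(A * L) $$ (N, j) = 0" if "j < N" for j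
  proof -
    have "w powi (l j - l (Suc j)) * w powi l (Suc j) = w powi l j"
      using w by (simp flip: power_int_add)
    then show ?thesis using AL[of N j] that by (simp add: w_def)
  qed
  have "Determinant.det A = Determinant.det (A * L)"
    using det_mult[OF A L] detL by simp
  also have "\<dots> = (\<Sum>j<Suc N. (A * L) $$ (N, j) * cofactor (A * L) N j)"
    by (rule laplace_expansion_row[OF ALc]) simp
  also have "\<dots> = w powi l N * cofactor (A * L) N N"
    using AL[of N N] lastrow by (simp add: w_def)
  also have "cofactor (A * L) N N = Determinant.det (mat_delete (A * L) N N)"
    by (simp add: cofactor_def flip: power_add mult_2)
  also have "mat_delete (A * L) N N =
     Matrix.mat N N (\<lambda>(i, j). (u i - w) * (\<Sum>p\<in>{l (Suc j)..<l j}. u i powi p * w powi (l j - 1 - p)))"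
  proof (rule eq_matI)
    fix i j assume "i < dim_row (Matrix.mat N N (\<lambda>(i, j). (u i - w) * (\<Sum>p\<in>{l (Suc j)..<l j}. u i powi p * w powi (l j - 1 - p))))"
      "j < dim_col (Matrix.mat N N (\<lambda>(i, j). (u i - w) * (\<Sum>p\<in>{l (Suc j)..<l j}. u i powi p * w powi (l j - 1 - p))))"
    then have ij: "i < N" "j < N" by auto
    have "mat_delete (A * L) N N $$ (i, j) = (A * L) $$ (i, j)"
      using ij mat_delete_index[OF ALc, of N N i j] by (simp add: insert_index_def)
    also have "\<dots> = (u i - w) * (\<Sum>p\<in>{l (Suc j)..<l j}. u i powi p * w powi (l j - 1 - p))"
      using AL[of i j] ij geometric_powi[OF nz[of i] w, of "l (Suc j)" "l j"] l by (auto simp: strict_dec_def)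
    finally show "mat_delete (A * L) N N $$ (i, j) = Matrix.mat N N (\<lambda>(i, j). (u i - w) * (\<Sum>p\<in>{l (Suc j)..<l j}. u i powi p * w powi (l j - 1 - p))) $$ (i, j)"
      using ij by simp
  qed (use ALc in auto)
  also have "Determinant.det \<dots> = (\<Prod>i<N. u i - w) * (\<Sum>p\<in>interlacing N l.
     Determinant.det (Matrix.mat N N (\<lambda>(i, j). u i powi p j * w powi (l j - 1 - p j))))"
    unfolding interlacing_def by (rule det_col_sums) auto
  also have "(\<Sum>p\<in>interlacing N l. Determinant.det (Matrix.mat N N (\<lambda>(i, j). u i powi p j * w powi (l j - 1 - p j)))) =
     (\<Sum>p\<in>interlacing N l. Determinant.det (alt_mat N p u) * w powi (\<Sum>j<N. l j - 1 - p j))"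
  proof (rule sum.cong)
    fix p
    have "(\<Prod>j<N. w powi (l j - 1 - p j)) = w powi (\<Sum>j<N. l j - 1 - p j)" for N
      using w by (induction N) (auto simp: power_int_add mult.commute)
    then show "Determinant.det (Matrix.mat N N (\<lambda>(i, j). u i powi p j * w powi (l j - 1 - p j))) =
      Determinant.det (alt_mat N p u) * w powi (\<Sum>j<N. l j - 1 - p j)"
      unfolding alt_mat_def
      by (subst (1 2) det_col[of _ N])
         (auto simp: sum_distrib_right prod.distrib mult.assoc intro!: sum.cong)
  qed simp
  finally show ?thesis
    using w by (simp add: A_def w_def sum_distrib_left power_int_add algebra_simps)
qed

lemma vdm_gt_schur:
  "u \<in> torus N \<Longrightarrow> strict_dec N l \<Longrightarrow> vdm N u * gt_schur N l u = Determinant.det (alt_mat N l u)"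
proof (induction N arbitrary: l)
  case 0
  then show ?case by (simp add: vdm_def alt_mat_def)
next
  case (Suc N)
  have uN: "u \<in> torus N" using Suc.prems by (auto simp: torus_def)
  have "vdm (Suc N) u * gt_schur (Suc N) l u =
    (\<Prod>i<N. u i - u N) * (\<Sum>p\<in>interlacing N l. (vdm N u * gt_schur N p u) * u N powi (l N + (\<Sum>j<N. l j - 1 - p j)))"
    by (simp add: vdm_def sum_distrib_left algebra_simps)
  also have "(\<Sum>p\<in>interlacing N l. (vdm N u * gt_schur N p u) * u N powi (l N + (\<Sum>j<N. l j - 1 - p j))) =
    (\<Sum>p\<in>interlacing N l. Determinant.det (alt_mat N p u) * u N powi (l N + (\<Sum>j<N. l j - 1 - p j)))"
    by (intro sum.cong refl, subst Suc.IH[OF uN])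
       (use strict_dec_interlacing[OF Suc.prems(2)] in auto)
  also have "(\<Prod>i<N. u i - u N) * \<dots> = Determinant.det (alt_mat (Suc N) l u)"
    by (rule det_alt_mat_Suc[OF Suc.prems, symmetric])
  finally show ?case .
qed

lemma gt_schur_staircase: "(\<And>j. j < N \<Longrightarrow> l j = int N - 1 - int j) \<Longrightarrow> gt_schur N l u = 1"
proof (induction N arbitrary: l)
  case (Suc N)
  let ?p = "restrict (\<lambda>j. l (Suc j)) {..<N}"
  have "{l (Suc j)..<l j} = {?p j}" if "j < N" for j
  proof -
    have "l j = l (Suc j) + 1" using Suc.prems[of j] Suc.prems[of "Suc j"] that by simp
    then show ?thesis using that by auto
  qed
  then have "interlacing N l = PiE {..<N} (\<lambda>j. {?p j})"
    unfolding interlacing_def by (intro PiE_cong) auto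
  then have I: "interlacing N l = {?p}" by (simp only: PiE_singleton restrict_extensional)
  have "gt_schur N ?p u = 1"
    by (rule Suc.IH) (use Suc.prems in auto)
  moreover have "l N + (\<Sum>j<N. l j - 1 - ?p j) = 0"
    using Suc.prems by simp
  ultimately show ?case using I by simp
qed simp

lemma laurent_mono:
  assumes "N \<le> M" shows "laurent N f \<Longrightarrow> laurent M f"
proof (induction rule: laurent.induct)
  case (cong f g)
  show ?case
    by (rule laurent.cong[OF cong.IH]) (use cong.hyps assms in \<open>auto simp: torus_def\<close>)
qed (use assms in \<open>auto intro: laurent_intros\<close>)

lemma laurent_gt_schur: "laurent N (gt_schur N l)"
proof (induction N arbitrary: l)
  case 0
  show ?case by (rule laurent.cong[OF laurent.const[of 0 1]]) simp
next
  case (Suc N)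
  have "laurent (Suc N) (\<lambda>u. \<Sum>p\<in>interlacing N l.
     gt_schur N p u * u N powi (l N + (\<Sum>j<N. l j - 1 - p j)))"
    by (intro laurent_sum laurent.mult laurent_powi laurent_mono[OF _ Suc]) auto
  then show ?case by (rule laurent.cong) simp
qed

lemma det_alt_mat_swap:
  assumes "a < N" "b < N"
  shows "Determinant.det (alt_mat N l (u \<circ> swap a b)) = signof (swap a b) * Determinant.det (alt_mat N l u)"
proof -
  have p: "swap a b permutes {0..<N}" using assms by (intro permutes_swap_id) auto
  have "Determinant.det (Matrix.mat N N (\<lambda>(i, j). alt_mat N l u $$ (swap a b i, j))) =
    signof (swap a b) * Determinant.det (alt_mat N l u)"
    by (rule det_permute_rows[OF _ p]) (simp add: alt_mat_def)
  also have "Matrix.mat N N (\<lambda>(i, j). alt_mat N l u $$ (swap a b i, j)) = alt_mat N l (u \<circ> swap a b)"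
    unfolding alt_mat_def by (rule cong_mat) (use assms swap_less in auto)
  finally show ?thesis .
qed

lemma vdm_det: "u \<in> torus N \<Longrightarrow> vdm N u = Determinant.det (alt_mat N (\<lambda>j. int N - 1 - int j) u)"
  using vdm_gt_schur[of u N "\<lambda>j. int N - 1 - int j"] gt_schur_staircase[of N "\<lambda>j. int N - 1 - int j" u]
  by (simp add: strict_dec_def)

lemma vdm_nz: "inj_on u {..<N} \<Longrightarrow> vdm N u \<noteq> 0"
  by (auto simp: vdm_def inj_on_def)

text \<open>It is a quotient of two alternating functions where the coordinates are distinct.\<close>

lemma sym_gt_schur:
  assumes l: "strict_dec N l"
  shows "sym_laurent N (gt_schur N l)"
  unfolding sym_laurent_def
proof (intro conjI allI impI ballI laurent_gt_schur)
  fix a b u assume ab: "a < N" "b < N" and u: "u \<in> torus N"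
  show "gt_schur N l (u \<circ> swap a b) = gt_schur N l u"
  proof (rule laurent_eqI[OF _ laurent_gt_schur _ u])
    show "laurent N (\<lambda>u. gt_schur N l (u \<circ> swap a b))"
      by (rule laurent_compose_index[OF laurent_gt_schur]) (use ab swap_less in auto)
    fix u assume u: "u \<in> torus N" "inj_on u {..<N}"
    note u' = torus_swap[OF u(1) ab]
    have s: "signof (swap a b) * signof (swap a b) = (1::complex)"
      by (simp add: sign_def)
    have "vdm N (u \<circ> swap a b) * gt_schur N l (u \<circ> swap a b) = signof (swap a b) * (vdm N u * gt_schur N l u)"
      by (simp only: vdm_gt_schur[OF u' l] vdm_gt_schur[OF u(1) l] det_alt_mat_swap[OF ab])
    moreover have "vdm N (u \<circ> swap a b) = signof (swap a b) * vdm N u"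
      by (simp only: vdm_det[OF u'] vdm_det[OF u(1)] det_alt_mat_swap[OF ab])
    ultimately have "(signof (swap a b) * vdm N u) * gt_schur N l (u \<circ> swap a b) = (signof (swap a b) * vdm N u) * gt_schur N l u"
      by (simp add: algebra_simps)
    moreover have "signof (swap a b) * vdm N u \<noteq> 0"
      using s vdm_nz[OF u(2)] by auto
    ultimately show "gt_schur N l (u \<circ> swap a b) = gt_schur N l u"
      by (simp only: mult_cancel_left) simp
  qed
qed

lemma monomial_sum_collect:
  fixes c :: "'x \<Rightarrow> real" and \<alpha> :: "'x \<Rightarrow> nat \<Rightarrow> int"
  assumes "finite X" "\<And>x. x \<in> X \<Longrightarrow> c x \<ge> 0"
  shows "\<exists>A d. finite A \<and> (\<forall>\<beta>\<in>A. d \<beta> \<ge> (0::real)) \<and>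
    (\<forall>u. (\<Sum>x\<in>X. of_real (c x) * (\<Prod>i<N. u i powi \<alpha> x i)) =
         (\<Sum>\<beta>\<in>A. of_real (d \<beta>) * (\<Prod>i<N. (u i :: complex) powi \<beta> i)))"
proof (intro exI conjI allI ballI)
  let ?d = "\<lambda>\<beta>. \<Sum>x\<in>{x\<in>X. \<alpha> x = \<beta>}. c x"
  show "finite (\<alpha> ` X)" using assms by simp
  show "?d \<beta> \<ge> 0" for \<beta> using assms by (intro sum_nonneg) auto
  fix u :: "nat \<Rightarrow> complex"
  have "(\<Sum>x\<in>X. of_real (c x) * (\<Prod>i<N. u i powi \<alpha> x i)) =
    (\<Sum>\<beta>\<in>\<alpha> ` X. \<Sum>x\<in>{x\<in>X. \<alpha> x = \<beta>}. of_real (c x) * (\<Prod>i<N. u i powi \<alpha> x i))"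
    by (rule sum.image_gen[OF assms(1)])
  also have "\<dots> = (\<Sum>\<beta>\<in>\<alpha> ` X. of_real (?d \<beta>) * (\<Prod>i<N. u i powi \<beta> i))"
    by (auto simp: sum_distrib_right intro!: sum.cong)
  finally show "(\<Sum>x\<in>X. of_real (c x) * (\<Prod>i<N. u i powi \<alpha> x i)) =
    (\<Sum>\<beta>\<in>\<alpha> ` X. of_real (?d \<beta>) * (\<Prod>i<N. u i powi \<beta> i))" .
qed

lemma gt_schur_expansion:
  "\<exists>A c. finite A \<and> (\<forall>\<alpha>\<in>A. c \<alpha> \<ge> (0::real)) \<and>
    (\<forall>u. gt_schur N l u = (\<Sum>\<alpha>\<in>A. of_real (c \<alpha>) * (\<Prod>i<N. u i powi \<alpha> i)))"
proof (induction N arbitrary: l)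
  case 0
  show ?case by (rule exI[of _ "{\<lambda>_. 0}"], rule exI[of _ "\<lambda>_. 1"]) simp
next
  case (Suc N)
  have "\<forall>p. \<exists>A c. finite A \<and> (\<forall>\<alpha>\<in>A. c \<alpha> \<ge> (0::real)) \<and>
    (\<forall>u. gt_schur N p u = (\<Sum>\<alpha>\<in>A. of_real (c \<alpha>) * (\<Prod>i<N. u i powi \<alpha> i)))"
    by (rule allI, rule Suc.IH)
  then obtain A c where Ac: "\<And>p. finite (A p)" "\<And>p \<alpha>. \<alpha> \<in> A p \<Longrightarrow> c p \<alpha> \<ge> (0::real)"
    "\<And>p u. gt_schur N p u = (\<Sum>\<alpha>\<in>A p. of_real (c p \<alpha>) * (\<Prod>i<N. u i powi \<alpha> i))"
    unfolding choice_iff by blast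
  define e where "e p = l N + (\<Sum>j<N. l j - 1 - p j)" for p
  have "gt_schur (Suc N) l u = (\<Sum>x\<in>Sigma (interlacing N l) A.
      of_real (c (fst x) (snd x)) * (\<Prod>i<Suc N. u i powi ((snd x)(N := e (fst x))) i))" for u
  proof -
    have "gt_schur (Suc N) l u = (\<Sum>p\<in>interlacing N l. \<Sum>\<alpha>\<in>A p.
       of_real (c p \<alpha>) * (\<Prod>i<N. u i powi \<alpha> i) * u N powi e p)"
      by (simp add: Ac(3) e_def sum_distrib_right)
    also have "\<dots> = (\<Sum>x\<in>Sigma (interlacing N l) A.
       of_real (c (fst x) (snd x)) * (\<Prod>i<N. u i powi (snd x) i) * u N powi e (fst x))"
      using Ac(1) by (subst sum.Sigma) (auto simp: case_prod_unfold)
    also have "\<dots> = (\<Sum>x\<in>Sigma (interlacing N l) A.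
      of_real (c (fst x) (snd x)) * (\<Prod>i<Suc N. u i powi ((snd x)(N := e (fst x))) i))"
      by (intro sum.cong refl) simp
    finally show ?thesis .
  qed
  moreover have "finite (Sigma (interlacing N l) A)" using Ac(1) by auto
  ultimately show ?case
    using monomial_sum_collect[of "Sigma (interlacing N l) A" "\<lambda>x. c (fst x) (snd x)"
        "\<lambda>x. (snd x)(N := e (fst x))" "Suc N"] Ac(2) by auto
qed

lemma gt_schur_one_pos:
  "strict_dec N l \<Longrightarrow> \<exists>x>0. gt_schur N l (\<lambda>_. 1) = of_real x"
proof (induction N arbitrary: l)
  case 0
  show ?case by (rule exI[of _ 1]) simp
next
  case (Suc N)
  have "\<forall>p\<in>interlacing N l. \<exists>x>0. gt_schur N p (\<lambda>_. 1) = of_real x"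
    using Suc strict_dec_interlacing by blast
  then obtain x where x: "\<And>p. p \<in> interlacing N l \<Longrightarrow> x p > 0 \<and> gt_schur N p (\<lambda>_. 1) = of_real (x p)"
    by metis
  have "restrict (\<lambda>j. l (Suc j)) {..<N} \<in> interlacing N l"
    using Suc.prems by (auto simp: interlacing_def strict_dec_def)
  then have "(\<Sum>p\<in>interlacing N l. x p) > 0"
    using x by (intro sum_pos) auto
  moreover have "gt_schur (Suc N) l (\<lambda>_. 1) = of_real (\<Sum>p\<in>interlacing N l. x p)"
    using x by simp
  ultimately show ?case by blast
qed

text \<open>A monomial satisfies \<open>|v|\<^sup>n \<le> a\<^sup>n + b\<^sup>n\<close> for \<open>a \<le> |v| \<le> b\<close> and any integer \<open>n\<close>; as the
  coefficients are nonnegative, a Schur function is bounded on a product of annuli by the sum of its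
  values at the real corners. The bound does not depend on \<open>v\<close>, which makes it a majorant for
  uniform convergence.\<close>

lemma gt_schur_bound:
  assumes v: "\<And>i. i < N \<Longrightarrow> 0 < a i \<and> a i \<le> norm (v i) \<and> norm (v i) \<le> b i"
  shows "norm (gt_schur N l v) \<le>
    (\<Sum>B\<in>Pow {..<N}. norm (gt_schur N l (\<lambda>i. complex_of_real (if i \<in> B then a i else b i))))"
proof -
  obtain A c where Ac: "finite A" "\<And>\<alpha>. \<alpha> \<in> A \<Longrightarrow> c \<alpha> \<ge> (0::real)"
    "\<And>u. gt_schur N l u = (\<Sum>\<alpha>\<in>A. of_real (c \<alpha>) * (\<Prod>i<N. u i powi \<alpha> i))"
    using gt_schur_expansion[of N l] by auto
  have pw: "norm (v i) powi n \<le> a i powi n + b i powi n" if "i < N" for i n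
  proof (cases "n \<ge> 0")
    case True
    then have "norm (v i) powi n \<le> b i powi n"
      using v[OF that] by (intro power_int_mono) auto
    then show ?thesis using v[OF that] by (smt (verit) zero_le_power_int)
  next
    case False
    then have "norm (v i) powi n \<le> a i powi n"
      using v[OF that] by (intro power_int_antimono) auto
    then show ?thesis using v[OF that] by (smt (verit) zero_le_power_int)
  qed
  have "norm (gt_schur N l v) \<le> (\<Sum>\<alpha>\<in>A. norm (of_real (c \<alpha>) * (\<Prod>i<N. v i powi \<alpha> i)))"
    unfolding Ac(3) by (rule norm_sum)
  also have "\<dots> = (\<Sum>\<alpha>\<in>A. c \<alpha> * (\<Prod>i<N. norm (v i) powi \<alpha> i))"
    using Ac(2) by (intro sum.cong refl) (simp add: norm_mult norm_power_int prod_norm[symmetric])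
  also have "\<dots> \<le> (\<Sum>\<alpha>\<in>A. c \<alpha> * (\<Prod>i<N. a i powi \<alpha> i + b i powi \<alpha> i))"
    using Ac(2) pw by (intro sum_mono mult_left_mono prod_mono) auto
  also have "\<dots> = (\<Sum>\<alpha>\<in>A. c \<alpha> * (\<Sum>B\<in>Pow {..<N}. \<Prod>i<N. (if i \<in> B then a i else b i) powi \<alpha> i))"
  proof (intro sum.cong refl arg_cong2[where f="(*)"])
    fix \<alpha> :: "nat \<Rightarrow> int"
    have "(\<Prod>i\<in>B. a i powi \<alpha> i) * (\<Prod>i\<in>{..<N} - B. b i powi \<alpha> i) =
       (\<Prod>i<N. (if i \<in> B then a i else b i) powi \<alpha> i)" if "B \<subseteq> {..<N}" for B
    proof -
      have "(\<Prod>i<N. (if i \<in> B then a i else b i) powi \<alpha> i) =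
        (\<Prod>i\<in>B. (if i \<in> B then a i else b i) powi \<alpha> i) * (\<Prod>i\<in>{..<N} - B. (if i \<in> B then a i else b i) powi \<alpha> i)"
        using prod.subset_diff[OF that, of "\<lambda>i. (if i \<in> B then a i else b i) powi \<alpha> i"] by (simp add: mult.commute)
      then show ?thesis by simp
    qed
    then show "(\<Prod>i<N. a i powi \<alpha> i + b i powi \<alpha> i) =
      (\<Sum>B\<in>Pow {..<N}. \<Prod>i<N. (if i \<in> B then a i else b i) powi \<alpha> i)"
      by (subst prod_add) (auto intro!: sum.cong)
  qed
  also have "\<dots> = (\<Sum>B\<in>Pow {..<N}. \<Sum>\<alpha>\<in>A. c \<alpha> * (\<Prod>i<N. (if i \<in> B then a i else b i) powi \<alpha> i))"
    by (subst sum.swap) (simp add: sum_distrib_left)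
  also have "\<dots> \<le> (\<Sum>B\<in>Pow {..<N}. norm (gt_schur N l (\<lambda>i. complex_of_real (if i \<in> B then a i else b i))))"
  proof (rule sum_mono)
    fix B
    have "gt_schur N l (\<lambda>i. complex_of_real (if i \<in> B then a i else b i)) =
      of_real (\<Sum>\<alpha>\<in>A. c \<alpha> * (\<Prod>i<N. (if i \<in> B then a i else b i) powi \<alpha> i))"
      by (simp add: Ac(3))
    then show "(\<Sum>\<alpha>\<in>A. c \<alpha> * (\<Prod>i<N. (if i \<in> B then a i else b i) powi \<alpha> i)) \<le>
      norm (gt_schur N l (\<lambda>i. complex_of_real (if i \<in> B then a i else b i)))"
      by (simp only: norm_of_real abs_ge_self)
  qed
  finally show ?thesis .
qed

lemma laurent_poly_laurent:
  assumes "laurent_poly N f" shows "laurent N f"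
proof -
  obtain A c where A: "finite A" and f: "f = (\<lambda>u. \<Sum>\<alpha>\<in>A. c \<alpha> * (\<Prod>i<N. u i powi \<alpha> i))"
    using assms by (auto simp: laurent_poly_def)
  show ?thesis unfolding f
    by (intro laurent_sum laurent_cmult laurent_prod laurent_powi) auto
qed

text \<open>By convention \<open>0 powi 0 = 1\<close> and \<open>0 powi n = 0\<close> for \<open>n \<noteq> 0\<close>, so the left-hand side is the constant
  term of the Laurent polynomial.\<close>

lemma powi_sum_at_zero:
  fixes b :: "'x \<Rightarrow> complex" and e :: "'x \<Rightarrow> int"
  assumes X: "finite X" and 0: "\<And>z. z \<noteq> 0 \<Longrightarrow> (\<Sum>x\<in>X. b x * z powi e x) = 0"
  shows "(\<Sum>x\<in>X. b x * 0 powi e x) = 0"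
proof -
  \<comment> \<open>Multiplication by \<open>z ^ M\<close> clears all negative exponents.\<close>
  define M where "M = nat (\<Sum>x\<in>X. \<bar>e x\<bar>)"
  have M: "\<bar>e x\<bar> \<le> int M" if "x \<in> X" for x
    unfolding M_def using member_le_sum[OF that, of "\<lambda>x. \<bar>e x\<bar>"] X by (simp add: sum_nonneg)
  define p where "p = (\<Sum>x\<in>X. monom (b x) (nat (e x + int M)))"
  have "poly p z = 0" if "z \<noteq> 0" for z
  proof -
    have "poly p z = (\<Sum>x\<in>X. z ^ M * (b x * z powi e x))"
      unfolding p_def poly_sum
    proof (intro sum.cong refl)
      fix x assume "x \<in> X"
      then have "z ^ nat (e x + int M) = z powi (e x + int M)"
        using M[of x] by (auto simp: power_int_def)
      also have "\<dots> = z powi e x * z ^ M"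
        using that by (simp add: power_int_add)
      finally show "poly (monom (b x) (nat (e x + int M))) z = z ^ M * (b x * z powi e x)"
        by (simp add: poly_monom)
    qed
    also have "\<dots> = 0" using 0[OF that] by (simp flip: sum_distrib_left)
    finally show ?thesis .
  qed
  then have "{z. poly p z = 0} \<supseteq> UNIV - {0}" by auto
  then have "infinite {z. poly p z = 0}"
    using infinite_super[of "UNIV - {0::complex}"] by (simp add: infinite_UNIV_char_0)
  then have "p = 0" using poly_roots_finite by blast
  then have "0 = coeff p M" by simp
  also have "\<dots> = (\<Sum>x\<in>X. if e x = 0 then b x else 0)"
    unfolding p_def coeff_sum
  proof (intro sum.cong refl)
    fix x assume "x \<in> X"
    then have "nat (e x + int M) = M \<longleftrightarrow> e x = 0" using M[of x] by auto
    then show "coeff (monom (b x) (nat (e x + int M))) M = (if e x = 0 then b x else 0)"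
      by simp
  qed
  also have "\<dots> = (\<Sum>x\<in>X. b x * 0 powi e x)"
    by (intro sum.cong) auto
  finally show ?thesis ..
qed

text \<open>The definite description that defines \<open>schur\<close> ranges over functions on all points. Its uniqueness
  therefore also concerns points with vanishing coordinates, where the value of a Laurent polynomial
  is a matter of convention.\<close>

lemma laurent_poly_eqI:
  assumes f: "laurent_poly N f" and g: "laurent_poly N g"
    and eq: "\<And>u. u \<in> torus N \<Longrightarrow> f u = g u"
  shows "f = g"
proof -
  obtain A c where A: "finite A" and fA: "f = (\<lambda>u. \<Sum>\<alpha>\<in>A. c \<alpha> * (\<Prod>i<N. u i powi \<alpha> i))"
    using f by (auto simp: laurent_poly_def)
  obtain B d where B: "finite B" and gB: "g = (\<lambda>u. \<Sum>\<alpha>\<in>B. d \<alpha> * (\<Prod>i<N. u i powi \<alpha> i))"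
    using g by (auto simp: laurent_poly_def)
  \<comment> \<open>Coordinates are allowed to vanish one after the other.\<close>
  have this': "\<forall>u. (\<forall>i. j \<le> i \<and> i < N \<longrightarrow> u i \<noteq> 0) \<longrightarrow> f u = g u" if "j \<le> N" for j
    using that
  proof (induction j)
    case 0
    then show ?case using eq by (auto simp: torus_def)
  next
    case (Suc j)
    show ?case
    proof (intro allI impI)
      fix u :: "nat \<Rightarrow> complex" assume u: "\<forall>i. Suc j \<le> i \<and> i < N \<longrightarrow> u i \<noteq> 0"
      have jN: "j < N" using Suc.prems by simp
      have nz: "f (u(j := z)) = g (u(j := z))" if "z \<noteq> 0" for z
        using Suc.IH jN u that by (auto simp: Suc_le_eq)
      define q where "q \<alpha> = (\<Prod>i\<in>{..<N}-{j}. u i powi \<alpha> i)" for \<alpha> :: "nat \<Rightarrow> int"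
      have split: "(\<Prod>i<N. (u(j := z)) i powi \<alpha> i) = q \<alpha> * z powi \<alpha> j" for z \<alpha>
        using jN by (subst prod.remove[of _ j]) (auto simp: q_def mult.commute intro!: prod.cong)
      have fj: "f (u(j := z)) = (\<Sum>\<alpha>\<in>A. c \<alpha> * (q \<alpha> * z powi \<alpha> j))" for z
        by (simp only: fA split)
      have gj: "g (u(j := z)) = (\<Sum>\<alpha>\<in>B. d \<alpha> * (q \<alpha> * z powi \<alpha> j))" for z
        by (simp only: gB split)
      \<comment> \<open>The disjoint union of the two index sets writes \<open>f - g\<close> as a single sum of monomials.\<close>
      let ?X = "A <+> B"
      let ?b = "case_sum (\<lambda>\<alpha>. c \<alpha> * q \<alpha>) (\<lambda>\<alpha>. - d \<alpha> * q \<alpha>)"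
      let ?e = "case_sum (\<lambda>\<alpha>. \<alpha> j) (\<lambda>\<alpha>. \<alpha> j)"
      have key: "f (u(j := z)) - g (u(j := z)) = (\<Sum>x\<in>?X. ?b x * z powi ?e x)" for z
        using A B unfolding fj gj by (subst sum.Plus) (auto simp: sum_negf mult.assoc)
      have "(\<Sum>x\<in>?X. ?b x * 0 powi ?e x) = 0"
      proof (rule powi_sum_at_zero)
        fix z :: complex assume "z \<noteq> 0"
        then show "(\<Sum>x\<in>?X. ?b x * z powi ?e x) = 0" unfolding key[symmetric] using nz by simp
      qed (use A B in simp)
      then have "f (u(j := z)) = g (u(j := z))" for z
        using nz[of z] key[of 0] by (cases "z = 0") auto
      from this[of "u j"] show "f u = g u" by simp
    qed
  qed
  show ?thesis
  proof (rule ext)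
    fix u show "f u = g u"
      by (rule mp[OF spec[OF this'[OF order_refl]]]) auto
  qed
qed

definition sig_exp :: "nat \<Rightarrow> int list \<Rightarrow> nat \<Rightarrow> int" where
  "sig_exp N l j = l ! j + int N - 1 - int j"

lemma strict_dec_sig_exp:
  assumes "l \<in> signatures N" shows "strict_dec N (sig_exp N l)"
  unfolding strict_dec_def sig_exp_def
proof (intro allI impI)
  fix j assume "Suc j < N"
  then have "l ! Suc j \<le> l ! j"
    using assms sorted_wrt_nth_less[of "(\<ge>)" l j "Suc j"] by (auto simp: signatures_def)
  then show "l ! Suc j + int N - 1 - int (Suc j) < l ! j + int N - 1 - int j" by simp
qed

lemma schur_eq_gt_schur:
  assumes l: "l \<in> signatures N"
  shows "schur N l = gt_schur N (sig_exp N l)"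
  unfolding schur_def
proof (rule the_equality)
  obtain A c where Ac: "finite A"
    "\<And>u. gt_schur N (sig_exp N l) u = (\<Sum>\<alpha>\<in>A. of_real (c \<alpha>) * (\<Prod>i<N. u i powi \<alpha> i))"
    using gt_schur_expansion[of N "sig_exp N l"] by auto
  have lp: "laurent_poly N (gt_schur N (sig_exp N l))"
    unfolding laurent_poly_def using Ac by (intro exI[of _ A] exI[of _ "\<lambda>\<alpha>. of_real (c \<alpha>)"]) auto
  have quot: "gt_schur N (sig_exp N l) u = Determinant.det
       (Matrix.mat N N (\<lambda>(i, j). u i powi (l ! j + int N - 1 - int j))) / (\<Prod>j<N. \<Prod>i<j. u i - u j)"
    if "inj_on u {..<N}" "u \<in> torus N" for u
    using vdm_gt_schur[OF that(2) strict_dec_sig_exp[OF l]] vdm_nz[OF that(1)]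
    by (simp add: vdm_def alt_mat_def sig_exp_def field_simps)
  show "laurent_poly N (gt_schur N (sig_exp N l)) \<and> (\<forall>u. inj_on u {..<N} \<and> (\<forall>i<N. u i \<noteq> 0) \<longrightarrow>
      gt_schur N (sig_exp N l) u = Determinant.det
       (Matrix.mat N N (\<lambda>(i, j). u i powi (l ! j + int N - 1 - int j))) / (\<Prod>j<N. \<Prod>i<j. u i - u j))"
    using lp quot by (auto simp: torus_def)
  fix f assume f: "laurent_poly N f \<and> (\<forall>u. inj_on u {..<N} \<and> (\<forall>i<N. u i \<noteq> 0) \<longrightarrow>
      f u = Determinant.det
       (Matrix.mat N N (\<lambda>(i, j). u i powi (l ! j + int N - 1 - int j))) / (\<Prod>j<N. \<Prod>i<j. u i - u j))"
  show "f = gt_schur N (sig_exp N l)"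
  proof (rule laurent_poly_eqI[OF _ lp])
    fix u assume "u \<in> torus N"
    then show "f u = gt_schur N (sig_exp N l) u"
      by (rule laurent_eqI[OF _ laurent_gt_schur, rotated -1])
         (use f quot laurent_poly_laurent in \<open>auto simp: torus_def\<close>)
  qed (use f in auto)
qed

section \<open>Falling factorial sums as brackets of Schur functions\<close>

definition ffact :: "nat \<Rightarrow> complex \<Rightarrow> complex" where
  "ffact m z = (\<Prod>q<m. z - of_nat q)"

lemma partial_iter_cong:
  assumes "i < N" "\<And>u. u \<in> torus N \<Longrightarrow> g u = f u"
  shows "u \<in> torus N \<Longrightarrow> (partial i ^^ m) g u = (partial i ^^ m) f u"
proof (induction m arbitrary: u)
  case (Suc m)
  then show ?case using partial_cong[OF Suc.prems assms(1) Suc.IH] by simp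
qed (use assms in simp)

lemma partial_sum:
  assumes "finite A" "\<And>x. x \<in> A \<Longrightarrow> laurent N (f x)" "u \<in> torus N" "i < N"
  shows "(partial i ^^ m) (\<lambda>u. \<Sum>x\<in>A. f x u) u = (\<Sum>x\<in>A. (partial i ^^ m) (f x) u)"
  using assms(1,2)
proof (induction A rule: finite_induct)
  case empty
  show ?case by (simp add: partial_iter)
next
  case (insert x A)
  have "(partial i ^^ m) (\<lambda>u. f x u + (\<Sum>x\<in>A. f x u)) u = (partial i ^^ m) (f x) u + (partial i ^^ m) (\<lambda>u. \<Sum>x\<in>A. f x u) u"
    by (rule partial_iter_add[OF _ laurent_sum assms(4,3)]) (use insert in auto)
  then show ?case using insert by simp
qed

definition monomial :: "nat \<Rightarrow> (nat \<Rightarrow> int) \<Rightarrow> (nat \<Rightarrow> complex) \<Rightarrow> complex" where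
  "monomial N e u = (\<Prod>j<N. u j powi e j)"

lemma laurent_monomial: "laurent N (monomial N e)"
  unfolding monomial_def[abs_def] by (intro laurent_prod laurent_powi) auto

lemma partial_monomial:
  assumes "u \<in> torus N" "i < N"
  shows "partial i (monomial N e) u = of_int (e i) * monomial N (e(i := e i - 1)) u"
proof -
  define K where "K = (\<Prod>j\<in>{..<N} - {i}. u j powi e j)"
  have split: "monomial N d (u(i := z)) = z powi d i * K" if "\<And>j. j \<noteq> i \<Longrightarrow> d j = e j" for d z
    unfolding monomial_def K_def using assms(2) that by (subst prod.remove[of _ i]) (auto intro!: prod.cong)
  have "((\<lambda>z. z powi e i * K) has_field_derivative of_int (e i) * u i powi (e i - 1) * K) (at (u i))"
    using assms by (auto intro!: derivative_eq_intros simp: torus_def)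
  then have "partial i (monomial N e) u = of_int (e i) * u i powi (e i - 1) * K"
    unfolding partial_def by (simp add: split DERIV_imp_deriv)
  moreover have "monomial N (e(i := e i - 1)) u = u i powi (e i - 1) * K"
    using split[of "e(i := e i - 1)" "u i"] by simp
  ultimately show ?thesis by simp
qed

lemma partial_iter_monomial:
  assumes "i < N"
  shows "u \<in> torus N \<Longrightarrow> (partial i ^^ m) (monomial N e) u =
    ffact m (of_int (e i)) * monomial N (e(i := e i - int m)) u"
proof (induction m arbitrary: u)
  case 0
  then show ?case by (simp add: ffact_def)
next
  case (Suc m)
  let ?e = "e(i := e i - int m)"
  have "(partial i ^^ Suc m) (monomial N e) u = partial i (\<lambda>u. ffact m (of_int (e i)) * monomial N ?e u) u"
    unfolding funpow.simps o_apply by (rule partial_cong[OF Suc.prems assms Suc.IH])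
  also have "\<dots> = ffact m (of_int (e i)) * partial i (monomial N ?e) u"
    using partial_iter_cmult[OF laurent_monomial assms Suc.prems, of 1] by simp
  also have "partial i (monomial N ?e) u = (of_int (e i) - of_nat m) * monomial N (e(i := e i - int (Suc m))) u"
  proof -
    have "?e(i := ?e i - 1) = e(i := e i - int (Suc m))" by auto
    then show ?thesis using partial_monomial[OF Suc.prems assms, of ?e] by simp
  qed
  moreover have "ffact (Suc m) z = ffact m z * (z - of_nat m)" for z by (simp add: ffact_def)
  ultimately show ?case by (simp only: mult.assoc)
qed

lemma power_partial_monomial:
  assumes "i < N" "u \<in> torus N"
  shows "u i ^ m * (partial i ^^ m) (monomial N e) u = ffact m (of_int (e i)) * monomial N e u"
proof -
  have nz: "u i \<noteq> 0" using assms by (auto simp: torus_def)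
  have "u i ^ m * u i powi (e i - int m) = u i powi e i"
    using nz power_int_add[of "u i" "int m" "e i - int m"] by simp
  then have "u i ^ m * monomial N (e(i := e i - int m)) u = monomial N e u"
    unfolding monomial_def using assms(1)
    by (subst (1 2) prod.remove[of _ i]) (auto intro!: prod.cong simp: mult.assoc[symmetric])
  then show ?thesis by (simp add: partial_iter_monomial[OF assms(1,2)] mult.left_commute)
qed

lemma det_alt_mat_monomials:
  "Determinant.det (alt_mat N l u) = (\<Sum>\<sigma> | \<sigma> permutes {0..<N}. signof \<sigma> * monomial N (\<lambda>i. l (\<sigma> i)) u)"
  unfolding alt_mat_def monomial_def
  by (subst det_def'[of _ N]) (auto intro!: sum.cong prod.cong simp: atLeast0LessThan)

text \<open>The operator multiplies each monomial of the determinant by a sum over its exponents, and the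
  monomials only differ in the order of their exponents.\<close>

lemma det_alt_mat_eigen:
  assumes u: "u \<in> torus N"
  shows "(\<Sum>i<N. u i ^ m * (partial i ^^ m) (\<lambda>u. Determinant.det (alt_mat N l u)) u) =
    (\<Sum>j<N. ffact m (of_int (l j))) * Determinant.det (alt_mat N l u)"
proof -
  let ?P = "{\<sigma>. \<sigma> permutes {0..<N}}"
  let ?M = "\<lambda>\<sigma>. monomial N (\<lambda>i. l (\<sigma> i))"
  have fin: "finite ?P" by (rule finite_permutations) auto
  have "(\<Sum>i<N. u i ^ m * (partial i ^^ m) (\<lambda>u. Determinant.det (alt_mat N l u)) u) =
    (\<Sum>i<N. \<Sum>\<sigma>\<in>?P. signof \<sigma> * (ffact m (of_int (l (\<sigma> i))) * ?M \<sigma> u))"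
  proof (rule sum.cong)
    fix i assume "i \<in> {..<N}"
    then have i: "i < N" by simp
    have "(partial i ^^ m) (\<lambda>u. Determinant.det (alt_mat N l u)) u = (\<Sum>\<sigma>\<in>?P. (partial i ^^ m) (\<lambda>u. signof \<sigma> * ?M \<sigma> u) u)"
      unfolding det_alt_mat_monomials
      by (rule partial_sum[OF fin _ u i]) (intro laurent_cmult laurent_monomial)
    also have "\<dots> = (\<Sum>\<sigma>\<in>?P. signof \<sigma> * (partial i ^^ m) (?M \<sigma>) u)"
      by (intro sum.cong refl partial_iter_cmult[OF laurent_monomial i u])
    finally show "u i ^ m * (partial i ^^ m) (\<lambda>u. Determinant.det (alt_mat N l u)) u =
      (\<Sum>\<sigma>\<in>?P. signof \<sigma> * (ffact m (of_int (l (\<sigma> i))) * ?M \<sigma> u))"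
      by (simp add: sum_distrib_left mult.left_commute[of "u i ^ m"] power_partial_monomial[OF i u])
  qed simp
  also have "\<dots> = (\<Sum>\<sigma>\<in>?P. signof \<sigma> * ((\<Sum>i<N. ffact m (of_int (l (\<sigma> i)))) * ?M \<sigma> u))"
    by (subst sum.swap) (simp add: sum_distrib_left sum_distrib_right)
  also have "\<dots> = (\<Sum>\<sigma>\<in>?P. signof \<sigma> * ((\<Sum>j<N. ffact m (of_int (l j))) * ?M \<sigma> u))"
  proof (rule sum.cong)
    fix \<sigma> assume "\<sigma> \<in> ?P"
    then have "bij_betw \<sigma> {..<N} {..<N}" by (simp add: permutes_imp_bij atLeast0LessThan)
    then have "(\<Sum>i<N. ffact m (of_int (l (\<sigma> i)))) = (\<Sum>j<N. ffact m (of_int (l j)))"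
      by (rule sum.reindex_bij_betw)
    then show "signof \<sigma> * ((\<Sum>i<N. ffact m (of_int (l (\<sigma> i)))) * ?M \<sigma> u) =
       signof \<sigma> * ((\<Sum>j<N. ffact m (of_int (l j))) * ?M \<sigma> u)" by simp
  qed simp
  finally show ?thesis
    by (simp add: det_alt_mat_monomials sum_distrib_left mult.left_commute)
qed

text \<open>The product is expanded in powers of \<open>h\<close> at \<open>z + h\<close>; the coefficient of \<open>h\<^sup>j\<close> is a sum over
  \<open>j\<close>-element subsets.\<close>

lemma higher_deriv_prod_linear:
  fixes b :: "nat \<Rightarrow> complex"
  assumes fin: "finite A" and ne: "\<And>a. a \<in> A \<Longrightarrow> z \<noteq> b a"
  shows "(deriv ^^ j) (\<lambda>w. \<Prod>a\<in>A. w - b a) z =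
    (\<Prod>a\<in>A. z - b a) * fact j * (\<Sum>B\<in>{B. B \<subseteq> A \<and> card B = j}. 1 / (\<Prod>a\<in>B. z - b a))"
proof -
  let ?Q = "\<lambda>w. \<Prod>a\<in>A. w - b a"
  let ?c = "\<lambda>B. \<Prod>a\<in>A - B. z - b a"
  have exp: "?Q (h + z) = (\<Sum>B\<in>Pow A. ?c B * h ^ card B)" for h
  proof -
    have "(\<Prod>a\<in>A. h + (z - b a)) = (\<Sum>B\<in>Pow A. (\<Prod>a\<in>B. h) * ?c B)"
      by (rule prod_add[OF fin])
    then show ?thesis by (simp add: mult.commute add_diff_eq)
  qed
  have "(\<lambda>h. \<Sum>B\<in>Pow A. ?c B * h ^ card B) has_fps_expansion (\<Sum>B\<in>Pow A. fps_const (?c B) * fps_X ^ card B)"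
    by (intro fps_expansion_intros)
  then have "fps_nth (\<Sum>B\<in>Pow A. fps_const (?c B) * fps_X ^ card B) j =
      (deriv ^^ j) (\<lambda>h. \<Sum>B\<in>Pow A. ?c B * h ^ card B) 0 / fact j"
    by (rule fps_nth_fps_expansion)
  also have "(\<lambda>h. \<Sum>B\<in>Pow A. ?c B * h ^ card B) = (\<lambda>h. ?Q (1 * h + z))"
    by (simp only: exp mult_1)
  also have "(deriv ^^ j) \<dots> 0 = 1 ^ j * (deriv ^^ j) ?Q (1 * 0 + z)"
    by (rule higher_deriv_compose_linear'[where S=UNIV and T=UNIV]) (auto intro!: holomorphic_intros)
  finally have "(deriv ^^ j) ?Q z = fact j * fps_nth (\<Sum>B\<in>Pow A. fps_const (?c B) * fps_X ^ card B) j"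
    by simp
  also have "fps_nth (\<Sum>B\<in>Pow A. fps_const (?c B) * fps_X ^ card B) j = (\<Sum>B\<in>Pow A. if card B = j then ?c B else 0)"
    by (simp add: fps_sum_nth fps_X_power_nth if_distrib cong: if_cong) (rule sum.cong, auto)
  also have "\<dots> = (\<Sum>B\<in>{B. B \<subseteq> A \<and> card B = j}. ?c B)"
    using fin by (simp add: sum.inter_filter[symmetric] Pow_def)
  also have "\<dots> = (\<Sum>B\<in>{B. B \<subseteq> A \<and> card B = j}. (\<Prod>a\<in>A. z - b a) * (1 / (\<Prod>a\<in>B. z - b a)))"
  proof (rule sum.cong)
    fix B assume "B \<in> {B. B \<subseteq> A \<and> card B = j}"
    then have B: "B \<subseteq> A" "finite B" using fin finite_subset by auto
    have "(\<Prod>a\<in>B. z - b a) \<noteq> 0" using B ne by auto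
    then show "?c B = (\<Prod>a\<in>A. z - b a) * (1 / (\<Prod>a\<in>B. z - b a))"
      using prod.subset_diff[OF B(1) fin, of "\<lambda>a. z - b a"] by simp
  qed simp
  finally show ?thesis by (simp add: sum_distrib_left mult_ac)
qed

lemma vdm_upd:
  "i < N \<Longrightarrow> \<exists>K. \<forall>z. vdm N (u(i := z)) = K * (\<Prod>a\<in>{..<N} - {i}. z - u a)"
proof (induction N)
  case (Suc N)
  show ?case
  proof (cases "i = N")
    case True
    have "vdm (Suc N) (u(i := z)) = vdm N u * (-1) ^ N * (\<Prod>a\<in>{..<Suc N} - {i}. z - u a)" for z
    proof -
      have "{..<Suc N} - {i} = {..<N}" using True by auto
      moreover have "vdm N (u(i := z)) = vdm N u"
        unfolding vdm_def using True by (intro prod.cong) auto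
      moreover have "(\<Prod>a<N. u a - z) = (-1) ^ N * (\<Prod>a<N. z - u a)"
      proof -
        have "(\<Prod>a<N. u a - z) = (\<Prod>a<N. (-1) * (z - u a))" by (intro prod.cong) auto
        then show ?thesis by (simp only: prod.distrib prod_constant card_lessThan)
      qed
      moreover have "vdm (Suc N) (u(i := z)) = vdm N (u(i := z)) * (\<Prod>a<N. u a - z)"
        using True by (simp add: vdm_def)
      ultimately show ?thesis by (simp only: mult.assoc)
    qed
    then show ?thesis by blast
  next
    case False
    then have iN: "i < N" using Suc.prems by simp
    then obtain K where K: "\<And>z. vdm N (u(i := z)) = K * (\<Prod>a\<in>{..<N} - {i}. z - u a)"
      using Suc.IH by blast
    have "vdm (Suc N) (u(i := z)) = K * (\<Prod>p\<in>{..<N} - {i}. u p - u N) * (\<Prod>a\<in>{..<Suc N} - {i}. z - u a)" for z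
    proof -
      have "vdm (Suc N) (u(i := z)) = vdm N (u(i := z)) * (\<Prod>p<N. (u(i := z)) p - u N)"
        using False by (simp add: vdm_def)
      also have "(\<Prod>p<N. (u(i := z)) p - u N) = (z - u N) * (\<Prod>p\<in>{..<N} - {i}. u p - u N)"
        using iN by (subst prod.remove[of _ i]) (auto intro!: prod.cong)
      also have "{..<Suc N} - {i} = insert N ({..<N} - {i})" using False by auto
      then have "(\<Prod>a\<in>{..<Suc N} - {i}. z - u a) = (z - u N) * (\<Prod>a\<in>{..<N} - {i}. z - u a)" by simp
      ultimately show ?thesis unfolding K by (simp only: mult_ac)
    qed
    then show ?thesis by blast
  qed
qed simp

lemma laurent_vdm: "laurent N (vdm N)"
  unfolding vdm_def[abs_def] by (intro laurent_prod laurent_diff laurent.var) auto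

lemma partial_iter_vdm:
  assumes i: "i < N" and inj: "inj_on u {..<N}"
  shows "(partial i ^^ j) (vdm N) u =
    vdm N u * (fact j * (\<Sum>B\<in>{B. B \<subseteq> {..<N} - {i} \<and> card B = j}. 1 / (\<Prod>a\<in>B. u i - u a)))"
proof -
  obtain K where K: "\<And>z. vdm N (u(i := z)) = K * (\<Prod>a\<in>{..<N} - {i}. z - u a)"
    using vdm_upd[OF i] by blast
  have "(partial i ^^ j) (vdm N) u = (deriv ^^ j) (\<lambda>z. K * (\<Prod>a\<in>{..<N} - {i}. z - u a)) (u i)"
    unfolding partial_iter K ..
  also have "\<dots> = K * (deriv ^^ j) (\<lambda>z. \<Prod>a\<in>{..<N} - {i}. z - u a) (u i)"
    by (rule higher_deriv_cmult[where A=UNIV]) (auto intro!: holomorphic_intros)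
  also have "\<dots> = K * ((\<Prod>a\<in>{..<N} - {i}. u i - u a) * fact j * (\<Sum>B\<in>{B. B \<subseteq> {..<N} - {i} \<and> card B = j}. 1 / (\<Prod>a\<in>B. u i - u a)))"
    using inj i by (subst higher_deriv_prod_linear) (auto simp: inj_on_def)
  also have "\<dots> = vdm N u * (fact j * (\<Sum>B\<in>{B. B \<subseteq> {..<N} - {i} \<and> card B = j}. 1 / (\<Prod>a\<in>B. u i - u a)))"
    using K[of "u i"] by (simp add: mult_ac)
  finally show ?thesis .
qed

lemma partial_iter_leibniz:
  assumes "laurent N f" "laurent N g" "u \<in> torus N" "i < N"
  shows "(partial i ^^ m) (\<lambda>u. f u * g u) u =
    (\<Sum>j\<le>m. of_nat (m choose j) * (partial i ^^ j) f u * (partial i ^^ (m - j)) g u)"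
  unfolding partial_iter atLeast0AtMost[symmetric]
  by (rule higher_deriv_mult[OF laurent_holo[OF assms(1,3)] laurent_holo[OF assms(2,3)]])
     (use assms in \<open>auto simp: torus_def\<close>)

text \<open>Both sides run over the pairs of a set \<open>D\<close> with \<open>j + 1\<close> elements and a distinguished element \<open>i\<close>
  of \<open>D\<close>.\<close>

lemma sum_pointed_subsets:
  fixes h :: "nat \<Rightarrow> nat set \<Rightarrow> complex"
  shows "(\<Sum>i<N. \<Sum>B\<in>{B. B \<subseteq> {..<N} - {i} \<and> card B = j}. h i B) =
    (\<Sum>D\<in>{D. D \<subseteq> {..<N} \<and> card D = Suc j}. \<Sum>i\<in>D. h i (D - {i}))"
proof -
  let ?X = "Sigma {..<N} (\<lambda>i. {B. B \<subseteq> {..<N} - {i} \<and> card B = j})"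
  let ?Y = "Sigma {D. D \<subseteq> {..<N} \<and> card D = Suc j} (\<lambda>D. D)"
  have finB: "finite B" if "B \<subseteq> {..<N} - {i}" for B i using that finite_subset by blast
  have finD: "finite D" if "D \<subseteq> {..<N}" for D using that finite_subset by blast
  have finX: "finite {B. B \<subseteq> {..<N} - {i} \<and> card B = j}" for i
    by (rule finite_subset[of _ "Pow {..<N}"]) auto
  have finY: "finite {D. D \<subseteq> {..<N} \<and> card D = Suc j}"
    by (rule finite_subset[of _ "Pow {..<N}"]) auto
  have "(\<Sum>i<N. \<Sum>B\<in>{B. B \<subseteq> {..<N} - {i} \<and> card B = j}. h i B) = (\<Sum>(i, B)\<in>?X. h i B)"
    using finX by (subst sum.Sigma) auto
  also have "\<dots> = (\<Sum>(D, i)\<in>?Y. h i (D - {i}))"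
  proof (rule sum.reindex_bij_witness[where i="\<lambda>(D, i). (i, D - {i})" and j="\<lambda>(i, B). (insert i B, i)"])
    fix x assume "x \<in> ?X"
    then obtain i B where x: "x = (i, B)" "i < N" "B \<subseteq> {..<N} - {i}" "card B = j" by auto
    then have "i \<notin> B" "finite B" using finB by auto
    then show "(case case x of (i, B) \<Rightarrow> (insert i B, i) of (D, i) \<Rightarrow> (i, D - {i})) = x"
      "(case x of (i, B) \<Rightarrow> (insert i B, i)) \<in> ?Y"
      "(case case x of (i, B) \<Rightarrow> (insert i B, i) of (D, i) \<Rightarrow> h i (D - {i})) = (case x of (i, B) \<Rightarrow> h i B)"
      using x by auto
  next
    fix y assume "y \<in> ?Y"
    then obtain D i where y: "y = (D, i)" "i \<in> D" "D \<subseteq> {..<N}" "card D = Suc j" by auto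
    then show "(case case y of (D, i) \<Rightarrow> (i, D - {i}) of (i, B) \<Rightarrow> (insert i B, i)) = y"
      "(case y of (D, i) \<Rightarrow> (i, D - {i})) \<in> ?X"
      using finD[of D] by (auto simp: insert_absorb)
  qed
  also have "\<dots> = (\<Sum>D\<in>{D. D \<subseteq> {..<N} \<and> card D = Suc j}. \<Sum>i\<in>D. h i (D - {i}))"
    using finY finD by (subst sum.Sigma) auto
  finally show ?thesis .
qed

text \<open>Transpositions move \<open>B\<close> to an initial segment one element at a time.\<close>

lemma ddval_card:
  assumes F: "equivariant N F" and B: "B \<subseteq> {..<N}" "B \<noteq> {}"
  shows "ddval N B F = ddval N {..<card B} F"
  using B
proof (induction "card (B - {..<card B})" arbitrary: B)
  case 0
  have fin: "finite B" using 0 finite_subset by blast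
  then have "B \<subseteq> {..<card B}" using 0 by auto
  then have "B = {..<card B}" by (intro card_subset_eq) auto
  then show ?case by metis
next
  case (Suc n)
  have fin: "finite B" using Suc.prems finite_subset by blast
  obtain p where p: "p \<in> B" "p \<notin> {..<card B}" using Suc.hyps(2) by (metis DiffE all_not_in_conv card.empty nat.distinct(1))
  have "\<not> {..<card B} \<subseteq> B"
  proof
    assume "{..<card B} \<subseteq> B"
    then have "{..<card B} = B" using fin by (intro card_subset_eq) auto
    then show False using p by auto
  qed
  then obtain q where q: "q < card B" "q \<notin> B" by auto
  have pN: "p < N" using p Suc.prems by auto
  then have qN: "q < N" using q p by auto
  let ?B = "swap p q ` B"
  have B': "?B = insert q (B - {p})"
    using p(1) q by (auto simp: Transposition.transpose_def image_iff split: if_splits)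
  have cB: "card ?B = card B" by (rule card_image) (auto intro: inj_on_subset[of _ UNIV])
  have "?B - {..<card B} = (B - {..<card B}) - {p}"
    unfolding B' using q by auto
  then have "n = card (?B - {..<card ?B})" using Suc.hyps(2) p cB by simp
  moreover have "?B \<subseteq> {..<N}" "?B \<noteq> {}" using B' Suc.prems qN by auto
  ultimately have "ddval N ?B F = ddval N {..<card ?B} F" by (rule Suc.hyps(1))
  then show ?case using ddval_swap[OF F Suc.prems pN qN] cB by simp
qed

lemma pad_ones_upd: "i < r \<Longrightarrow> (pad_ones r u)(i := z) = pad_ones r (u(i := z))"
  by (auto simp: pad_ones_def fun_eq_iff)

text \<open>A divided difference over the first \<open>r\<close> coordinates only differentiates in these, so the other
  coordinates may be set to \<open>1\<close> beforehand.\<close>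

lemma ddval_bracket:
  assumes f: "sym_laurent N f" and r: "0 < r" "r \<le> N"
  shows "ddval N {..<r} (\<lambda>i u. u i ^ m * (partial i ^^ n) f u) = bracket r m n (\<lambda>u. f (pad_ones r u))"
proof -
  let ?F = "\<lambda>i u. u i ^ m * (partial i ^^ n) f u"
  obtain g where g: "laurent N g" "\<And>u. u\<in>torus N \<Longrightarrow> inj_on u {..<r} \<Longrightarrow> g u = divdiff {..<r} ?F u"
    "ddval N {..<r} ?F = g (\<lambda>_. 1)"
    using ddval_obtain[OF bracket_family[OF f], of "{..<r}"] r by (auto simp: lessThan_empty_iff)
  have one: "pad_ones r (\<lambda>_. 1) = (\<lambda>_. 1)" by (auto simp: pad_ones_def)
  have "bracket r m n (\<lambda>u. f (pad_ones r u)) = g (pad_ones r (\<lambda>_. 1))"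
    unfolding bracket_def
  proof (rule ddval_eq[OF laurent_pad_ones[OF g(1)]])
    fix u assume u: "u \<in> torus r" "inj_on u {..<r}"
    have "pad_ones r u \<in> torus N" using u by (auto simp: torus_def pad_ones_def)
    moreover have "inj_on (pad_ones r u) {..<r}" using u by (auto simp: inj_on_def pad_ones_def)
    ultimately have "g (pad_ones r u) = divdiff {..<r} ?F (pad_ones r u)" by (rule g(2))
    also have "\<dots> = divdiff {..<r} (\<lambda>i u. u i ^ m * (partial i ^^ n) (\<lambda>u. f (pad_ones r u)) u) u"
      unfolding divdiff_def partial_iter
      by (intro sum.cong refl arg_cong2[where f="(/)"] arg_cong2[where f="(*)"] prod.cong)
         (auto simp: pad_ones_def pad_ones_upd[unfolded pad_ones_def])
    finally show "g (pad_ones r u) = divdiff {..<r} (\<lambda>i u. u i ^ m * (partial i ^^ n) (\<lambda>u. f (pad_ones r u)) u) u" .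
  qed
  then show ?thesis using g(3) one by simp
qed

text \<open>The exact formula behind the theorem: the eigenvalue equation for \<open>V s\<close>, divided by \<open>V\<close> and
  evaluated at the base point. The factor \<open>C(N, j+1)\<close> counts the index sets, all of which give the
  same value by symmetry.\<close>

lemma gt_schur_eigen_expansion:
  assumes l: "strict_dec N l"
  shows "(\<Sum>j<N. ffact m (of_int (l j))) * gt_schur N l (\<lambda>_. 1) =
    (\<Sum>j\<le>m. of_nat (m choose j) * fact j * of_nat (N choose Suc j) *
       bracket (Suc j) m (m - j) (\<lambda>u. gt_schur N l (pad_ones (Suc j) u)))"
proof -
  define f where "f = gt_schur N l"
  have sf: "sym_laurent N f" and lf: "laurent N f"
    using sym_gt_schur[OF l] laurent_gt_schur by (auto simp: f_def)
  define Fam where "Fam j = (\<lambda>i u. u i ^ m * (partial i ^^ (m - j)) f u)" for j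
  define D where "D j = {D. D \<subseteq> {..<N} \<and> card D = Suc j}" for j
  have eqv: "equivariant N (Fam j)" for j unfolding Fam_def by (rule bracket_family[OF sf])
  have finD: "finite (D j)" for j unfolding D_def by (rule finite_subset[of _ "Pow {..<N}"]) auto
  have Dne: "B \<subseteq> {..<N}" "B \<noteq> {}" "card B = Suc j" if "B \<in> D j" for B j
    using that by (auto simp: D_def)
  \<comment> \<open>\<open>g j B\<close> is the Laurent polynomial that extends the divided difference over \<open>B\<close>.\<close>
  define Q where "Q j B g \<longleftrightarrow> laurent N g \<and>
    (\<forall>u\<in>torus N. inj_on u B \<longrightarrow> g u = divdiff B (Fam j) u) \<and> ddval N B (Fam j) = g (\<lambda>_. 1)" for j B g
  define g where "g j B = (SOME h. Q j B h)" for j B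
  have gQ: "Q j B (g j B)" if "B \<in> D j" for B j
    unfolding g_def
  proof (rule someI_ex[where P="Q j B" for j B])
    show "\<exists>h. Q j B h" using ddval_obtain[OF eqv Dne(1,2)[OF that]] unfolding Q_def by metis
  qed
  have g: "\<And>B j. B \<in> D j \<Longrightarrow> laurent N (g j B)"
    "\<And>B j u. B \<in> D j \<Longrightarrow> u \<in> torus N \<Longrightarrow> inj_on u B \<Longrightarrow> g j B u = divdiff B (Fam j) u"
    "\<And>B j. B \<in> D j \<Longrightarrow> ddval N B (Fam j) = g j B (\<lambda>_. 1)"
    using gQ by (auto simp: Q_def)
  \<comment> \<open>At points with distinct coordinates the Vandermonde product can be cancelled.\<close>
  have id: "(\<Sum>j<N. ffact m (of_int (l j))) * f u = (\<Sum>j\<le>m. of_nat (m choose j) * fact j * (\<Sum>B\<in>D j. g j B u))"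
    if u: "u \<in> torus N" "inj_on u {..<N}" for u
  proof -
    let ?S = "\<lambda>i j. \<Sum>B\<in>{B. B \<subseteq> {..<N} - {i} \<and> card B = j}. 1 / (\<Prod>a\<in>B. u i - u a)"
    have part: "(partial i ^^ m) (\<lambda>u. Determinant.det (alt_mat N l u)) u =
       (\<Sum>j\<le>m. of_nat (m choose j) * (vdm N u * (fact j * ?S i j)) * (partial i ^^ (m - j)) f u)" if i: "i < N" for i
    proof -
      have "(partial i ^^ m) (\<lambda>u. Determinant.det (alt_mat N l u)) u = (partial i ^^ m) (\<lambda>u. vdm N u * f u) u"
        by (rule partial_iter_cong[OF i _ u(1)]) (simp add: vdm_gt_schur[OF _ l] f_def)
      then show ?thesis
        unfolding partial_iter_leibniz[OF laurent_vdm lf u(1) i] partial_iter_vdm[OF i u(2)] .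
    qed
    have "(\<Sum>j<N. ffact m (of_int (l j))) * (vdm N u * f u) =
       (\<Sum>i<N. u i ^ m * (\<Sum>j\<le>m. of_nat (m choose j) * (vdm N u * (fact j * ?S i j)) * (partial i ^^ (m - j)) f u))"
      using det_alt_mat_eigen[OF u(1), of m l] vdm_gt_schur[OF u(1) l] part by (simp add: f_def)
    also have "\<dots> = vdm N u * (\<Sum>j\<le>m. of_nat (m choose j) * fact j * (\<Sum>i<N. \<Sum>B\<in>{B. B \<subseteq> {..<N} - {i} \<and> card B = j}. Fam j i u / (\<Prod>a\<in>B. u i - u a)))"
    proof -
      have "u i ^ m * (\<Sum>j\<le>m. of_nat (m choose j) * (vdm N u * (fact j * ?S i j)) * (partial i ^^ (m - j)) f u)
        = (\<Sum>j\<le>m. vdm N u * (of_nat (m choose j) * fact j * (\<Sum>B\<in>{B. B \<subseteq> {..<N} - {i} \<and> card B = j}. Fam j i u / (\<Prod>a\<in>B. u i - u a))))" for i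
        unfolding sum_distrib_left Fam_def
        by (intro sum.cong refl) (simp add: sum_distrib_left sum_distrib_right mult_ac)
      then show ?thesis by (simp only: sum.swap[of _ "{..<N}"] sum_distrib_left)
    qed
    also have "\<dots> = vdm N u * (\<Sum>j\<le>m. of_nat (m choose j) * fact j * (\<Sum>B\<in>D j. divdiff B (Fam j) u))"
      unfolding sum_pointed_subsets D_def divdiff_def ..
    also have "\<dots> = vdm N u * (\<Sum>j\<le>m. of_nat (m choose j) * fact j * (\<Sum>B\<in>D j. g j B u))"
    proof -
      have "(\<Sum>B\<in>D j. divdiff B (Fam j) u) = (\<Sum>B\<in>D j. g j B u)" for j
        using g(2)[OF _ u(1)] inj_on_subset[OF u(2) Dne(1)] by (intro sum.cong) auto
      then show ?thesis by simp
    qed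
    finally have "vdm N u * ((\<Sum>j<N. ffact m (of_int (l j))) * f u) =
        vdm N u * (\<Sum>j\<le>m. of_nat (m choose j) * fact j * (\<Sum>B\<in>D j. g j B u))"
      by (simp only: mult_ac)
    then show ?thesis using vdm_nz[OF u(2)] by (simp only: mult_cancel_left) simp
  qed
  have "(\<Sum>j<N. ffact m (of_int (l j))) * f (\<lambda>_. 1) = (\<Sum>j\<le>m. of_nat (m choose j) * fact j * (\<Sum>B\<in>D j. g j B (\<lambda>_. 1)))"
    by (rule laurent_eqI[OF laurent_cmult[OF lf] _ id])
       (intro laurent_sum laurent_cmult g torus_one | simp)+
  also have "\<dots> = (\<Sum>j\<le>m. of_nat (m choose j) * fact j * of_nat (N choose Suc j) *
       bracket (Suc j) m (m - j) (\<lambda>u. f (pad_ones (Suc j) u)))"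
  proof (rule sum.cong)
    fix j
    have "(\<Sum>B\<in>D j. g j B (\<lambda>_. 1)) = (\<Sum>B\<in>D j. bracket (Suc j) m (m - j) (\<lambda>u. f (pad_ones (Suc j) u)))"
    proof (rule sum.cong)
      fix B assume B: "B \<in> D j"
      have "Suc j \<le> N" using Dne[OF B] card_mono[of "{..<N}" B] by simp
      then show "g j B (\<lambda>_. 1) = bracket (Suc j) m (m - j) (\<lambda>u. f (pad_ones (Suc j) u))"
        using g(3)[OF B] ddval_card[OF eqv Dne(1,2)[OF B], of j] Dne(3)[OF B] ddval_bracket[OF sf, of "Suc j" m "m - j"]
        by (simp add: Fam_def)
    qed simp
    also have "\<dots> = of_nat (N choose Suc j) * bracket (Suc j) m (m - j) (\<lambda>u. f (pad_ones (Suc j) u))"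
      using n_subsets[of "{..<N}" "Suc j"] by (simp add: D_def)
    finally show "of_nat (m choose j) * fact j * (\<Sum>B\<in>D j. g j B (\<lambda>_. 1)) =
       of_nat (m choose j) * fact j * of_nat (N choose Suc j) * bracket (Suc j) m (m - j) (\<lambda>u. f (pad_ones (Suc j) u))"
      by (simp add: mult_ac)
  qed simp
  finally show ?thesis by (simp add: f_def)
qed

section \<open>Brackets of uniform limits\<close>

definition polyball :: "nat \<Rightarrow> real \<Rightarrow> (nat \<Rightarrow> complex) set" where
  "polyball r \<delta> = {u. \<forall>i<r. u i \<in> cball 1 \<delta>}"

lemma ones_polyball: "0 < \<delta> \<Longrightarrow> (\<lambda>_. 1) \<in> polyball r \<delta>"
  by (simp add: polyball_def)

lemma norm_near_one:
  fixes z :: complex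
  assumes "z \<in> cball 1 \<delta>" shows "1 - \<delta> \<le> norm z" "norm z \<le> 1 + \<delta>"
proof -
  have "norm (1 - z) \<le> \<delta>" using assms by (simp add: dist_norm)
  moreover have "norm (1::complex) \<le> norm (1 - z) + norm z" "norm z \<le> norm (1 - z) + norm (1::complex)"
    using norm_triangle_ineq[of "1 - z" z] norm_triangle_ineq4[of 1 "1 - z"] by (simp_all add: add.commute)
  ultimately show "1 - \<delta> \<le> norm z" "norm z \<le> 1 + \<delta>" by simp_all
qed

lemma polyball_torus: "\<delta> < 1 \<Longrightarrow> u \<in> polyball r \<delta> \<Longrightarrow> u \<in> torus r"
  unfolding polyball_def torus_def using norm_near_one(1)[of _ \<delta>] by fastforce

lemma laurent_bounded:
  assumes "\<delta> < 1"
  shows "laurent r f \<Longrightarrow> \<exists>M. \<forall>u\<in>polyball r \<delta>. norm (f u) \<le> M"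
proof (induction rule: laurent.induct)
  case (var i)
  show ?case
    by (rule exI[of _ "1 + \<delta>"]) (use var norm_near_one(2) in \<open>auto simp: polyball_def\<close>)
next
  case (inv i)
  have "norm (inverse (u i)) \<le> inverse (1 - \<delta>)" if "u \<in> polyball r \<delta>" for u
  proof -
    have "1 - \<delta> \<le> norm (u i)" using that inv norm_near_one(1) by (auto simp: polyball_def)
    then show ?thesis using assms by (simp add: norm_inverse le_imp_inverse_le)
  qed
  then show ?case by blast
next
  case (add f g)
  then obtain M M' where "\<forall>u\<in>polyball r \<delta>. norm (f u) \<le> M" "\<forall>u\<in>polyball r \<delta>. norm (g u) \<le> M'" by blast
  then have "\<forall>u\<in>polyball r \<delta>. norm (f u + g u) \<le> M + M'" by (auto intro!: norm_triangle_mono)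
  then show ?case by blast
next
  case (mult f g)
  then obtain M M' where M: "\<forall>u\<in>polyball r \<delta>. norm (f u) \<le> M" "\<forall>u\<in>polyball r \<delta>. norm (g u) \<le> M'" by blast
  have "\<forall>u\<in>polyball r \<delta>. norm (f u * g u) \<le> M * M'"
  proof
    fix u assume "u \<in> polyball r \<delta>"
    then have "norm (f u) \<le> M" "norm (g u) \<le> M'" using M by auto
    then show "norm (f u * g u) \<le> M * M'"
      unfolding norm_mult by (intro mult_mono) (auto intro: order_trans[OF norm_ge_zero])
  qed
  then show ?case by blast
next
  case (cong f g)
  then show ?case using polyball_torus[OF assms] by metis
qed auto

text \<open>The points \<open>(1, 1 + t, 1 + 2 t, \<dots>)\<close> with \<open>|t|\<close> fixed have well separated coordinates, so there the
  divided difference is bounded by the Cauchy estimates for the derivatives of \<open>f\<close>. The maximum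
  principle in \<open>t\<close> carries the bound to \<open>t = 0\<close>.\<close>

lemma bracket_bound:
  assumes \<delta>: "0 < \<delta>" "\<delta> < 1" and r: "0 < r"
  obtains C where "C \<ge> 0"
    "\<And>f M. sym_laurent r f \<Longrightarrow> (\<And>u. u \<in> polyball r \<delta> \<Longrightarrow> norm (f u) \<le> M) \<Longrightarrow> norm (bracket r m n f) \<le> C * M"
proof -
  \<comment> \<open>For \<open>|t| \<le> \<rho>\<close> all coordinates \<open>1 + i t\<close> stay within \<open>\<delta> / 2\<close> of \<open>1\<close>, which leaves room \<open>\<delta> / 2\<close> for the
    Cauchy estimates.\<close>
  define \<rho> where "\<rho> = \<delta> / (2 * real r)"
  have \<rho>: "0 < \<rho>" using \<delta> r by (simp add: \<rho>_def)
  define C where "C = real r * (2 ^ m * (fact n / (\<delta> / 2) ^ n) / \<rho> ^ (r - 1))"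
  have C0: "C \<ge> 0" using \<delta> \<rho> by (simp add: C_def)
  have "norm (bracket r m n f) \<le> C * M"
    if f: "sym_laurent r f" and M: "\<And>u. u \<in> polyball r \<delta> \<Longrightarrow> norm (f u) \<le> M" for f M
  proof -
    define F where "F = (\<lambda>i u. u i ^ m * (partial i ^^ n) f u)"
    obtain g where g: "laurent r g" "\<And>u. u\<in>torus r \<Longrightarrow> inj_on u {..<r} \<Longrightarrow> g u = divdiff {..<r} F u"
      "ddval r {..<r} F = g (\<lambda>_. 1)"
      using ddval_obtain[OF bracket_family[OF f, of m n], of "{..<r}"] r
      unfolding F_def by (auto simp: lessThan_empty_iff)
    have M0: "0 \<le> M" using M[OF ones_polyball[OF \<delta>(1)]] norm_ge_zero order_trans by blast
    define line where "line t = (\<lambda>i. 1 + of_nat i * t)" for t :: complex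
    have small: "norm (of_nat i * t) \<le> \<delta> / 2" if "norm t \<le> \<rho>" "i < r" for i and t :: complex
    proof -
      have "norm (of_nat i * t) \<le> real r * \<rho>"
        unfolding norm_mult using that by (intro mult_mono) auto
      then show ?thesis using r by (simp add: \<rho>_def)
    qed
    have line_near: "line t \<in> polyball r (\<delta> / 2)" if "norm t \<le> \<rho>" for t
      using small[OF that] by (auto simp: polyball_def line_def dist_norm)
    have partial_bound: "norm ((partial i ^^ n) f u) \<le> fact n * M / (\<delta> / 2) ^ n"
      if u: "u \<in> polyball r (\<delta> / 2)" and i: "i < r" for u i
    proof -
      have ui: "dist 1 (u i) \<le> \<delta> / 2" using u i by (auto simp: polyball_def)
      have near: "dist 1 z \<le> \<delta>" if "z \<in> cball (u i) (\<delta> / 2)" for z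
        using that ui dist_triangle[of 1 z "u i"] by simp
      have inK: "u(i := z) \<in> polyball r \<delta>" if "z \<in> cball (u i) (\<delta> / 2)" for z
        using near[OF that] u \<delta> by (auto simp: polyball_def intro: order_trans)
      have "cball (u i) (\<delta> / 2) \<subseteq> -{0}"
      proof
        fix z assume "z \<in> cball (u i) (\<delta> / 2)"
        from near[OF this] \<delta> show "z \<in> -{0}" by auto
      qed
      moreover have "u \<in> torus r" using polyball_torus[OF _ u] \<delta> by simp
      ultimately have hol: "(\<lambda>z. f (u(i := z))) holomorphic_on cball (u i) (\<delta> / 2)"
        using holomorphic_on_subset[OF laurent_holo[OF sym_laurent_D[OF f]]] by blast
      have "norm ((deriv ^^ n) (\<lambda>z. f (u(i := z))) (u i)) \<le> fact n * M / (\<delta> / 2) ^ n"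
      proof (rule Cauchy_inequality)
        show "(\<lambda>z. f (u(i := z))) holomorphic_on ball (u i) (\<delta> / 2)"
          by (rule holomorphic_on_subset[OF hol]) auto
        show "continuous_on (cball (u i) (\<delta> / 2)) (\<lambda>z. f (u(i := z)))"
          by (rule holomorphic_on_imp_continuous_on[OF hol])
        show "norm (f (u(i := x))) \<le> M" if "norm (u i - x) = \<delta> / 2" for x
          using that by (intro M inK) (simp add: dist_norm)
      qed (use \<delta> in auto)
      then show ?thesis by (simp add: partial_iter)
    qed
    have "norm (g (line 0)) \<le> C * M"
    proof (rule maximum_modulus_frontier[of "\<lambda>t. g (line t)" "cball 0 \<rho>"])
      have "cball 0 \<rho> \<subseteq> {t :: complex. \<forall>i<r. 1 + of_nat i * t \<noteq> 0}"
      proof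
        fix t :: complex assume "t \<in> cball 0 \<rho>"
        then have "line t \<in> torus r" using line_near[of t] polyball_torus[of "\<delta> / 2"] \<delta> by simp
        then show "t \<in> {t :: complex. \<forall>i<r. 1 + of_nat i * t \<noteq> 0}" by (simp add: torus_def line_def)
      qed
      then have hol: "(\<lambda>t. g (line t)) holomorphic_on cball 0 \<rho>"
        unfolding line_def by (rule holomorphic_on_subset[OF laurent_line[OF g(1)]])
      then show "(\<lambda>t. g (line t)) holomorphic_on interior (cball 0 \<rho>)"
        by (rule holomorphic_on_subset) auto
      show "continuous_on (closure (cball 0 \<rho>)) (\<lambda>t. g (line t))"
        using holomorphic_on_imp_continuous_on[OF hol] by simp
      show "norm (g (line t)) \<le> C * M" if "t \<in> frontier (cball 0 \<rho>)" for t
      proof -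
        have t: "norm t = \<rho>" using that \<rho> by simp
        have lt: "line t \<in> polyball r (\<delta> / 2)" using line_near[of t] t by simp
        have inj: "inj_on (line t) {..<r}" using t \<rho> by (auto simp: inj_on_def line_def)
        have "norm (g (line t)) = norm (divdiff {..<r} F (line t))"
          using g(2)[OF _ inj] polyball_torus[OF _ lt] \<delta> by simp
        also have "\<dots> \<le> (\<Sum>i<r. norm (F i (line t) / (\<Prod>a\<in>{..<r} - {i}. line t i - line t a)))"
          unfolding divdiff_def by (rule norm_sum)
        also have "\<dots> \<le> (\<Sum>i<r. 2 ^ m * (fact n * M / (\<delta> / 2) ^ n) / \<rho> ^ (r - 1))"
        proof (rule sum_mono)
          fix i assume "i \<in> {..<r}"
          then have i: "i < r" by simp
          have "norm (line t i) \<le> 2"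
            using lt i norm_near_one(2)[of "line t i" "\<delta> / 2"] \<delta> by (auto simp: polyball_def)
          then have num: "norm (F i (line t)) \<le> 2 ^ m * (fact n * M / (\<delta> / 2) ^ n)"
            unfolding F_def norm_mult norm_power
            using partial_bound[OF lt i] by (intro mult_mono power_mono) auto
          have "\<rho> ^ (r - 1) = (\<Prod>a\<in>{..<r} - {i}. \<rho>)" using i by (simp add: card_Diff_singleton)
          also have "\<dots> \<le> (\<Prod>a\<in>{..<r} - {i}. norm (line t i - line t a))"
          proof (rule prod_mono)
            fix a assume "a \<in> {..<r} - {i}"
            then have "1 \<le> \<bar>real i - real a\<bar>" by auto
            then have "\<rho> \<le> \<bar>real i - real a\<bar> * \<rho>" using \<rho> by simp
            also have "\<dots> = norm ((of_nat i - of_nat a) * t)"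
              unfolding norm_mult t by (metis norm_of_real of_real_diff of_real_of_nat_eq)
            also have "(of_nat i - of_nat a) * t = line t i - line t a"
              by (simp add: line_def algebra_simps)
            finally show "0 \<le> \<rho> \<and> \<rho> \<le> norm (line t i - line t a)" using \<rho> by simp
          qed
          finally have den: "\<rho> ^ (r - 1) \<le> norm (\<Prod>a\<in>{..<r} - {i}. line t i - line t a)"
            by (simp add: prod_norm)
          show "norm (F i (line t) / (\<Prod>a\<in>{..<r} - {i}. line t i - line t a)) \<le> 2 ^ m * (fact n * M / (\<delta> / 2) ^ n) / \<rho> ^ (r - 1)"
            unfolding norm_divide by (rule frac_le) (use num den \<rho> M0 \<delta> in auto)
        qed
        also have "\<dots> = C * M" by (simp add: C_def)
        finally show ?thesis .
      qed
    qed (use \<rho> in auto)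
    moreover have "line 0 = (\<lambda>_. 1)" by (simp add: line_def)
    ultimately show ?thesis using g(3) by (simp add: bracket_def F_def)
  qed
  then show thesis using C0 that by blast
qed

definition sym_closure :: "nat \<Rightarrow> real \<Rightarrow> ((nat \<Rightarrow> complex) \<Rightarrow> complex) \<Rightarrow> bool" where
  "sym_closure r \<delta> f \<longleftrightarrow> (\<exists>p. (\<forall>k::nat. sym_laurent r (p k)) \<and> uniform_limit (polyball r \<delta>) p f sequentially)"

text \<open>The continuous extension of \<open>bracket\<close> to \<open>sym_closure\<close>, computed along an arbitrary
  approximating sequence.\<close>

definition blim :: "nat \<Rightarrow> real \<Rightarrow> nat \<Rightarrow> nat \<Rightarrow> ((nat \<Rightarrow> complex) \<Rightarrow> complex) \<Rightarrow> complex" where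
  "blim r \<delta> m n f = lim (\<lambda>k. bracket r m n ((SOME p. (\<forall>k::nat. sym_laurent r (p k)) \<and>
     uniform_limit (polyball r \<delta>) p f sequentially) k))"

lemma sym_closure_sym: "sym_laurent r p \<Longrightarrow> sym_closure r \<delta> p"
  unfolding sym_closure_def by (rule exI[of _ "\<lambda>_. p"]) (auto intro: uniform_limit_const)

text \<open>By the bound, the brackets along a uniformly convergent sequence form a Cauchy sequence.\<close>

lemma blim_seq:
  assumes \<delta>: "0 < \<delta>" "\<delta> < 1" and r: "0 < r" and f: "sym_closure r \<delta> f"
  obtains q where "\<And>k::nat. sym_laurent r (q k)" "uniform_limit (polyball r \<delta>) q f sequentially"
    "(\<lambda>k. bracket r m n (q k)) \<longlonglongrightarrow> blim r \<delta> m n f"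
proof -
  define q where "q = (SOME p. (\<forall>k::nat. sym_laurent r (p k)) \<and> uniform_limit (polyball r \<delta>) p f sequentially)"
  have q: "(\<forall>k. sym_laurent r (q k)) \<and> uniform_limit (polyball r \<delta>) q f sequentially"
    unfolding q_def by (rule someI_ex[OF f[unfolded sym_closure_def]])
  obtain C where C: "C \<ge> 0" "\<And>f M. sym_laurent r f \<Longrightarrow> (\<And>u. u \<in> polyball r \<delta> \<Longrightarrow> norm (f u) \<le> M) \<Longrightarrow>
     norm (bracket r m n f) \<le> C * M" using bracket_bound[OF \<delta> r] by metis
  have "Cauchy (\<lambda>k. bracket r m n (q k))"
  proof (rule CauchyI)
    fix e :: real assume e: "0 < e"
    define e' where "e' = e / (C + 1) / 2"
    have e': "0 < e'" using e C by (simp add: e'_def)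
    obtain K where K: "\<And>k u. k \<ge> K \<Longrightarrow> u \<in> polyball r \<delta> \<Longrightarrow> dist (q k u) (f u) < e'"
      using uniform_limitD[OF conjunct2[OF q] e'] unfolding eventually_sequentially by blast
    have "norm (bracket r m n (q k) - bracket r m n (q l)) < e" if "k \<ge> K" "l \<ge> K" for k l
    proof -
      have "norm (bracket r m n (\<lambda>u. q k u - q l u)) \<le> C * (2 * e')"
      proof (rule C(2))
        show "sym_laurent r (\<lambda>u. q k u - q l u)" using q by (intro sym_laurent_diff) auto
        fix u assume u: "u \<in> polyball r \<delta>"
        have "dist (q k u) (q l u) \<le> dist (q k u) (f u) + dist (q l u) (f u)" by (rule dist_triangle2)
        then show "norm (q k u - q l u) \<le> 2 * e'"
          using K[OF that(1) u] K[OF that(2) u] by (simp add: dist_norm)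
      qed
      also have "C * (2 * e') < (C + 1) * (2 * e')" using e' by simp
      also have "\<dots> = e" using C(1) by (auto simp: e'_def divide_eq_eq algebra_simps)
      finally show ?thesis using bracket_diff[of r "q k" "q l" m n] q r by simp
    qed
    then show "\<exists>K. \<forall>k\<ge>K. \<forall>l\<ge>K. norm (bracket r m n (q k) - bracket r m n (q l)) < e" by blast
  qed
  then have "(\<lambda>k. bracket r m n (q k)) \<longlonglongrightarrow> blim r \<delta> m n f"
    unfolding blim_def q_def[symmetric] by (simp add: Cauchy_convergent_iff convergent_LIMSEQ_iff)
  then show thesis using that q by blast
qed

lemma blim_diff_bound:
  assumes \<delta>: "0 < \<delta>" "\<delta> < 1" and r: "0 < r"
  obtains C where "C \<ge> 0"
    "\<And>f g M. sym_closure r \<delta> f \<Longrightarrow> sym_closure r \<delta> g \<Longrightarrow> (\<And>u. u \<in> polyball r \<delta> \<Longrightarrow> norm (f u - g u) \<le> M) \<Longrightarrow>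
       norm (blim r \<delta> m n f - blim r \<delta> m n g) \<le> C * M"
proof -
  obtain C where C: "C \<ge> 0" "\<And>f M. sym_laurent r f \<Longrightarrow> (\<And>u. u \<in> polyball r \<delta> \<Longrightarrow> norm (f u) \<le> M) \<Longrightarrow>
     norm (bracket r m n f) \<le> C * M" using bracket_bound[OF \<delta> r] by metis
  have "norm (blim r \<delta> m n f - blim r \<delta> m n g) \<le> C * M"
    if f: "sym_closure r \<delta> f" and g: "sym_closure r \<delta> g" and M: "\<And>u. u \<in> polyball r \<delta> \<Longrightarrow> norm (f u - g u) \<le> M"
    for f g M
  proof (rule field_le_epsilon)
    fix e :: real assume e: "0 < e"
    define e' where "e' = e / (C + 1) / 2"
    have e': "0 < e'" using e C by (simp add: e'_def)
    obtain p where p: "\<And>k::nat. sym_laurent r (p k)" "uniform_limit (polyball r \<delta>) p f sequentially"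
      "(\<lambda>k. bracket r m n (p k)) \<longlonglongrightarrow> blim r \<delta> m n f" using blim_seq[OF \<delta> r f] by metis
    obtain q where q: "\<And>k::nat. sym_laurent r (q k)" "uniform_limit (polyball r \<delta>) q g sequentially"
      "(\<lambda>k. bracket r m n (q k)) \<longlonglongrightarrow> blim r \<delta> m n g" using blim_seq[OF \<delta> r g] by metis
    have "\<forall>\<^sub>F k in sequentially. norm (bracket r m n (p k) - bracket r m n (q k)) \<le> C * (M + 2 * e')"
      using uniform_limitD[OF p(2) e'] uniform_limitD[OF q(2) e']
    proof eventually_elim
      case (elim k)
      have "norm (bracket r m n (\<lambda>u. p k u - q k u)) \<le> C * (M + 2 * e')"
      proof (rule C(2)[OF sym_laurent_diff[OF p(1) q(1)]])
        fix u assume u: "u \<in> polyball r \<delta>"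
        have "p k u - q k u = (p k u - f u) + (f u - g u) + (g u - q k u)" by simp
        then have "norm (p k u - q k u) \<le> norm (p k u - f u) + norm (f u - g u) + norm (g u - q k u)"
          by (metis norm_triangle_ineq norm_triangle_mono order_refl)
        then show "norm (p k u - q k u) \<le> M + 2 * e'"
          using elim u M[OF u] by (fastforce simp: dist_norm norm_minus_commute)
      qed
      then show ?case using bracket_diff[OF p(1) q(1) r, of m n k k] by simp
    qed
    then have "norm (blim r \<delta> m n f - blim r \<delta> m n g) \<le> C * (M + 2 * e')"
      by (rule tendsto_upperbound[OF tendsto_norm[OF tendsto_diff[OF p(3) q(3)]]]) simp
    also have "\<dots> \<le> C * M + e"
    proof -
      have "C * (2 * e') \<le> (C + 1) * (2 * e')" using e' by simp
      also have "\<dots> = e" using C(1) by (auto simp: e'_def divide_eq_eq algebra_simps)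
      finally show ?thesis by (simp add: distrib_left)
    qed
    finally show "norm (blim r \<delta> m n f - blim r \<delta> m n g) \<le> C * M + e" .
  qed
  then show thesis using C(1) that by blast
qed

lemma blim_sym:
  assumes \<delta>: "0 < \<delta>" "\<delta> < 1" and r: "0 < r" and p: "sym_laurent r p"
  shows "blim r \<delta> m n p = bracket r m n p"
proof -
  obtain C where C: "C \<ge> 0" "\<And>f M. sym_laurent r f \<Longrightarrow> (\<And>u. u \<in> polyball r \<delta> \<Longrightarrow> norm (f u) \<le> M) \<Longrightarrow>
     norm (bracket r m n f) \<le> C * M" using bracket_bound[OF \<delta> r] by metis
  obtain q where q: "\<And>k::nat. sym_laurent r (q k)" "uniform_limit (polyball r \<delta>) q p sequentially"
      "(\<lambda>k. bracket r m n (q k)) \<longlonglongrightarrow> blim r \<delta> m n p" using blim_seq[OF \<delta> r sym_closure_sym[OF p]] by metis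
  have "(\<lambda>k. bracket r m n (q k)) \<longlonglongrightarrow> bracket r m n p"
  proof (rule tendstoI)
    fix e :: real assume e: "0 < e"
    define e' where "e' = e / (C + 1)"
    have e': "0 < e'" using e C by (simp add: e'_def)
    show "\<forall>\<^sub>F k in sequentially. dist (bracket r m n (q k)) (bracket r m n p) < e"
      using uniform_limitD[OF q(2) e']
    proof eventually_elim
      case (elim k)
      have "norm (bracket r m n (\<lambda>u. q k u - p u)) \<le> C * e'"
        by (rule C(2)[OF sym_laurent_diff[OF q(1) p]]) (use elim in \<open>fastforce simp: dist_norm\<close>)
      also have "\<dots> < (C + 1) * e'" using e' by simp
      also have "\<dots> = e" using C by (simp add: e'_def)
      finally show ?case using bracket_diff[OF q(1) p r, of m n k] by (simp add: dist_norm)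
    qed
  qed
  then show ?thesis using LIMSEQ_unique[OF q(3)] by simp
qed

lemma blim_tendsto:
  assumes \<delta>: "0 < \<delta>" "\<delta> < 1" and r: "0 < r"
    and lim: "uniform_limit (polyball r \<delta>) f g F" and f: "\<forall>\<^sub>F x in F. sym_closure r \<delta> (f x)"
    and g: "sym_closure r \<delta> g"
  shows "((\<lambda>x. blim r \<delta> m n (f x)) \<longlongrightarrow> blim r \<delta> m n g) F"
proof (rule tendstoI)
  fix e :: real assume e: "0 < e"
  obtain C where C: "C \<ge> 0" "\<And>f g M. sym_closure r \<delta> f \<Longrightarrow> sym_closure r \<delta> g \<Longrightarrow>
     (\<And>u. u \<in> polyball r \<delta> \<Longrightarrow> norm (f u - g u) \<le> M) \<Longrightarrow> norm (blim r \<delta> m n f - blim r \<delta> m n g) \<le> C * M"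
    using blim_diff_bound[OF \<delta> r] by metis
  define e' where "e' = e / (C + 1)"
  have e': "0 < e'" using e C by (simp add: e'_def)
  show "\<forall>\<^sub>F x in F. dist (blim r \<delta> m n (f x)) (blim r \<delta> m n g) < e"
    using uniform_limitD[OF lim e'] f
  proof eventually_elim
    case (elim x)
    have "norm (blim r \<delta> m n (f x) - blim r \<delta> m n g) \<le> C * e'"
      by (rule C(2)[OF elim(2) g]) (use elim in \<open>fastforce simp: dist_norm\<close>)
    also have "\<dots> < (C + 1) * e'" using e' by simp
    also have "\<dots> = e" using C by (simp add: e'_def)
    finally show ?case by (simp add: dist_norm)
  qed
qed

lemma sym_closure_limit:
  assumes lim: "uniform_limit (polyball r \<delta>) f g F" and f: "\<forall>\<^sub>F x in F. sym_closure r \<delta> (f x)" and F: "F \<noteq> bot"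
  shows "sym_closure r \<delta> g"
proof -
  have "\<exists>p. sym_laurent r p \<and> (\<forall>u\<in>polyball r \<delta>. dist (p u) (g u) < 2 * inverse (real (Suc k)))" for k
  proof -
    have pos: "0 < inverse (real (Suc k))" by simp
    have "\<exists>x. (\<forall>u\<in>polyball r \<delta>. dist (f x u) (g u) < inverse (real (Suc k))) \<and> sym_closure r \<delta> (f x)"
      using eventually_happens[OF eventually_conj[OF uniform_limitD[OF lim pos] f]] F by auto
    then obtain x where x: "\<forall>u\<in>polyball r \<delta>. dist (f x u) (g u) < inverse (real (Suc k))" "sym_closure r \<delta> (f x)" by blast
    obtain p where p: "\<forall>k::nat. sym_laurent r (p k)" "uniform_limit (polyball r \<delta>) p (f x) sequentially"
      using x(2) unfolding sym_closure_def by blast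
    obtain l where l: "\<forall>u\<in>polyball r \<delta>. dist (p l u) (f x u) < inverse (real (Suc k))"
      using eventually_happens[OF uniform_limitD[OF p(2) pos]] by auto
    have "dist (p l u) (g u) < 2 * inverse (real (Suc k))" if "u \<in> polyball r \<delta>" for u
      using dist_triangle[of "p l u" "g u" "f x u"] x(1) l that by fastforce
    then show ?thesis using p(1) by blast
  qed
  then obtain p where p: "\<And>k. sym_laurent r (p k)"
    "\<And>k u. u \<in> polyball r \<delta> \<Longrightarrow> dist (p k u) (g u) < 2 * inverse (real (Suc k))"
    by metis
  have "uniform_limit (polyball r \<delta>) p g sequentially"
  proof (rule uniform_limitI)
    fix e :: real assume "0 < e"
    then have "\<forall>\<^sub>F k in sequentially. inverse (real (Suc k)) < e / 2"
      using order_tendstoD(2)[OF LIMSEQ_inverse_real_of_nat, of "e / 2"] by simp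
    then show "\<forall>\<^sub>F k in sequentially. \<forall>u\<in>polyball r \<delta>. dist (p k u) (g u) < e"
    proof eventually_elim
      case (elim k)
      show ?case
      proof
        fix u assume "u \<in> polyball r \<delta>"
        from p(2)[OF this, of k] elim show "dist (p k u) (g u) < e" by simp
      qed
    qed
  qed
  then show ?thesis using p(1) unfolding sym_closure_def by blast
qed

lemma sym_closure_bounded:
  assumes "\<delta> < 1" "sym_closure r \<delta> f"
  shows "bounded (f ` polyball r \<delta>)"
proof -
  obtain p where p: "\<forall>k::nat. sym_laurent r (p k)" "uniform_limit (polyball r \<delta>) p f sequentially"
    using assms(2) unfolding sym_closure_def by blast
  obtain k where k: "\<forall>u\<in>polyball r \<delta>. dist (p k u) (f u) < 1"
    using eventually_happens[OF uniform_limitD[OF p(2), of 1]] by auto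
  obtain M where M: "\<forall>u\<in>polyball r \<delta>. norm (p k u) \<le> M"
    using laurent_bounded[OF assms(1) sym_laurent_D] p(1) by blast
  have "norm (f u) \<le> M + 1" if "u \<in> polyball r \<delta>" for u
    using k M that norm_triangle_ineq2[of "f u" "p k u"] by (fastforce simp: dist_norm norm_minus_commute)
  then show ?thesis unfolding bounded_iff by blast
qed

lemma sym_closure_mult:
  assumes "\<delta> < 1" "sym_closure r \<delta> f" "sym_closure r \<delta> g"
  shows "sym_closure r \<delta> (\<lambda>u. f u * g u)"
proof -
  obtain p where p: "\<forall>k::nat. sym_laurent r (p k)" "uniform_limit (polyball r \<delta>) p f sequentially"
    using assms(2) unfolding sym_closure_def by blast
  obtain q where q: "\<forall>k::nat. sym_laurent r (q k)" "uniform_limit (polyball r \<delta>) q g sequentially"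
    using assms(3) unfolding sym_closure_def by blast
  have "uniform_limit (polyball r \<delta>) (\<lambda>k u. p k u * q k u) (\<lambda>u. f u * g u) sequentially"
    by (rule uniform_lim_mult[OF p(2) q(2) sym_closure_bounded[OF assms(1,2)] sym_closure_bounded[OF assms(1,3)]])
  moreover have "\<forall>k. sym_laurent r (\<lambda>u. p k u * q k u)" using p(1) q(1) by (simp add: sym_laurent_mult)
  ultimately show ?thesis unfolding sym_closure_def by (intro exI[of _ "\<lambda>k u. p k u * q k u"] conjI)
qed

lemma sym_closure_add:
  assumes "sym_closure r \<delta> f" "sym_closure r \<delta> g"
  shows "sym_closure r \<delta> (\<lambda>u. f u + g u)"
proof -
  obtain p where p: "\<forall>k::nat. sym_laurent r (p k)" "uniform_limit (polyball r \<delta>) p f sequentially"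
    using assms(1) unfolding sym_closure_def by blast
  obtain q where q: "\<forall>k::nat. sym_laurent r (q k)" "uniform_limit (polyball r \<delta>) q g sequentially"
    using assms(2) unfolding sym_closure_def by blast
  have "uniform_limit (polyball r \<delta>) (\<lambda>k u. p k u + q k u) (\<lambda>u. f u + g u) sequentially"
    by (rule uniform_limit_add[OF p(2) q(2)])
  moreover have "\<forall>k. sym_laurent r (\<lambda>u. p k u + q k u)" using p(1) q(1) by (simp add: sym_laurent_add)
  ultimately show ?thesis unfolding sym_closure_def by (intro exI[of _ "\<lambda>k u. p k u + q k u"] conjI)
qed

lemma sym_closure_const: "sym_closure r \<delta> (\<lambda>_. c)"
  by (rule sym_closure_sym[OF sym_laurent_const])

lemma sym_closure_cmult: "\<delta> < 1 \<Longrightarrow> sym_closure r \<delta> f \<Longrightarrow> sym_closure r \<delta> (\<lambda>u. c * f u)"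
  by (intro sym_closure_mult sym_closure_const)

lemma sym_closure_power: "\<delta> < 1 \<Longrightarrow> sym_closure r \<delta> f \<Longrightarrow> sym_closure r \<delta> (\<lambda>u. f u ^ n)"
  by (induction n) (auto intro: sym_closure_mult sym_closure_const)

lemma sym_closure_sum:
  "(\<And>x. x \<in> A \<Longrightarrow> sym_closure r \<delta> (f x)) \<Longrightarrow> sym_closure r \<delta> (\<lambda>u. \<Sum>x\<in>A. f x u)"
  by (induction A rule: infinite_finite_induct) (auto intro: sym_closure_add sym_closure_const)

lemma blim_add:
  assumes \<delta>: "0 < \<delta>" "\<delta> < 1" and r: "0 < r" and "sym_closure r \<delta> f" "sym_closure r \<delta> g"
  shows "blim r \<delta> m n (\<lambda>u. f u + g u) = blim r \<delta> m n f + blim r \<delta> m n g"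
proof -
  obtain p where p: "\<And>k::nat. sym_laurent r (p k)" "uniform_limit (polyball r \<delta>) p f sequentially"
      "(\<lambda>k. bracket r m n (p k)) \<longlonglongrightarrow> blim r \<delta> m n f" using blim_seq[OF \<delta> r assms(4)] by metis
  obtain q where q: "\<And>k::nat. sym_laurent r (q k)" "uniform_limit (polyball r \<delta>) q g sequentially"
      "(\<lambda>k. bracket r m n (q k)) \<longlonglongrightarrow> blim r \<delta> m n g" using blim_seq[OF \<delta> r assms(5)] by metis
  have "(\<lambda>k. blim r \<delta> m n (\<lambda>u. p k u + q k u)) \<longlonglongrightarrow> blim r \<delta> m n (\<lambda>u. f u + g u)"
    by (intro blim_tendsto[OF \<delta> r uniform_limit_add[OF p(2) q(2)]] always_eventually allI
        sym_closure_sym sym_laurent_add p(1) q(1) sym_closure_add assms)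
  then have "(\<lambda>k. bracket r m n (p k) + bracket r m n (q k)) \<longlonglongrightarrow> blim r \<delta> m n (\<lambda>u. f u + g u)"
    by (simp add: blim_sym[OF \<delta> r] sym_laurent_add p(1) q(1) bracket_add r)
  then show ?thesis using LIMSEQ_unique tendsto_add[OF p(3) q(3)] by blast
qed

lemma blim_cmult:
  assumes \<delta>: "0 < \<delta>" "\<delta> < 1" and r: "0 < r" and "sym_closure r \<delta> f"
  shows "blim r \<delta> m n (\<lambda>u. c * f u) = c * blim r \<delta> m n f"
proof -
  obtain p where p: "\<And>k::nat. sym_laurent r (p k)" "uniform_limit (polyball r \<delta>) p f sequentially"
      "(\<lambda>k. bracket r m n (p k)) \<longlonglongrightarrow> blim r \<delta> m n f" using blim_seq[OF \<delta> r assms(4)] by metis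
  have "uniform_limit (polyball r \<delta>) (\<lambda>k u. c * p k u) (\<lambda>u. c * f u) sequentially"
    by (rule bounded_linear.uniform_limit[OF bounded_linear_mult_right p(2)])
  then have "(\<lambda>k. blim r \<delta> m n (\<lambda>u. c * p k u)) \<longlonglongrightarrow> blim r \<delta> m n (\<lambda>u. c * f u)"
    by (intro blim_tendsto[OF \<delta> r] always_eventually allI
        sym_closure_sym sym_laurent_cmult p(1) sym_closure_cmult assms)
  then have "(\<lambda>k. c * bracket r m n (p k)) \<longlonglongrightarrow> blim r \<delta> m n (\<lambda>u. c * f u)"
    by (simp add: blim_sym[OF \<delta> r] sym_laurent_cmult p(1) bracket_cmult r)
  then show ?thesis using LIMSEQ_unique tendsto_mult_left[OF p(3)] by blast
qed

lemma blim_sum: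
  assumes \<delta>: "0 < \<delta>" "\<delta> < 1" and r: "0 < r" and "finite A" "\<And>x. x \<in> A \<Longrightarrow> sym_closure r \<delta> (f x)"
  shows "blim r \<delta> m n (\<lambda>u. \<Sum>x\<in>A. f x u) = (\<Sum>x\<in>A. blim r \<delta> m n (f x))"
  using assms(4,5)
proof (induction A rule: finite_induct)
  case empty
  show ?case using blim_cmult[OF \<delta> r sym_closure_const[of r \<delta> 0], of m n 0] by simp
next
  case (insert x A)
  then show ?case
    using blim_add[OF \<delta> r insert.prems[of x] sym_closure_sum[of A r \<delta> f], of m n] by simp
qed

text \<open>The approximants can be normalized by subtracting their values at the base point.\<close>

lemma sym_approx_vanishing:
  assumes \<delta>: "0 < \<delta>" and a: "sym_closure r \<delta> a" "a (\<lambda>_. 1) = 0"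
  obtains p where "\<And>k::nat. sym_laurent r (p k)" "\<And>k. p k (\<lambda>_. 1) = 0" "uniform_limit (polyball r \<delta>) p a sequentially"
proof -
  obtain p where p: "\<forall>k::nat. sym_laurent r (p k)" "uniform_limit (polyball r \<delta>) p a sequentially"
    using a(1) unfolding sym_closure_def by blast
  have "uniform_limit (polyball r \<delta>) (\<lambda>k u. p k u - p k (\<lambda>_. 1)) a sequentially"
  proof (rule uniform_limitI)
    fix e :: real assume "0 < e"
    then have e: "0 < e / 2" by simp
    show "\<forall>\<^sub>F k in sequentially. \<forall>u\<in>polyball r \<delta>. dist (p k u - p k (\<lambda>_. 1)) (a u) < e"
      using uniform_limitD[OF p(2) e]
    proof eventually_elim
      case (elim k)
      have 1: "norm (p k (\<lambda>_. 1)) < e / 2" using elim ones_polyball[OF \<delta>, of r] a(2) by (force simp: dist_norm)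
      show ?case
      proof
        fix u assume "u \<in> polyball r \<delta>"
        then have "norm (p k u - a u) < e / 2" using elim by (simp add: dist_norm)
        then show "dist (p k u - p k (\<lambda>_. 1)) (a u) < e"
          using 1 norm_triangle_ineq4[of "p k u - a u" "p k (\<lambda>_. 1)"] by (simp add: dist_norm algebra_simps)
      qed
    qed
  qed
  then show thesis
    using p(1) by (intro that[of "\<lambda>k u. p k u - p k (\<lambda>_. 1)"]) (auto intro: sym_laurent_diff sym_laurent_const)
qed

lemma uniform_limit_power:
  assumes \<delta>: "\<delta> < 1" and "sym_closure r \<delta> a" "uniform_limit (polyball r \<delta>) p a F"
  shows "uniform_limit (polyball r \<delta>) (\<lambda>k u. p k u ^ q) (\<lambda>u. a u ^ q) F"
proof (induction q)
  case 0
  then show ?case by (simp add: uniform_limit_const)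
next
  case (Suc q)
  show ?case unfolding power_Suc
    by (rule uniform_lim_mult[OF assms(3) Suc sym_closure_bounded[OF \<delta> assms(2)]
          sym_closure_bounded[OF \<delta> sym_closure_power[OF \<delta> assms(2)]]])
qed

lemma blim_power_vanish:
  assumes \<delta>: "0 < \<delta>" "\<delta> < 1" and r: "0 < r" and a: "sym_closure r \<delta> a" "a (\<lambda>_. 1) = 0"
    and f: "sym_closure r \<delta> f" and q: "n < q \<or> n = q \<and> f (\<lambda>_. 1) = 0"
  shows "blim r \<delta> m n (\<lambda>u. a u ^ q * f u) = 0"
proof -
  obtain p where p: "\<And>k::nat. sym_laurent r (p k)" "\<And>k. p k (\<lambda>_. 1) = 0" "uniform_limit (polyball r \<delta>) p a sequentially"
    using sym_approx_vanishing[OF \<delta>(1) a] by metis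
  have "\<exists>h. (\<forall>k::nat. sym_laurent r (h k)) \<and> uniform_limit (polyball r \<delta>) h f sequentially \<and>
     (\<forall>k. n < q \<or> n = q \<and> h k (\<lambda>_. 1) = 0)"
    using q
  proof
    assume "n < q" then show ?thesis using f unfolding sym_closure_def by blast
  next
    assume "n = q \<and> f (\<lambda>_. 1) = 0"
    then show ?thesis using sym_approx_vanishing[OF \<delta>(1) f] by metis
  qed
  then obtain h where h: "\<And>k::nat. sym_laurent r (h k)" "uniform_limit (polyball r \<delta>) h f sequentially"
    "\<And>k. n < q \<or> n = q \<and> h k (\<lambda>_. 1) = 0" by blast
  have "uniform_limit (polyball r \<delta>) (\<lambda>k u. p k u ^ q * h k u) (\<lambda>u. a u ^ q * f u) sequentially"
    by (rule uniform_lim_mult[OF uniform_limit_power[OF \<delta>(2) a(1) p(3)] h(2)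
          sym_closure_bounded[OF \<delta>(2) sym_closure_power[OF \<delta>(2) a(1)]] sym_closure_bounded[OF \<delta>(2) f]])
  then have "(\<lambda>k. blim r \<delta> m n (\<lambda>u. p k u ^ q * h k u)) \<longlonglongrightarrow> blim r \<delta> m n (\<lambda>u. a u ^ q * f u)"
    by (intro blim_tendsto[OF \<delta> r] always_eventually allI sym_closure_sym sym_laurent_mult
        sym_laurent_power p(1) h(1) sym_closure_mult sym_closure_power \<delta> a f)
  moreover have "blim r \<delta> m n (\<lambda>u. p k u ^ q * h k u) = 0" for k
  proof -
    have "blim r \<delta> m n (\<lambda>u. p k u ^ q * h k u) = bracket r m n (\<lambda>u. p k u ^ q * h k u)"
      by (intro blim_sym[OF \<delta> r] sym_laurent_mult sym_laurent_power p(1) h(1))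
    also have "\<dots> = 0"
      using h(3)[of k]
    proof
      assume "n < q"
      then show ?thesis by (rule bracket_power_gt[OF p(1,2) h(1) _ r])
    next
      assume "n = q \<and> h k (\<lambda>_. 1) = 0"
      then show ?thesis using bracket_power_eq[OF p(1,2) h(1) _ r] by blast
    qed
    finally show ?thesis .
  qed
  ultimately have "(\<lambda>k::nat. 0) \<longlonglongrightarrow> blim r \<delta> m n (\<lambda>u. a u ^ q * f u)" by simp
  then show ?thesis using LIMSEQ_unique tendsto_const by blast
qed

lemma uniform_limit_exp_series:
  assumes "bounded (a ` X)"
  shows "uniform_limit X (\<lambda>Q u. \<Sum>q<Q. (a u :: complex) ^ q / fact q) (\<lambda>u. exp (a u)) sequentially"
proof -
  obtain B where B: "\<And>u. u \<in> X \<Longrightarrow> norm (a u) \<le> B" using assms by (auto simp: bounded_iff)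
  have "uniform_limit X (\<lambda>Q u. \<Sum>q<Q. a u ^ q / fact q) (\<lambda>u. suminf (\<lambda>q. a u ^ q / fact q)) sequentially"
  proof (rule Weierstrass_m_test)
    fix q u assume "u \<in> X"
    then have "norm (a u) \<le> B" by (rule B)
    then show "norm (a u ^ q / fact q) \<le> B ^ q / fact q"
      by (simp add: norm_divide norm_power divide_right_mono power_mono)
  next
    show "summable (\<lambda>q. B ^ q / fact q)"
      using summable_exp_generic[of B] by (simp add: divide_inverse mult.commute)
  qed
  also have "(\<lambda>u. suminf (\<lambda>q. a u ^ q / fact q)) = (\<lambda>u. exp (a u))"
    by (simp add: exp_def divide_inverse scaleR_conv_of_real mult.commute)
  finally show ?thesis .
qed

lemma sym_closure_exp:
  assumes "\<delta> < 1" "sym_closure r \<delta> a"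
  shows "sym_closure r \<delta> (\<lambda>u. exp (a u))"
proof (rule sym_closure_limit[OF uniform_limit_exp_series[OF sym_closure_bounded[OF assms]]])
  have "sym_closure r \<delta> (\<lambda>u. \<Sum>q<Q. inverse (fact q) * a u ^ q)" for Q
    by (intro sym_closure_sum sym_closure_cmult sym_closure_power assms)
  then show "\<forall>\<^sub>F Q in sequentially. sym_closure r \<delta> (\<lambda>u. \<Sum>q<Q. a u ^ q / fact q)"
    by (simp add: divide_inverse mult.commute)
qed simp

text \<open>The bracket kills all terms of the exponential series with more than \<open>n\<close> factors \<open>a\<close>.\<close>

lemma blim_exp_mult:
  assumes \<delta>: "0 < \<delta>" "\<delta> < 1" and r: "0 < r" and a: "sym_closure r \<delta> a" "a (\<lambda>_. 1) = 0"
    and w: "sym_closure r \<delta> w"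
  shows "blim r \<delta> m n (\<lambda>u. exp (z * a u) * w u) =
    (\<Sum>q\<le>n. z ^ q / fact q * blim r \<delta> m n (\<lambda>u. a u ^ q * w u))"
proof -
  have za: "sym_closure r \<delta> (\<lambda>u. z * a u)" by (intro sym_closure_cmult \<delta> a)
  have lim: "uniform_limit (polyball r \<delta>) (\<lambda>Q u. (\<Sum>q<Q. (z * a u) ^ q / fact q) * w u) (\<lambda>u. exp (z * a u) * w u) sequentially"
    by (rule uniform_lim_mult[OF uniform_limit_exp_series[OF sym_closure_bounded[OF \<delta>(2) za]] uniform_limit_const
          sym_closure_bounded[OF \<delta>(2) sym_closure_exp[OF \<delta>(2) za]] sym_closure_bounded[OF \<delta>(2) w]])
  have tm: "sym_closure r \<delta> (\<lambda>u. z ^ q / fact q * (a u ^ q * w u))" for q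
    by (intro sym_closure_cmult sym_closure_mult sym_closure_power \<delta> a w)
  have part: "(\<lambda>u. (\<Sum>q<Q. (z * a u) ^ q / fact q) * w u) = (\<lambda>u. \<Sum>q<Q. z ^ q / fact q * (a u ^ q * w u))" for Q
    by (simp add: sum_distrib_left power_mult_distrib mult_ac)
  have "(\<lambda>Q. blim r \<delta> m n (\<lambda>u. \<Sum>q<Q. z ^ q / fact q * (a u ^ q * w u))) \<longlonglongrightarrow> blim r \<delta> m n (\<lambda>u. exp (z * a u) * w u)"
    using lim unfolding part
    by (intro blim_tendsto[OF \<delta> r] always_eventually allI sym_closure_sum tm sym_closure_mult
        sym_closure_exp za w \<delta>)
  moreover have "(\<lambda>Q. blim r \<delta> m n (\<lambda>u. \<Sum>q<Q. z ^ q / fact q * (a u ^ q * w u))) \<longlonglongrightarrow>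
     (\<Sum>q\<le>n. z ^ q / fact q * blim r \<delta> m n (\<lambda>u. a u ^ q * w u))"
  proof (rule tendsto_eventually)
    show "\<forall>\<^sub>F Q in sequentially. blim r \<delta> m n (\<lambda>u. \<Sum>q<Q. z ^ q / fact q * (a u ^ q * w u)) =
     (\<Sum>q\<le>n. z ^ q / fact q * blim r \<delta> m n (\<lambda>u. a u ^ q * w u))"
    using eventually_gt_at_top[of n]
  proof eventually_elim
    case (elim Q)
    have "blim r \<delta> m n (\<lambda>u. \<Sum>q<Q. z ^ q / fact q * (a u ^ q * w u)) =
       (\<Sum>q<Q. blim r \<delta> m n (\<lambda>u. z ^ q / fact q * (a u ^ q * w u)))"
      by (intro blim_sum[OF \<delta> r] tm) auto
    also have "\<dots> = (\<Sum>q<Q. z ^ q / fact q * blim r \<delta> m n (\<lambda>u. a u ^ q * w u))"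
      by (intro sum.cong refl blim_cmult[OF \<delta> r] sym_closure_mult sym_closure_power \<delta> a w)
    also have "\<dots> = (\<Sum>q\<le>n. z ^ q / fact q * blim r \<delta> m n (\<lambda>u. a u ^ q * w u))"
      using elim blim_power_vanish[OF \<delta> r a w, of n] by (intro sum.mono_neutral_right) auto
    finally show ?case .
  qed
  qed
  ultimately show ?thesis by (rule LIMSEQ_unique)
qed

text \<open>Replacing \<open>W N\<close> by its limit \<open>w\<close> changes the bracket by \<open>o(N\<^bsup>n-1\<^esup>)\<close> only. The coefficients of
  \<open>N\<^sup>q\<close> with \<open>q < n\<close> converge by continuity, and the coefficient of \<open>N\<^sup>n\<close> does not change at all because
  \<open>W N\<close> and \<open>w\<close> agree at the base point.\<close>

lemma blim_exp_perturb:
  assumes \<delta>: "0 < \<delta>" "\<delta> < 1" and r: "0 < r" and a: "sym_closure r \<delta> a" "a (\<lambda>_. 1) = 0"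
    and w: "sym_closure r \<delta> w" "w (\<lambda>_. 1) = 1"
    and W: "\<forall>\<^sub>F N in sequentially. sym_closure r \<delta> (W N) \<and> W N (\<lambda>_. 1) = 1"
    and lim: "uniform_limit (polyball r \<delta>) W w sequentially"
  shows "(\<lambda>N. of_nat N * ((blim r \<delta> m n (\<lambda>u. exp (of_nat N * a u) * W N u) -
     blim r \<delta> m n (\<lambda>u. exp (of_nat N * a u) * w u)) / of_nat N ^ n)) \<longlonglongrightarrow> 0"
proof -
  let ?b = "blim r \<delta> m n"
  define d where "d q N = ?b (\<lambda>u. a u ^ q * W N u) - ?b (\<lambda>u. a u ^ q * w u)" for q N
  have d0: "d q \<longlonglongrightarrow> 0" for q
  proof -
    have "uniform_limit (polyball r \<delta>) (\<lambda>N u. a u ^ q * W N u) (\<lambda>u. a u ^ q * w u) sequentially"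
      by (rule uniform_lim_mult[OF uniform_limit_const lim
            sym_closure_bounded[OF \<delta>(2) sym_closure_power[OF \<delta>(2) a(1)]] sym_closure_bounded[OF \<delta>(2) w(1)]])
    moreover have "\<forall>\<^sub>F N in sequentially. sym_closure r \<delta> (\<lambda>u. a u ^ q * W N u)"
      using W by eventually_elim (rule sym_closure_mult[OF \<delta>(2) sym_closure_power[OF \<delta>(2) a(1)]], simp)
    ultimately have "(\<lambda>N. ?b (\<lambda>u. a u ^ q * W N u)) \<longlonglongrightarrow> ?b (\<lambda>u. a u ^ q * w u)"
      by (intro blim_tendsto[OF \<delta> r] sym_closure_mult sym_closure_power \<delta> a w)
    then show ?thesis unfolding d_def by (rule LIM_zero)
  qed
  \<comment> \<open>This term carries the factor \<open>a\<^sup>n (W\<^sub>N - w)\<close>, where \<open>W\<^sub>N - w\<close> vanishes at the base point.\<close>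
  have dn: "\<forall>\<^sub>F N in sequentially. d n N = 0"
    using W
  proof eventually_elim
    case (elim N)
    have sc: "sym_closure r \<delta> (\<lambda>u. W N u + (-1) * w u)"
      using elim by (intro sym_closure_add sym_closure_cmult \<delta> w) auto
    have "?b (\<lambda>u. a u ^ n * (W N u + (-1) * w u)) = 0"
      by (rule blim_power_vanish[OF \<delta> r a sc]) (use elim w in simp)
    moreover have "(\<lambda>u. a u ^ n * (W N u + (-1) * w u)) = (\<lambda>u. a u ^ n * W N u + (-1) * (a u ^ n * w u))"
      by (simp add: algebra_simps)
    moreover have "?b (\<lambda>u. a u ^ n * W N u + (-1) * (a u ^ n * w u)) = ?b (\<lambda>u. a u ^ n * W N u) + (-1) * ?b (\<lambda>u. a u ^ n * w u)"
    proof -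
      have s1: "sym_closure r \<delta> (\<lambda>u. a u ^ n * W N u)" and s2: "sym_closure r \<delta> (\<lambda>u. a u ^ n * w u)"
        using elim w(1) by (simp_all add: sym_closure_mult[OF \<delta>(2) sym_closure_power[OF \<delta>(2) a(1)]])
      show ?thesis
        by (simp only: blim_add[OF \<delta> r s1 sym_closure_cmult[OF \<delta>(2) s2]] blim_cmult[OF \<delta> r s2])
    qed
    ultimately show ?case by (simp add: d_def)
  qed
  \<comment> \<open>For \<open>q < n\<close> the factor \<open>N\<^bsup>q+1\<^esup> / N\<^sup>n\<close> is bounded.\<close>
  have "(\<lambda>N. \<Sum>q<n. (of_nat N * (of_nat N ^ q / of_nat N ^ n) / fact q) * d q N) \<longlonglongrightarrow> (\<Sum>q<n. 0)"
  proof (rule tendsto_sum)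
    fix q assume "q \<in> {..<n}"
    then have q: "Suc q \<le> n" by simp
    show "(\<lambda>N. (of_nat N * (of_nat N ^ q / of_nat N ^ n) / fact q) * d q N) \<longlonglongrightarrow> 0"
    proof (rule tendsto_0_le[OF d0, where K=1])
      show "\<forall>\<^sub>F N in sequentially. norm ((of_nat N * (of_nat N ^ q / of_nat N ^ n) / fact q) * d q N) \<le> norm (d q N) * 1"
        using eventually_gt_at_top[of 0]
      proof eventually_elim
        case (elim N)
        have "real N ^ Suc q \<le> real N ^ n" using elim q by (intro power_increasing) auto
        then have "real N * (real N ^ q / real N ^ n) \<le> 1" using elim by (simp add: field_simps)
        moreover have "real N * (real N ^ q / real N ^ n) / fact q \<le> real N * (real N ^ q / real N ^ n)"
        proof -
          have le: "y / fact q \<le> y" if "0 \<le> y" for y :: real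
            using that divide_left_mono[of 1 "fact q" y] by (auto simp: fact_ge_1)
          show ?thesis by (rule le) simp
        qed
        ultimately have "norm ((of_nat N * (of_nat N ^ q / of_nat N ^ n) / fact q) :: complex) \<le> 1"
          by (simp add: norm_mult norm_divide norm_power)
        then show ?case unfolding norm_mult[of _ "d q N"]
          using mult_right_mono[of _ 1 "norm (d q N)"] by simp
      qed
    qed
  qed
  then have lim0: "(\<lambda>N. \<Sum>q<n. (of_nat N * (of_nat N ^ q / of_nat N ^ n) / fact q) * d q N) \<longlonglongrightarrow> 0" by simp
  have "\<forall>\<^sub>F N in sequentially. of_nat N * ((?b (\<lambda>u. exp (of_nat N * a u) * W N u) -
     ?b (\<lambda>u. exp (of_nat N * a u) * w u)) / of_nat N ^ n) =
     (\<Sum>q<n. (of_nat N * (of_nat N ^ q / of_nat N ^ n) / fact q) * d q N)"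
    using W dn
  proof eventually_elim
    case (elim N)
    have "?b (\<lambda>u. exp (of_nat N * a u) * W N u) - ?b (\<lambda>u. exp (of_nat N * a u) * w u)
        = (\<Sum>q\<le>n. of_nat N ^ q / fact q * d q N)"
      using elim by (simp add: blim_exp_mult[OF \<delta> r a] w d_def sum_subtractf[symmetric] right_diff_distrib)
    also have "\<dots> = (\<Sum>q<n. of_nat N ^ q / fact q * d q N)"
      using elim by (simp add: lessThan_Suc_atMost[symmetric])
    finally show ?case by (simp add: sum_distrib_left sum_divide_distrib mult_ac)
  qed
  then show ?thesis using lim0 tendsto_cong by fastforce
qed

section \<open>Brackets of product functions\<close>

text \<open>Both sides are the coefficient of \<open>x\<^bsup>r-1\<^esup>\<close> in the polynomial of degree below \<open>r\<close> that interpolates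
  \<open>x\<^sup>p\<close> at the nodes \<open>0, \<dots>, r - 1\<close>.\<close>

lemma lagrange_nodes:
  assumes p: "p < r"
  shows "(\<Sum>i<r. of_nat i ^ p / (\<Prod>a\<in>{..<r} - {i}. of_nat i - of_nat a)) = (if p = r - 1 then 1 else 0 :: complex)"
proof -
  define L where "L i = (\<Prod>a\<in>{..<r} - {i}. [:- of_nat a, 1 :: complex:])" for i :: nat
  define D where "D i = (\<Prod>a\<in>{..<r} - {i}. of_nat i - of_nat a :: complex)" for i :: nat
  have D0: "D i \<noteq> 0" for i by (auto simp: D_def)
  have polyL: "poly (L i) (of_nat j) = (if i = j then D i else 0 :: complex)" if "i < r" "j < r" for i j
  proof (cases "i = j")
    case True
    then show ?thesis by (simp add: L_def D_def poly_prod)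
  next
    case False
    then have "j \<in> {..<r} - {i}" using that by auto
    then show ?thesis using False by (auto simp: L_def poly_prod intro!: prod_zero bexI[of _ j])
  qed
  have degL: "degree (L i :: complex poly) = r - 1" if "i < r" for i
    unfolding L_def using that by (subst degree_prod_sum_eq) auto
  have coeffL: "coeff (L i :: complex poly) (r - 1) = 1" if "i < r" for i
    using lead_coeff_prod[of "\<lambda>a. [:- of_nat a, 1:] :: complex poly" "{..<r} - {i}"] degL[OF that]
    by (simp add: L_def)
  define Q where "Q = (\<Sum>i<r. Polynomial.smult (of_nat i ^ p / D i) (L i))"
  have "Q = monom 1 p"
  proof (rule poly_eqI_degree[where A="of_nat ` {..<r}"])
    fix x :: complex assume "x \<in> of_nat ` {..<r}"
    then obtain j where j: "j < r" "x = of_nat j" by auto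
    have "poly Q x = (\<Sum>i<r. if i = j then of_nat i ^ p else 0)"
      unfolding Q_def poly_sum j(2) using j(1) D0 by (intro sum.cong) (auto simp: polyL)
    then show "poly Q x = poly (monom 1 p) x" using j by (simp add: poly_monom)
  next
    have "degree Q \<le> r - 1"
      unfolding Q_def using degL by (intro degree_sum_le) (auto intro: order_trans[OF degree_smult_le])
    moreover have card: "card (of_nat ` {..<r} :: complex set) = r" by (subst card_image) (auto simp: inj_on_def)
    ultimately show "degree Q < card (of_nat ` {..<r} :: complex set)" using p by simp
    show "degree (monom (1::complex) p) < card (of_nat ` {..<r} :: complex set)"
      using p card degree_monom_le[of "1::complex" p] by simp
  qed
  moreover have "coeff Q (r - 1) = (\<Sum>i<r. of_nat i ^ p / D i)"
    using coeffL by (simp add: Q_def coeff_sum)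
  ultimately have "(\<Sum>i<r. of_nat i ^ p / D i) = coeff (monom 1 p) (r - 1)" by simp
  then show ?thesis by (simp add: D_def coeff_monom)
qed

text \<open>In the Taylor expansion of \<open>h\<close> the divided difference at equidistant nodes kills the powers
  below \<open>r - 1\<close> and has value \<open>1\<close> on the power \<open>r - 1\<close>.\<close>

lemma divided_difference_limit:
  assumes h: "(\<lambda>x. h (1 + x)) has_fps_expansion F" and r: "0 < r"
  shows "((\<lambda>t. \<Sum>i<r. h (1 + of_nat i * t) / (\<Prod>a\<in>{..<r} - {i}. (of_nat i - of_nat a) * t)) \<longlongrightarrow> fps_nth F (r - 1)) (at (0::complex))"
proof -
  define D where "D i = (\<Prod>a\<in>{..<r} - {i}. of_nat i - of_nat a :: complex)" for i :: nat
  define G where "G t = (\<Sum>i<r. 1 / D i * h (1 + of_nat i * t))" for t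
  define FG where "FG = (\<Sum>i<r. fps_const (1 / D i) * Abs_fps (\<lambda>n. of_nat i ^ n * fps_nth F n))"
  have "((\<lambda>x. h (1 + x)) \<circ> (\<lambda>t. of_nat i * t)) has_fps_expansion fps_compose F (fps_const (of_nat i) * fps_X)" for i :: nat
    by (rule has_fps_expansion_compose[OF h]) (auto intro!: fps_expansion_intros)
  then have G: "G has_fps_expansion FG"
    unfolding G_def[abs_def] FG_def
    by (intro has_fps_expansion_sum has_fps_expansion_cmult_left) (simp add: fps_compose_linear o_def)
  have coeff: "fps_nth FG p = (if p = r - 1 then fps_nth F p else 0)" if "p < r" for p
  proof -
    have "fps_nth FG p = (\<Sum>i<r. of_nat i ^ p / D i) * fps_nth F p"
      by (simp add: FG_def fps_sum_nth sum_distrib_right)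
    then show ?thesis using lagrange_nodes[OF that] by (simp add: D_def)
  qed
  define S where "S = fps_shift (r - 1) FG"
  have FGS: "FG = fps_X ^ (r - 1) * S"
    using coeff r by (auto simp: S_def fps_eq_iff fps_X_power_mult_nth)
  have conv: "fps_conv_radius S > 0"
    using G by (simp add: S_def has_fps_expansion_def)
  then have ES: "eval_fps S has_fps_expansion S" by (simp add: has_fps_expansion_def)
  then have "(\<lambda>t. t ^ (r - 1) * eval_fps S t) has_fps_expansion FG"
    unfolding FGS by (intro fps_expansion_intros)
  then have "\<forall>\<^sub>F t in nhds 0. G t = t ^ (r - 1) * eval_fps S t"
    using G unfolding has_fps_expansion_def by (auto elim: eventually_elim2)
  then have ev: "\<forall>\<^sub>F t in at 0. eval_fps S t =
      (\<Sum>i<r. h (1 + of_nat i * t) / (\<Prod>a\<in>{..<r} - {i}. (of_nat i - of_nat a) * t))"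
    unfolding eventually_at_filter
  proof eventually_elim
    case (elim t)
    show ?case
    proof (intro impI)
      assume t: "t \<noteq> 0"
      have "(\<Prod>a\<in>{..<r} - {i}. (of_nat i - of_nat a) * t) = D i * t ^ (r - 1)" if "i < r" for i
        using that by (simp add: D_def prod.distrib card_Diff_singleton)
      then have "(\<Sum>i<r. h (1 + of_nat i * t) / (\<Prod>a\<in>{..<r} - {i}. (of_nat i - of_nat a) * t)) = G t / t ^ (r - 1)"
        by (simp add: G_def sum_divide_distrib)
      then show "eval_fps S t = (\<Sum>i<r. h (1 + of_nat i * t) / (\<Prod>a\<in>{..<r} - {i}. (of_nat i - of_nat a) * t))"
        using t elim by simp
    qed
  qed
  have "(eval_fps S \<longlongrightarrow> fps_nth S 0) (at 0)"
    using has_fps_expansion_imp_tendsto_0[OF ES] by (rule tendsto_mono[rotated]) (simp add: at_within_def)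
  moreover have "fps_nth S 0 = fps_nth F (r - 1)" using coeff[of "r - 1"] r by (simp add: S_def)
  ultimately show ?thesis using tendsto_cong[OF ev] by simp
qed

lemma has_fps_expansion_higher_deriv_shift:
  fixes f :: "complex \<Rightarrow> complex"
  assumes "(\<lambda>x. f (1 + x)) has_fps_expansion F"
  shows "(\<lambda>x. (deriv ^^ n) f (1 + x)) has_fps_expansion (fps_deriv ^^ n) F"
proof (induction n)
  case 0
  then show ?case using assms by simp
next
  case (Suc n)
  let ?f = "(deriv ^^ n) f"
  have "deriv (\<lambda>x. ?f (1 + x)) = (\<lambda>x. deriv ?f (1 + x))"
  proof
    fix y
    show "deriv (\<lambda>x. ?f (1 + x)) y = deriv ?f (1 + y)"
      unfolding deriv_shift_0[where f="\<lambda>x. ?f (1 + x)" and z=y] deriv_shift_0[where f="?f" and z="1 + y"]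
      by (simp only: o_def add.assoc)
  qed
  then show ?case using has_fps_expansion_deriv[OF Suc] by simp
qed

text \<open>The expansion at \<open>1\<close> of \<open>x\<^sup>m f\<^sup>(\<^sup>n\<^sup>)(x) / f(x)\<close>, where \<open>F\<close> is the expansion of \<open>f\<close>.\<close>

definition log_deriv_fps :: "nat \<Rightarrow> nat \<Rightarrow> complex fps \<Rightarrow> complex fps" where
  "log_deriv_fps m n F = (1 + fps_X) ^ m * (fps_deriv ^^ n) F * inverse F"

text \<open>For a product function \<open>f\<close> the family \<open>u\<^sub>i\<^sup>m \<partial>\<^sub>i\<^sup>n f\<close> is \<open>f\<close> times a one-variable function \<open>h(u\<^sub>i)\<close>, so
  the bracket is a classical divided difference of \<open>h\<close> at \<open>r\<close> nodes that coalesce at \<open>1\<close>.\<close>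

lemma bracket_prod_poly:
  assumes p: "poly p 1 \<noteq> 0" and r: "0 < r" and F: "(\<lambda>x. poly p (1 + x)) has_fps_expansion F"
  shows "bracket r m n (\<lambda>u. \<Prod>i<r. poly p (u i)) = poly p 1 ^ r * fps_nth (log_deriv_fps m n F) (r - 1)"
proof -
  define f where "f = (\<lambda>u. \<Prod>i<r. poly p (u i))"
  define h where "h x = x ^ m * (deriv ^^ n) (poly p) x * inverse (poly p x)" for x
  have F0: "fps_nth F 0 = poly p 1" using has_fps_expansion_imp_0_eq_fps_nth_0[OF F] by simp
  have h: "(\<lambda>x. h (1 + x)) has_fps_expansion log_deriv_fps m n F"
    unfolding h_def log_deriv_fps_def
    using p F0 by (intro fps_expansion_intros F has_fps_expansion_higher_deriv_shift) auto
  define Fam where "Fam = (\<lambda>i u. u i ^ m * (partial i ^^ n) f u)"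
  have sf: "sym_laurent r f" unfolding f_def by (rule sym_laurent_prod_poly)
  obtain g where g: "laurent r g" "\<And>u. u\<in>torus r \<Longrightarrow> inj_on u {..<r} \<Longrightarrow> g u = divdiff {..<r} Fam u"
      "ddval r {..<r} Fam = g (\<lambda>_. 1)"
    using ddval_obtain[OF bracket_family[OF sf, of m n], of "{..<r}"] r
    unfolding Fam_def by (auto simp: lessThan_empty_iff)
  \<comment> \<open>The base point is approached along a line on which the coordinates are distinct.\<close>
  define line where "line t = (\<lambda>i. 1 + of_nat i * t)" for t :: complex
  have line0: "line 0 = (\<lambda>_. 1)" by (simp add: line_def)
  let ?U = "{t :: complex. \<forall>i<r. 1 + of_nat i * t \<noteq> 0}"
  have openU: "open ?U"
  proof -
    have "?U = (\<Inter>i\<in>{..<r}. {t. 1 + of_nat i * t \<noteq> 0})" by auto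
    then show ?thesis by (auto intro!: open_INT open_Collect_neq continuous_intros)
  qed
  have U0: "0 \<in> ?U" by simp
  have "(\<lambda>t. g (line t)) holomorphic_on ?U"
    unfolding line_def by (rule laurent_line[OF g(1)])
  then have "isCont (\<lambda>t. g (line t)) 0"
    using holomorphic_on_imp_continuous_on continuous_on_eq_continuous_at[OF openU] U0 by blast
  then have lim1: "((\<lambda>t. g (line t)) \<longlongrightarrow> g (\<lambda>_. 1)) (at 0)"
    unfolding isCont_def line0 .
  have "((\<lambda>t. \<Prod>i<r. poly p (line t i)) \<longlongrightarrow> (\<Prod>i<r. poly p (line 0 i))) (at 0)"
    unfolding line_def by (intro tendsto_intros)
  then have lim2: "((\<lambda>t. (\<Prod>i<r. poly p (line t i)) * (\<Sum>i<r. h (1 + of_nat i * t) / (\<Prod>a\<in>{..<r} - {i}. (of_nat i - of_nat a) * t)))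
      \<longlongrightarrow> poly p 1 ^ r * fps_nth (log_deriv_fps m n F) (r - 1)) (at 0)"
    by (intro tendsto_mult divided_difference_limit[OF h r]) (simp add: line0)
  have "\<forall>\<^sub>F t in at 0. poly p (line t i) \<noteq> 0" for i
  proof -
    have "((\<lambda>t. poly p (line t i)) \<longlongrightarrow> poly p (line 0 i)) (at 0)"
      unfolding line_def by (intro tendsto_intros)
    then show ?thesis using p by (intro tendsto_imp_eventually_ne) (auto simp: line0)
  qed
  then have nz: "\<forall>\<^sub>F t in at 0. \<forall>i\<in>{..<r}. poly p (line t i) \<noteq> 0"
    by (intro eventually_ball_finite) auto
  have "\<forall>\<^sub>F t in at 0. t \<in> ?U" using openU U0 by (rule eventually_at_in_open')
  then have "\<forall>\<^sub>F t in at 0. g (line t) = (\<Prod>i<r. poly p (line t i)) * (\<Sum>i<r. h (1 + of_nat i * t) / (\<Prod>a\<in>{..<r} - {i}. (of_nat i - of_nat a) * t))"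
    using nz eventually_neq_at_within[of 0 0 UNIV]
  proof eventually_elim
    case (elim t)
    let ?u = "line t"
    have "?u \<in> torus r" using elim by (simp add: torus_def line_def)
    moreover have "inj_on ?u {..<r}" using elim by (auto simp: inj_on_def line_def)
    ultimately have "g ?u = divdiff {..<r} Fam ?u" by (rule g(2))
    also have "\<dots> = (\<Sum>i<r. (\<Prod>i<r. poly p (?u i)) * (h (?u i) / (\<Prod>a\<in>{..<r} - {i}. (of_nat i - of_nat a) * t)))"
      unfolding divdiff_def
    proof (rule sum.cong)
      fix i assume "i \<in> {..<r}"
      then have i: "i < r" by simp
      \<comment> \<open>The derivative in the coordinate \<open>i\<close> only sees one factor of the product.\<close>
      define K where "K = (\<Prod>a\<in>{..<r} - {i}. poly p (?u a))"
      have split: "(\<Prod>a<r. poly p ((?u(i := z)) a)) = K * poly p z" for z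
        using i by (subst prod.remove[of _ i]) (auto simp: K_def mult.commute intro!: prod.cong)
      have "(partial i ^^ n) f ?u = (deriv ^^ n) (\<lambda>z. K * poly p z) (?u i)"
        unfolding partial_iter f_def split ..
      also have "\<dots> = K * (deriv ^^ n) (poly p) (?u i)"
        by (rule higher_deriv_cmult[where A=UNIV]) (auto intro!: holomorphic_intros)
      finally have "Fam i ?u = (K * poly p (?u i)) * h (?u i)"
        using elim i by (simp add: Fam_def h_def)
      moreover have "K * poly p (?u i) = (\<Prod>i<r. poly p (?u i))" using split[of "?u i"] by simp
      moreover have "(\<Prod>a\<in>{..<r} - {i}. ?u i - ?u a) = (\<Prod>a\<in>{..<r} - {i}. (of_nat i - of_nat a) * t)"
        by (intro prod.cong) (auto simp: line_def algebra_simps)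
      ultimately show "Fam i ?u / (\<Prod>a\<in>{..<r} - {i}. ?u i - ?u a) =
          (\<Prod>i<r. poly p (?u i)) * (h (?u i) / (\<Prod>a\<in>{..<r} - {i}. (of_nat i - of_nat a) * t))" by simp
    qed simp
    finally show ?case by (simp add: sum_distrib_left line_def)
  qed
  from tendsto_cong[OF this] lim1 have "((\<lambda>t. (\<Prod>i<r. poly p (line t i)) * (\<Sum>i<r. h (1 + of_nat i * t) / (\<Prod>a\<in>{..<r} - {i}. (of_nat i - of_nat a) * t))) \<longlongrightarrow> g (\<lambda>_. 1)) (at 0)"
    by simp
  from tendsto_unique[OF trivial_limit_at this lim2] show ?thesis
    using g(3) by (simp add: bracket_def Fam_def f_def)
qed

definition coeff_lim :: "(nat \<Rightarrow> complex fps) \<Rightarrow> complex fps \<Rightarrow> bool" where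
  "coeff_lim A a \<longleftrightarrow> (\<forall>q. (\<lambda>k. fps_nth (A k) q) \<longlonglongrightarrow> fps_nth a q)"

lemma coeff_lim_const: "coeff_lim (\<lambda>_. a) a"
  by (simp add: coeff_lim_def)

lemma coeff_lim_mult: "coeff_lim A a \<Longrightarrow> coeff_lim B b \<Longrightarrow> coeff_lim (\<lambda>k. A k * B k) (a * b)"
  unfolding coeff_lim_def fps_mult_nth by (intro allI tendsto_intros) auto

lemma coeff_lim_deriv: "coeff_lim A a \<Longrightarrow> coeff_lim (\<lambda>k. fps_deriv (A k)) (fps_deriv a)"
  unfolding coeff_lim_def fps_deriv_nth by (intro allI tendsto_intros) auto

lemma coeff_lim_higher_deriv: "coeff_lim A a \<Longrightarrow> coeff_lim (\<lambda>k. (fps_deriv ^^ n) (A k)) ((fps_deriv ^^ n) a)"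
  by (induction n) (auto intro: coeff_lim_deriv)

lemma fps_inverse_nth_rec:
  fixes f :: "complex fps"
  assumes "fps_nth f 0 \<noteq> 0"
  shows "fps_nth (inverse f) q = ((if q = 0 then 1 else 0) - (\<Sum>i<q. fps_nth (inverse f) i * fps_nth f (q - i))) / fps_nth f 0"
proof -
  have "fps_nth (inverse f * f) q = (if q = 0 then 1 else 0)"
    using inverse_mult_eq_1[OF assms] by simp
  moreover have "fps_nth (inverse f * f) q = (\<Sum>i<q. fps_nth (inverse f) i * fps_nth f (q - i)) + fps_nth (inverse f) q * fps_nth f 0"
    unfolding fps_mult_nth atLeast0AtMost lessThan_Suc_atMost[symmetric] by simp
  ultimately show ?thesis using assms by (simp add: field_simps)
qed

lemma coeff_lim_inverse:
  assumes A: "coeff_lim A a" and nz: "\<And>k. fps_nth (A k) 0 \<noteq> 0" "fps_nth a 0 \<noteq> 0"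
  shows "coeff_lim (\<lambda>k. inverse (A k)) (inverse a)"
  unfolding coeff_lim_def
proof
  fix q
  show "(\<lambda>k. fps_nth (inverse (A k)) q) \<longlonglongrightarrow> fps_nth (inverse a) q"
  proof (induction q rule: less_induct)
    case (less q)
    show ?case
      unfolding fps_inverse_nth_rec[OF nz(1), of _ q] fps_inverse_nth_rec[OF nz(2), of q]
      by (intro tendsto_intros less) (use A nz in \<open>auto simp: coeff_lim_def\<close>)
  qed
qed

lemma taylor_polynomials:
  assumes "\<phi> holomorphic_on ball 1 \<epsilon>" "\<delta> < \<epsilon>" "0 < \<delta>"
  obtains P F where "(\<lambda>x. \<phi> (1 + x)) has_fps_expansion F"
    "\<And>k::nat. (\<lambda>x. poly (P k) (1 + x)) has_fps_expansion (\<Sum>i<k. fps_const (fps_nth F i) * fps_X ^ i)"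
    "uniform_limit (cball 1 \<delta>) (\<lambda>k. poly (P k)) \<phi> sequentially"
proof -
  define F where "F = fps_expansion \<phi> 1"
  define P where "P k = (\<Sum>i<k. Polynomial.smult (fps_nth F i) ([:-1, 1:] ^ i))" for k :: nat
  have polyP: "poly (P k) x = (\<Sum>i<k. fps_nth F i * (x - 1) ^ i)" for k x
    by (simp add: P_def poly_sum algebra_simps)
  have Fn: "fps_nth F i = (deriv ^^ i) \<phi> 1 / fact i" for i by (simp add: F_def fps_expansion_def)
  have "\<phi> analytic_on {1}"
    using assms analytic_on_open[of "ball 1 \<epsilon>"] analytic_on_subset[of \<phi> "ball 1 \<epsilon>" "{1}"] by simp
  then have 1: "(\<lambda>x. \<phi> (1 + x)) has_fps_expansion F"
    unfolding F_def by (rule analytic_at_imp_has_fps_expansion)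
  have 2: "(\<lambda>x. poly (P k) (1 + x)) has_fps_expansion (\<Sum>i<k. fps_const (fps_nth F i) * fps_X ^ i)" for k
    unfolding polyP by (simp, intro fps_expansion_intros)
  \<comment> \<open>A radius strictly between \<open>\<delta>\<close> and \<open>\<epsilon>\<close> gives a geometric majorant of ratio \<open>\<delta> / \<rho>\<close>.\<close>
  define \<rho> where "\<rho> = (\<delta> + \<epsilon>) / 2"
  have \<rho>: "\<delta> < \<rho>" "\<rho> < \<epsilon>" "0 < \<rho>" using assms by (auto simp: \<rho>_def)
  have hol: "\<phi> holomorphic_on cball 1 \<rho>"
    using assms(1) by (rule holomorphic_on_subset) (use \<rho> in auto)
  have "bounded (\<phi> ` cball 1 \<rho>)"
    by (intro compact_imp_bounded compact_continuous_image holomorphic_on_imp_continuous_on[OF hol]) auto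
  then obtain B where B: "\<And>x. x \<in> cball 1 \<rho> \<Longrightarrow> norm (\<phi> x) \<le> B" unfolding bounded_iff by blast
  have Fbound: "norm (fps_nth F i) \<le> B / \<rho> ^ i" for i
  proof -
    have "norm ((deriv ^^ i) \<phi> 1) \<le> fact i * B / \<rho> ^ i"
      by (rule Cauchy_inequality) (use \<rho> B hol in \<open>auto intro: holomorphic_on_subset holomorphic_on_imp_continuous_on simp: dist_norm\<close>)
    then show ?thesis by (simp add: Fn norm_divide field_simps)
  qed
  have B0: "0 \<le> B" using order_trans[OF norm_ge_zero B[of 1]] \<rho> by simp
  have "uniform_limit (cball 1 \<delta>) (\<lambda>k x. \<Sum>i<k. fps_nth F i * (x - 1) ^ i) (\<lambda>x. suminf (\<lambda>i. fps_nth F i * (x - 1) ^ i)) sequentially"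
  proof (rule Weierstrass_m_test)
    fix i x assume x: "x \<in> cball (1::complex) \<delta>"
    have "norm (fps_nth F i * (x - 1) ^ i) \<le> (B / \<rho> ^ i) * \<delta> ^ i"
      unfolding norm_mult norm_power using x Fbound[of i]
      by (intro mult_mono power_mono) (auto simp: dist_norm norm_minus_commute B0 \<rho> less_imp_le)
    then show "norm (fps_nth F i * (x - 1) ^ i) \<le> B * (\<delta> / \<rho>) ^ i" by (simp add: power_divide)
  next
    show "summable (\<lambda>i. B * (\<delta> / \<rho>) ^ i)"
      using \<rho> assms by (intro summable_mult summable_geometric) auto
  qed
  then have 3: "uniform_limit (cball 1 \<delta>) (\<lambda>k. poly (P k)) (\<lambda>x. suminf (\<lambda>i. fps_nth F i * (x - 1) ^ i)) sequentially"
    by (simp add: polyP[abs_def])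
  have "suminf (\<lambda>i. fps_nth F i * (x - 1) ^ i) = \<phi> x" if "x \<in> cball 1 \<delta>" for x
  proof -
    have "x \<in> ball 1 \<epsilon>" using that assms by auto
    from sums_unique[OF holomorphic_power_series[OF assms(1) this]] show ?thesis by (simp add: Fn)
  qed
  then have "uniform_limit (cball 1 \<delta>) (\<lambda>k. poly (P k)) \<phi> sequentially"
    using uniform_limit_cong'[of "cball 1 \<delta>" "\<lambda>k. poly (P k)" "\<lambda>k. poly (P k)" "\<lambda>x. suminf (\<lambda>i. fps_nth F i * (x - 1) ^ i)" \<phi>] 3 by auto
  then show thesis using 1 2 that by blast
qed

lemma bounded_coord_image:
  assumes "\<phi> holomorphic_on ball 1 \<epsilon>" "\<delta> < \<epsilon>" "i < r"
  shows "bounded ((\<lambda>u. \<phi> (u i)) ` polyball r \<delta>)"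
proof -
  have "\<phi> holomorphic_on cball 1 \<delta>" using assms(1) by (rule holomorphic_on_subset) (use assms in auto)
  then have "bounded (\<phi> ` cball 1 \<delta>)"
    by (intro compact_imp_bounded compact_continuous_image holomorphic_on_imp_continuous_on) auto
  then show ?thesis by (rule bounded_subset) (use assms in \<open>auto simp: polyball_def\<close>)
qed

lemma uniform_limit_coord:
  assumes "uniform_limit (cball 1 \<delta>) P \<phi> F" "i < r"
  shows "uniform_limit (polyball r \<delta>) (\<lambda>k u. P k (u i)) (\<lambda>u. \<phi> (u i)) F"
  using assms unfolding uniform_limit_iff polyball_def by (fastforce elim: eventually_mono)

lemma sym_closure_sum_coord:
  assumes \<phi>: "\<phi> holomorphic_on ball 1 \<epsilon>" "\<delta> < \<epsilon>" "0 < \<delta>"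
  shows "sym_closure r \<delta> (\<lambda>u. \<Sum>i<r. \<phi> (u i))"
proof -
  obtain P F where P: "uniform_limit (cball 1 \<delta>) (\<lambda>k::nat. poly (P k)) \<phi> sequentially"
    using taylor_polynomials[OF \<phi>] by metis
  have "uniform_limit (polyball r \<delta>) (\<lambda>k u. \<Sum>i<r. poly (P k) (u i)) (\<lambda>u. \<Sum>i<r. \<phi> (u i)) sequentially"
  proof -
    have "uniform_limit (polyball r \<delta>) (\<lambda>k u. \<Sum>i<s. poly (P k) (u i)) (\<lambda>u. \<Sum>i<s. \<phi> (u i)) sequentially"
      if "s \<le> r" for s
      using that
    proof (induction s)
      case (Suc s)
      then show ?case
        using uniform_limit_add[OF Suc.IH uniform_limit_coord[OF P, of s r]] by simp
    qed (simp add: uniform_limit_const)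
    then show ?thesis by simp
  qed
  then show ?thesis
    unfolding sym_closure_def by (intro exI[of _ "\<lambda>k u. \<Sum>i<r. poly (P k) (u i)"] conjI allI sym_laurent_sum_poly)
qed

text \<open>Both sides are continuous along the Taylor polynomials of \<open>\<phi>\<close>.\<close>

lemma blim_prod:
  assumes \<phi>: "\<phi> holomorphic_on ball 1 \<epsilon>" "\<delta> < \<epsilon>" and \<delta>: "0 < \<delta>" "\<delta> < 1" and r: "0 < r" and nz: "\<phi> 1 \<noteq> 0"
    and F: "(\<lambda>x. \<phi> (1 + x)) has_fps_expansion F"
  shows "blim r \<delta> m n (\<lambda>u. \<Prod>i<r. \<phi> (u i)) = \<phi> 1 ^ r * fps_nth (log_deriv_fps m n F) (r - 1)"
proof -
  obtain P F' where F': "(\<lambda>x. \<phi> (1 + x)) has_fps_expansion F'"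
    and P: "\<And>k::nat. (\<lambda>x. poly (P k) (1 + x)) has_fps_expansion (\<Sum>i<k. fps_const (fps_nth F' i) * fps_X ^ i)"
    "uniform_limit (cball 1 \<delta>) (\<lambda>k. poly (P k)) \<phi> sequentially"
    using taylor_polynomials[OF \<phi> \<delta>(1)] by metis
  have FF: "F' = F" using F F' fps_expansion_unique_complex by blast
  define A where "A k = (\<Sum>i<Suc k. fps_const (fps_nth F i) * fps_X ^ i)" for k
  have An: "fps_nth (A k) q = (if q \<le> k then fps_nth F q else 0)" for k q
    by (simp add: A_def fps_sum_nth fps_X_power_nth if_distrib cong: if_cong)
  have F0: "fps_nth F 0 = \<phi> 1" using has_fps_expansion_imp_0_eq_fps_nth_0[OF F] by simp
  have PA: "(\<lambda>x. poly (P (Suc k)) (1 + x)) has_fps_expansion A k" for k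
    using P(1)[of "Suc k"] unfolding FF A_def .
  have P1: "poly (P (Suc k)) 1 = \<phi> 1" for k
    using has_fps_expansion_imp_0_eq_fps_nth_0[OF PA[of k]] An[of k 0] F0 by simp
  have "uniform_limit (polyball r \<delta>) (\<lambda>k u. \<Prod>i<s. poly (P k) (u i)) (\<lambda>u. \<Prod>i<s. \<phi> (u i)) sequentially \<and>
      bounded ((\<lambda>u. \<Prod>i<s. \<phi> (u i)) ` polyball r \<delta>)" if "s \<le> r" for s
    using that
  proof (induction s)
    case (Suc s)
    then have s: "s < r" by simp
    have IH: "uniform_limit (polyball r \<delta>) (\<lambda>k u. \<Prod>i<s. poly (P k) (u i)) (\<lambda>u. \<Prod>i<s. \<phi> (u i)) sequentially"
      "bounded ((\<lambda>u. \<Prod>i<s. \<phi> (u i)) ` polyball r \<delta>)" using Suc by auto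
    note b = bounded_coord_image[OF \<phi> s]
    obtain B1 where B1: "\<And>u. u \<in> polyball r \<delta> \<Longrightarrow> norm (\<Prod>i<s. \<phi> (u i)) \<le> B1" using IH(2) by (auto simp: bounded_iff)
    obtain B2 where B2: "\<And>u. u \<in> polyball r \<delta> \<Longrightarrow> norm (\<phi> (u s)) \<le> B2" using b by (auto simp: bounded_iff)
    have "norm ((\<Prod>i<s. \<phi> (u i)) * \<phi> (u s)) \<le> B1 * B2" if "u \<in> polyball r \<delta>" for u
      unfolding norm_mult using B1[OF that] B2[OF that] by (intro mult_mono) (auto intro: order_trans[OF norm_ge_zero])
    then have "bounded ((\<lambda>u. (\<Prod>i<s. \<phi> (u i)) * \<phi> (u s)) ` polyball r \<delta>)" unfolding bounded_iff by blast
    then show ?case using uniform_lim_mult[OF IH(1) uniform_limit_coord[OF P(2) s] IH(2) b] by simp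
  qed (auto simp: uniform_limit_const bounded_iff)
  then have ul: "uniform_limit (polyball r \<delta>) (\<lambda>k u. \<Prod>i<r. poly (P k) (u i)) (\<lambda>u. \<Prod>i<r. \<phi> (u i)) sequentially" by simp
  have sc: "sym_closure r \<delta> (\<lambda>u. \<Prod>i<r. \<phi> (u i))"
    unfolding sym_closure_def using ul by (intro exI[of _ "\<lambda>k u. \<Prod>i<r. poly (P k) (u i)"] conjI allI sym_laurent_prod_poly)
  \<comment> \<open>The shift by one skips the empty Taylor polynomial, which does not have the value \<open>\<phi> 1\<close> at \<open>1\<close>.\<close>
  have ul': "uniform_limit (polyball r \<delta>) (\<lambda>k u. \<Prod>i<r. poly (P (Suc k)) (u i)) (\<lambda>u. \<Prod>i<r. \<phi> (u i)) sequentially"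
    using filterlim_compose[OF ul filterlim_Suc] .
  have "(\<lambda>k. blim r \<delta> m n (\<lambda>u. \<Prod>i<r. poly (P (Suc k)) (u i))) \<longlonglongrightarrow> blim r \<delta> m n (\<lambda>u. \<Prod>i<r. \<phi> (u i))"
    by (intro blim_tendsto[OF \<delta> r ul' _ sc] always_eventually allI sym_closure_sym sym_laurent_prod_poly)
  moreover have "blim r \<delta> m n (\<lambda>u. \<Prod>i<r. poly (P (Suc k)) (u i)) = \<phi> 1 ^ r * fps_nth (log_deriv_fps m n (A k)) (r - 1)" for k
    using blim_sym[OF \<delta> r sym_laurent_prod_poly, of m n "P (Suc k)"] bracket_prod_poly[OF _ r PA[of k], of m n] P1[of k] nz
    by simp
  moreover have "coeff_lim A F"
    unfolding coeff_lim_def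
  proof
    fix q show "(\<lambda>k. fps_nth (A k) q) \<longlonglongrightarrow> fps_nth F q"
      by (rule tendsto_eventually) (use eventually_ge_at_top[of q] in eventually_elim, simp add: An)
  qed
  then have "coeff_lim (\<lambda>k. log_deriv_fps m n (A k)) (log_deriv_fps m n F)"
    unfolding log_deriv_fps_def using nz F0 An
    by (intro coeff_lim_mult coeff_lim_const coeff_lim_higher_deriv coeff_lim_inverse) auto
  then have "(\<lambda>k. \<phi> 1 ^ r * fps_nth (log_deriv_fps m n (A k)) (r - 1)) \<longlonglongrightarrow> \<phi> 1 ^ r * fps_nth (log_deriv_fps m n F) (r - 1)"
    unfolding coeff_lim_def by (intro tendsto_intros) auto
  ultimately show ?thesis using LIMSEQ_unique by simp
qed

lemma log_deriv_fps_rec: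
  assumes F': "fps_deriv F = Q * F" and F0: "fps_nth F 0 \<noteq> 0"
  shows "log_deriv_fps 0 0 F = 1" "log_deriv_fps 0 (Suc n) F = fps_deriv (log_deriv_fps 0 n F) + Q * log_deriv_fps 0 n F"
    "log_deriv_fps m n F = (1 + fps_X) ^ m * log_deriv_fps 0 n F"
proof -
  have inv: "F * inverse F = 1" using inverse_mult_eq_1'[OF F0] .
  have D: "(fps_deriv ^^ n) F = log_deriv_fps 0 n F * F" for n
    using inv by (simp add: log_deriv_fps_def mult.assoc mult.commute[of "inverse F"])
  show "log_deriv_fps 0 0 F = 1" using inv by (simp add: log_deriv_fps_def)
  show "log_deriv_fps m n F = (1 + fps_X) ^ m * log_deriv_fps 0 n F" by (simp add: log_deriv_fps_def mult.assoc)
  have "fps_deriv ((fps_deriv ^^ n) F) = (fps_deriv (log_deriv_fps 0 n F) + Q * log_deriv_fps 0 n F) * F"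
    unfolding D by (simp add: F' algebra_simps)
  then have "fps_deriv ((fps_deriv ^^ n) F) * inverse F = (fps_deriv (log_deriv_fps 0 n F) + Q * log_deriv_fps 0 n F) * (F * inverse F)"
    by (simp only: mult.assoc)
  then show "log_deriv_fps 0 (Suc n) F = fps_deriv (log_deriv_fps 0 n F) + Q * log_deriv_fps 0 n F"
    by (simp add: log_deriv_fps_def inv)
qed

section \<open>Two-term asymptotic expansions\<close>

text \<open>\<open>f N = a N\<^sup>p + b N\<^bsup>p-1\<^esup> + o(N\<^bsup>p-1\<^esup>)\<close>, in a form that also covers \<open>p = 0\<close>.\<close>

definition expansion2 :: "(nat \<Rightarrow> complex) \<Rightarrow> nat \<Rightarrow> complex \<Rightarrow> complex \<Rightarrow> bool" where
  "expansion2 f p a b \<longleftrightarrow> (\<lambda>N. of_nat N * (f N / of_nat N ^ p - a)) \<longlonglongrightarrow> b"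

lemma expansion2_leading:
  assumes "expansion2 f p a b" shows "(\<lambda>N. f N / of_nat N ^ p) \<longlonglongrightarrow> a"
proof -
  have "(\<lambda>N. inverse (of_nat N) * (of_nat N * (f N / of_nat N ^ p - a))) \<longlonglongrightarrow> 0 * b"
    by (rule tendsto_mult[OF lim_inverse_n assms[unfolded expansion2_def]])
  moreover have "\<forall>\<^sub>F N in sequentially. inverse (of_nat N) * (of_nat N * (f N / of_nat N ^ p - a)) = f N / of_nat N ^ p - a"
    using eventually_gt_at_top[of 0] by eventually_elim simp
  ultimately have "(\<lambda>N. f N / of_nat N ^ p - a) \<longlonglongrightarrow> 0" by (simp add: tendsto_cong)
  then show ?thesis by (rule LIM_zero_cancel)
qed

lemma expansion2_perturb:
  assumes "expansion2 f p a b" "(\<lambda>N. of_nat N * ((g N - f N) / of_nat N ^ p)) \<longlonglongrightarrow> 0"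
  shows "expansion2 g p a b"
  using tendsto_add[OF assms(1)[unfolded expansion2_def] assms(2)]
  unfolding expansion2_def by (simp add: diff_divide_distrib algebra_simps)

lemma expansion2_add:
  "expansion2 f p a b \<Longrightarrow> expansion2 g p c d \<Longrightarrow> expansion2 (\<lambda>N. f N + g N) p (a + c) (b + d)"
  unfolding expansion2_def by (drule (1) tendsto_add) (simp add: add_divide_distrib algebra_simps)

lemma expansion2_cmult: "expansion2 f p a b \<Longrightarrow> expansion2 (\<lambda>N. z * f N) p (z * a) (z * b)"
  unfolding expansion2_def by (drule tendsto_mult_left[of _ _ _ z]) (simp add: algebra_simps)

lemma expansion2_zero: "expansion2 (\<lambda>N. 0) p 0 0"
  by (simp add: expansion2_def)

lemma expansion2_sum:
  assumes "finite A" "\<And>x. x \<in> A \<Longrightarrow> expansion2 (f x) p (a x) (b x)"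
  shows "expansion2 (\<lambda>N. \<Sum>x\<in>A. f x N) p (\<Sum>x\<in>A. a x) (\<Sum>x\<in>A. b x)"
  using assms by (induction A rule: finite_induct) (auto intro: expansion2_add expansion2_zero)

lemma expansion2_mult:
  assumes f: "expansion2 f p a b" and g: "expansion2 g q c d"
  shows "expansion2 (\<lambda>N. f N * g N) (p + q) (a * c) (a * d + b * c)"
proof -
  have "(\<lambda>N. (of_nat N * (f N / of_nat N ^ p - a)) * (g N / of_nat N ^ q) + a * (of_nat N * (g N / of_nat N ^ q - c))) \<longlonglongrightarrow> b * c + a * d"
    using f g expansion2_leading[OF g] unfolding expansion2_def by (intro tendsto_intros)
  then show ?thesis
    unfolding expansion2_def by (simp add: algebra_simps power_add)
qed

lemma expansion2_raise:
  assumes "expansion2 f p a b" shows "expansion2 f (Suc p) 0 a"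
proof -
  have "\<forall>\<^sub>F N in sequentially. of_nat N * (f N / of_nat N ^ Suc p - 0) = f N / of_nat N ^ p"
    using eventually_gt_at_top[of 0] by eventually_elim (simp add: field_simps)
  from tendsto_cong[OF this] expansion2_leading[OF assms] show ?thesis unfolding expansion2_def by simp
qed

lemma expansion2_lower: "expansion2 f p a b \<Longrightarrow> p + 2 \<le> q \<Longrightarrow> expansion2 f q 0 0"
proof (induction q)
  case (Suc q)
  show ?case
  proof (cases "p + 2 \<le> q")
    case True
    then show ?thesis using expansion2_raise[OF Suc.IH[OF Suc.prems(1)]] by simp
  next
    case False
    then have "Suc q = Suc (Suc p)" using Suc.prems by simp
    then show ?thesis using expansion2_raise[OF expansion2_raise[OF Suc.prems(1)]] by simp
  qed
qed simp

lemma expansion2_power: "expansion2 (\<lambda>N. of_nat N ^ p) p 1 0"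
proof -
  have "\<forall>\<^sub>F N in sequentially. of_nat N * ((of_nat N :: complex) ^ p / of_nat N ^ p - 1) = 0"
    using eventually_gt_at_top[of 0] by eventually_elim simp
  then show ?thesis unfolding expansion2_def by (rule tendsto_eventually)
qed

lemma expansion2_polynomial:
  "expansion2 (\<lambda>N. \<Sum>q\<le>n. of_nat N ^ q * \<beta> q) n (\<beta> n) (if n = 0 then 0 else \<beta> (n - 1))"
proof -
  have pw: "expansion2 (\<lambda>N. of_nat N ^ q * \<beta> q) q (\<beta> q) 0" for q
    using expansion2_cmult[OF expansion2_power, of "\<beta> q" q] by (simp add: mult.commute)
  have "expansion2 (\<lambda>N. of_nat N ^ q * \<beta> q) n (if q = n then \<beta> n else 0) (if Suc q = n then \<beta> q else 0)"
    if "q \<in> {..n}" for q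
  proof -
    have "q \<le> n" using that by simp
    then consider "q = n" | "Suc q = n" | "q + 2 \<le> n" by linarith
    then show ?thesis
    proof cases
      case 1
      then show ?thesis using pw[of q] by simp
    next
      case 2
      then show ?thesis using expansion2_raise[OF pw[of q]] by auto
    next
      case 3
      then show ?thesis using expansion2_lower[OF pw[of q] 3] by simp
    qed
  qed
  then have "expansion2 (\<lambda>N. \<Sum>q\<le>n. of_nat N ^ q * \<beta> q) n (\<Sum>q\<le>n. if q = n then \<beta> n else 0) (\<Sum>q\<le>n. if Suc q = n then \<beta> q else 0)"
    by (intro expansion2_sum) auto
  moreover have "(\<Sum>q\<le>n. if Suc q = n then \<beta> q else 0) = (if n = 0 then 0 else \<beta> (n - 1))"
  proof (cases n)
    case (Suc n')
    have "(\<Sum>q\<le>n. if Suc q = n then \<beta> q else 0) = (\<Sum>q\<le>n. if q = n' then \<beta> n' else 0)"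
      using Suc by (intro sum.cong) auto
    then show ?thesis using Suc by simp
  qed simp
  ultimately show ?thesis by simp
qed

lemma expansion2_binomial:
  "expansion2 (\<lambda>N. of_nat (N choose Suc j)) (Suc j) (1 / fact (Suc j)) (- (of_nat (j * (j + 1)) / 2) / fact (Suc j))"
proof -
  have prod: "expansion2 (\<lambda>N. \<Prod>i<s. of_nat N - of_nat i) s 1 (- (\<Sum>i<s. of_nat i))" for s
  proof (induction s)
    case 0
    show ?case using expansion2_power[of 0] by simp
  next
    case (Suc s)
    have "expansion2 (\<lambda>N. of_nat N - of_nat s) 1 1 (- of_nat s)"
    proof -
      have "\<forall>\<^sub>F N in sequentially. of_nat N * (((of_nat N :: complex) - of_nat s) / of_nat N ^ 1 - 1) = - of_nat s"
        using eventually_gt_at_top[of 0] by eventually_elim (simp add: field_simps)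
      then show ?thesis unfolding expansion2_def by (rule tendsto_eventually)
    qed
    from expansion2_mult[OF Suc this] show ?case by (simp add: algebra_simps)
  qed
  have 1: "(of_nat (N choose Suc j) :: complex) = 1 / fact (Suc j) * (\<Prod>i<Suc j. of_nat N - of_nat i)" for N
    by (simp only: binomial_gbinomial gbinomial_prod_rev atLeast0LessThan) simp
  have 2: "(\<Sum>i<Suc j. of_nat i) = (of_nat (j * (j + 1)) / 2 :: complex)"
    by (induction j) (auto simp: field_simps)
  have "expansion2 (\<lambda>N. of_nat (N choose Suc j)) (Suc j) (1 / fact (Suc j) * 1)
      (1 / fact (Suc j) * (- (of_nat (j * (j + 1)) / 2)))"
    using expansion2_cmult[OF prod[of "Suc j"], of "1 / fact (Suc j)"] by (simp only: 1 2)
  then show ?thesis by (simp del: fact_Suc add: mult.commute)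
qed

lemma choose_two_Suc: "Suc n choose 2 = n + (n choose 2)"
  by (simp add: numeral_2_eq_2)

text \<open>For \<open>F = exp (z S + T)\<close> with \<open>S' = P\<close> and \<open>T' = Q\<close>, every differentiation multiplies by \<open>z P + Q\<close>
  or hits an earlier factor. The power \<open>z\<^sup>n\<close> needs the factor \<open>z P\<close> each time; \<open>z\<^bsup>n-1\<^esup>\<close> arises either by
  taking \<open>Q\<close> once or by letting one of the derivatives hit one of the factors \<open>P\<close>.\<close>

lemma log_deriv_polynomial:
  fixes P Q :: "complex fps"
  shows "\<exists>b. (\<forall>z F. fps_deriv F = (fps_const z * P + Q) * F \<and> fps_nth F 0 \<noteq> 0 \<longrightarrow>
       log_deriv_fps 0 n F = (\<Sum>q\<le>n. fps_const (z ^ q) * b q)) \<and> b n = P ^ n \<and> (\<forall>q>n. b q = 0) \<and>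
     (n \<noteq> 0 \<longrightarrow> b (n - 1) = of_nat n * P ^ (n - 1) * Q + of_nat (n choose 2) * P ^ (n - 2) * fps_deriv P)"
proof (induction n)
  case 0
  show ?case
    by (rule exI[of _ "\<lambda>q. if q = 0 then 1 else 0"]) (auto intro!: log_deriv_fps_rec(1))
next
  case (Suc n)
  then obtain b where b: "\<And>z F. fps_deriv F = (fps_const z * P + Q) * F \<Longrightarrow> fps_nth F 0 \<noteq> 0 \<Longrightarrow>
       log_deriv_fps 0 n F = (\<Sum>q\<le>n. fps_const (z ^ q) * b q)" "b n = P ^ n" "\<And>q. q > n \<Longrightarrow> b q = 0"
     "n \<noteq> 0 \<Longrightarrow> b (n - 1) = of_nat n * P ^ (n - 1) * Q + of_nat (n choose 2) * P ^ (n - 2) * fps_deriv P"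
    by blast
  define b' where "b' q = fps_deriv (b q) + Q * b q + (if q = 0 then 0 else P * b (q - 1))" for q
  have "log_deriv_fps 0 (Suc n) F = (\<Sum>q\<le>Suc n. fps_const (z ^ q) * b' q)"
    if F: "fps_deriv F = (fps_const z * P + Q) * F" "fps_nth F 0 \<noteq> 0" for z F
  proof -
    have "log_deriv_fps 0 (Suc n) F = fps_deriv (\<Sum>q\<le>n. fps_const (z ^ q) * b q) + (fps_const z * P + Q) * (\<Sum>q\<le>n. fps_const (z ^ q) * b q)"
      using log_deriv_fps_rec(2)[OF F] b(1)[OF F] by simp
    also have "\<dots> = (\<Sum>q\<le>n. fps_const (z ^ q) * (fps_deriv (b q) + Q * b q)) + (\<Sum>q\<le>n. fps_const (z ^ Suc q) * (P * b q))"
      by (simp add: fps_deriv_sum sum_distrib_left sum.distrib[symmetric] algebra_simps fps_const_mult[symmetric] del: fps_const_mult)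
    also have "(\<Sum>q\<le>n. fps_const (z ^ q) * (fps_deriv (b q) + Q * b q)) = (\<Sum>q\<le>Suc n. fps_const (z ^ q) * (fps_deriv (b q) + Q * b q))"
      using b(3)[of "Suc n"] by simp
    also have "(\<Sum>q\<le>n. fps_const (z ^ Suc q) * (P * b q)) = (\<Sum>q\<le>Suc n. fps_const (z ^ q) * (if q = 0 then 0 else P * b (q - 1)))"
      by (subst sum.atMost_Suc_shift) simp
    finally show ?thesis
      unfolding sum.distrib[symmetric] by (simp add: b'_def algebra_simps)
  qed
  moreover have "b' (Suc n) = P ^ Suc n" using b(2) b(3)[of "Suc n"] by (simp add: b'_def)
  moreover have "b' q = 0" if "q > Suc n" for q using b(3)[of q] b(3)[of "q - 1"] that by (simp add: b'_def)
  moreover have "b' n = of_nat (Suc n) * P ^ n * Q + of_nat (Suc n choose 2) * P ^ (Suc n - 2) * fps_deriv P"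
  proof (cases n)
    case 0
    then show ?thesis using b(2) by (simp add: b'_def)
  next
    case (Suc n')
    have Pn: "of_nat (n choose 2) * (P * P ^ (n - 2)) = of_nat (n choose 2) * P ^ n'"
    proof (cases n')
      case 0
      then show ?thesis using Suc by simp
    next
      case (Suc n'')
      then show ?thesis using \<open>n = Suc n'\<close> by simp
    qed
    have "fps_deriv (b n) = of_nat n * P ^ n' * fps_deriv P"
      unfolding b(2) by (subst fps_deriv_power') (simp add: Suc mult_ac)
    moreover have n1: "n - 1 = n'" "n \<noteq> 0" using Suc by auto
    moreover have "b' n = fps_deriv (b n) + Q * b n + P * b (n - 1)" by (simp add: b'_def n1(2))
    ultimately have "b' n = of_nat n * P ^ n' * fps_deriv P + Q * P ^ n + P * (of_nat n * P ^ n' * Q + of_nat (n choose 2) * P ^ (n - 2) * fps_deriv P)"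
      using b(4)[OF n1(2)] by (simp only: b(2) n1(1))
    also have "\<dots> = of_nat (Suc n) * P ^ n * Q + (of_nat n + of_nat (n choose 2)) * P ^ n' * fps_deriv P"
    proof -
      have "P * (of_nat (n choose 2) * P ^ (n - 2) * fps_deriv P) = of_nat (n choose 2) * (P * P ^ (n - 2)) * fps_deriv P"
        by (simp only: mult_ac)
      also have "\<dots> = of_nat (n choose 2) * P ^ n' * fps_deriv P" unfolding Pn ..
      finally have "P * (of_nat n * P ^ n' * Q + of_nat (n choose 2) * P ^ (n - 2) * fps_deriv P) =
        of_nat n * P ^ n * Q + of_nat (n choose 2) * P ^ n' * fps_deriv P"
        by (simp add: Suc algebra_simps)
      then show ?thesis by (simp add: algebra_simps)
    qed
    finally show ?thesis using Suc by (simp only: choose_two_Suc of_nat_add) simp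
  qed
  ultimately show ?case by (intro exI[of _ b']) simp
qed

text \<open>The coefficients are Stirling numbers of the second kind; \<open>C(k, 2)\<close> is the number of ways to
  merge two of \<open>k\<close> elements.\<close>

lemma power_ffact:
  "\<exists>c. (\<forall>z. z ^ k = (\<Sum>m\<le>k. c m * ffact m z)) \<and> c k = 1 \<and> (\<forall>m>k. c m = 0) \<and>
     (k \<noteq> 0 \<longrightarrow> c (k - 1) = of_nat (k choose 2))"
proof (induction k)
  case 0
  show ?case by (rule exI[of _ "\<lambda>m. if m = 0 then 1 else 0"]) (simp add: ffact_def)
next
  case (Suc k)
  then obtain c where c: "\<And>z. z ^ k = (\<Sum>m\<le>k. c m * ffact m z)" "c k = 1" "\<And>m. m > k \<Longrightarrow> c m = 0"
     "k \<noteq> 0 \<Longrightarrow> c (k - 1) = of_nat (k choose 2)" by blast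
  define c' where "c' m = of_nat m * c m + (if m = 0 then 0 else c (m - 1))" for m
  have step: "z * ffact m z = ffact (Suc m) z + of_nat m * ffact m z" for m z
    by (simp add: ffact_def algebra_simps)
  have "z ^ Suc k = (\<Sum>m\<le>Suc k. c' m * ffact m z)" for z
  proof -
    have "z ^ Suc k = (\<Sum>m\<le>k. c m * (z * ffact m z))" using c(1)[of z] by (simp add: sum_distrib_left mult_ac)
    also have "\<dots> = (\<Sum>m\<le>k. of_nat m * c m * ffact m z) + (\<Sum>m\<le>k. c m * ffact (Suc m) z)"
      unfolding step by (simp add: sum.distrib[symmetric] algebra_simps)
    also have "(\<Sum>m\<le>k. of_nat m * c m * ffact m z) = (\<Sum>m\<le>Suc k. of_nat m * c m * ffact m z)"
      using c(3)[of "Suc k"] by simp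
    also have "(\<Sum>m\<le>k. c m * ffact (Suc m) z) = (\<Sum>m\<le>Suc k. (if m = 0 then 0 else c (m - 1)) * ffact m z)"
      by (subst sum.atMost_Suc_shift) simp
    finally show ?thesis unfolding sum.distrib[symmetric] by (simp add: c'_def distrib_right)
  qed
  moreover have "c' (Suc k) = 1" using c(2) c(3)[of "Suc k"] by (simp add: c'_def)
  moreover have "c' m = 0" if "m > Suc k" for m using c(3)[of m] c(3)[of "m - 1"] that by (simp add: c'_def)
  moreover have "c' k = of_nat (Suc k choose 2)"
    using c(2,4) by (cases "k = 0") (simp_all add: c'_def choose_two_Suc)
  ultimately show ?case by (intro exI[of _ c']) simp
qed

section \<open>Brackets of Schur generating functions\<close>

lemma has_sum_finite_sum:
  fixes f :: "'i \<Rightarrow> 'a \<Rightarrow> 'b :: topological_comm_monoid_add"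
  assumes "finite I" "\<And>i. i \<in> I \<Longrightarrow> (f i has_sum s i) A"
  shows "((\<lambda>x. \<Sum>i\<in>I. f i x) has_sum (\<Sum>i\<in>I. s i)) A"
  using assms
proof (induction I rule: finite_induct)
  case (insert i I)
  then show ?case by (simp add: has_sum_add)
qed simp

lemma gt_schur_cong: "(\<And>i. i < N \<Longrightarrow> u i = v i) \<Longrightarrow> gt_schur N l u = gt_schur N l v"
proof (induction N arbitrary: l)
  case (Suc N)
  have "gt_schur N p u = gt_schur N p v" for p by (rule Suc.IH) (use Suc.prems in simp)
  then show ?case using Suc.prems[of N] by simp
qed simp

lemma sgf_term_gt_schur:
  "l \<in> signatures N \<Longrightarrow> sgf_term N \<rho> u l =
     of_real (pmf \<rho> l) * (gt_schur N (sig_exp N l) u / gt_schur N (sig_exp N l) (\<lambda>_. 1))"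
  by (simp add: sgf_term_def schur_eq_gt_schur)

lemma sgf_converges_cong:
  assumes "\<And>i. i < N \<Longrightarrow> u i = v i"
  shows "sgf_converges N \<rho> u \<longleftrightarrow> sgf_converges N \<rho> v"
  unfolding sgf_converges_def
  by (rule summable_on_cong) (simp add: sgf_term_gt_schur gt_schur_cong[OF assms])

lemma sym_laurent_pad:
  assumes f: "sym_laurent N f" and r: "r \<le> N"
  shows "sym_laurent r (\<lambda>u. f (pad_ones r u))"
  unfolding sym_laurent_def
proof (intro conjI allI impI ballI)
  show "laurent r (\<lambda>u. f (pad_ones r u))" by (rule laurent_pad_ones[OF sym_laurent_D[OF f]])
  fix a b u assume *: "a < r" "b < r" "u \<in> torus r"
  have "pad_ones r (u \<circ> swap a b) = pad_ones r u \<circ> swap a b"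
    using * by (auto simp: fun_eq_iff pad_ones_def Transposition.transpose_def)
  moreover have "pad_ones r u \<in> torus N" using * by (auto simp: torus_def pad_ones_def)
  ultimately show "f (pad_ones r (u \<circ> swap a b)) = f (pad_ones r u)"
    using f * r by (simp add: sym_laurent_def)
qed

lemma sym_laurent_sgf_term:
  assumes "l \<in> signatures N" "r \<le> N"
  shows "sym_laurent r (\<lambda>u. sgf_term N \<rho> (pad_ones r u) l)"
proof -
  have "sym_laurent r (\<lambda>u. (of_real (pmf \<rho> l) / gt_schur N (sig_exp N l) (\<lambda>_. 1)) * gt_schur N (sig_exp N l) (pad_ones r u))"
    by (intro sym_laurent_cmult sym_laurent_pad[OF sym_gt_schur[OF strict_dec_sig_exp[OF assms(1)]] assms(2)])
  then show ?thesis by (simp add: sgf_term_gt_schur[OF assms(1)])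
qed

text \<open>Convergence is only assumed pointwise. Absolute convergence at the real corners of a polydisc
  provides a majorant, since Schur functions have nonnegative coefficients.\<close>

lemma sgf_uniform_limit:
  assumes r: "r \<le> N" and \<delta>: "0 < \<delta>" "\<delta> < \<epsilon>" "\<delta> < 1"
    and conv: "\<And>u. u \<in> polydisc r \<epsilon> \<Longrightarrow> sgf_converges N \<rho> (pad_ones r u)"
  shows "uniform_limit (polyball r \<delta>) (\<lambda>F u. \<Sum>l\<in>F. sgf_term N \<rho> (pad_ones r u) l)
     (\<lambda>u. sgf N \<rho> (pad_ones r u)) (finite_subsets_at_top (signatures N))"
proof -
  define a where "a i = (if i < r then 1 - \<delta> else 1)" for i
  define b where "b i = (if i < r then 1 + \<delta> else 1)" for i
  \<comment> \<open>The corners are real points of the polydisc, padded with ones.\<close>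
  define corner where "corner B = (\<lambda>i. complex_of_real (if i \<in> B then a i else b i))" for B
  have summ: "(\<lambda>l. norm (sgf_term N \<rho> (corner B) l)) summable_on signatures N" for B
  proof -
    have "restrict (corner B) {..<r} \<in> polydisc r \<epsilon>"
      using \<delta> by (auto simp: polydisc_def corner_def a_def b_def dist_norm)
    moreover have "pad_ones r (restrict (corner B) {..<r}) = corner B"
      by (auto simp: pad_ones_def corner_def a_def b_def)
    ultimately have "sgf_converges N \<rho> (corner B)" using conv by metis
    then show ?thesis unfolding sgf_converges_def by (simp add: summable_on_iff_abs_summable_on_complex)
  qed
  define M where "M l = (\<Sum>B\<in>Pow {..<N}. norm (sgf_term N \<rho> (corner B) l))" for l
  have "uniform_limit (polyball r \<delta>) (\<lambda>F u. \<Sum>l\<in>F. sgf_term N \<rho> (pad_ones r u) l)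
     (\<lambda>u. \<Sum>\<^sub>\<infinity>l\<in>signatures N. sgf_term N \<rho> (pad_ones r u) l) (finite_subsets_at_top (signatures N))"
  proof (rule Weierstrass_m_test_general)
    show "M summable_on signatures N"
      unfolding M_def
      by (rule has_sum_imp_summable, rule has_sum_finite_sum) (auto intro: has_sum_infsum[OF summ])
    fix l u assume l: "l \<in> signatures N" and u: "u \<in> polyball r \<delta>"
    let ?g = "gt_schur N (sig_exp N l)"
    have "norm (?g (pad_ones r u)) \<le> (\<Sum>B\<in>Pow {..<N}. norm (?g (corner B)))"
      unfolding corner_def
    proof (rule gt_schur_bound)
      fix i assume "i < N"
      show "0 < a i \<and> a i \<le> norm (pad_ones r u i) \<and> norm (pad_ones r u i) \<le> b i"
        using norm_near_one[of "u i" \<delta>] u \<delta> by (auto simp: a_def b_def pad_ones_def polyball_def)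
    qed
    then have "norm (of_real (pmf \<rho> l) / ?g (\<lambda>_. 1)) * norm (?g (pad_ones r u)) \<le>
       norm (of_real (pmf \<rho> l) / ?g (\<lambda>_. 1)) * (\<Sum>B\<in>Pow {..<N}. norm (?g (corner B)))"
      by (intro mult_left_mono) auto
    then show "norm (sgf_term N \<rho> (pad_ones r u) l) \<le> M l"
      by (simp add: M_def sgf_term_gt_schur[OF l] norm_mult norm_divide sum_distrib_left)
  qed
  then show ?thesis by (simp add: sgf_def)
qed

text \<open>Uniform convergence allows the bracket to be taken term by term.\<close>

lemma sgf_sym_closure:
  assumes r: "0 < r" "r \<le> N" and \<delta>: "0 < \<delta>" "\<delta> < \<epsilon>" "\<delta> < 1"
    and conv: "\<And>u. u \<in> polydisc r \<epsilon> \<Longrightarrow> sgf_converges N \<rho> (pad_ones r u)"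
  shows "sym_closure r \<delta> (\<lambda>u. sgf N \<rho> (pad_ones r u))"
    "((\<lambda>l. bracket r m n (\<lambda>u. sgf_term N \<rho> (pad_ones r u) l)) has_sum
       blim r \<delta> m n (\<lambda>u. sgf N \<rho> (pad_ones r u))) (signatures N)"
proof -
  let ?F = "finite_subsets_at_top (signatures N)"
  note lim = sgf_uniform_limit[OF r(2) \<delta> conv]
  have sy: "sym_laurent r (\<lambda>u. \<Sum>l\<in>F. sgf_term N \<rho> (pad_ones r u) l)" if "F \<subseteq> signatures N" for F
    using that r by (intro sym_laurent_sum sym_laurent_sgf_term) auto
  have ev: "\<forall>\<^sub>F F in ?F. finite F \<and> F \<subseteq> signatures N"
    by (simp add: eventually_finite_subsets_at_top_weakI)
  then have ev': "\<forall>\<^sub>F F in ?F. sym_closure r \<delta> (\<lambda>u. \<Sum>l\<in>F. sgf_term N \<rho> (pad_ones r u) l)"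
    by eventually_elim (auto intro: sym_closure_sym sy)
  show sc: "sym_closure r \<delta> (\<lambda>u. sgf N \<rho> (pad_ones r u))"
    by (rule sym_closure_limit[OF lim ev']) auto
  have "((\<lambda>F. blim r \<delta> m n (\<lambda>u. \<Sum>l\<in>F. sgf_term N \<rho> (pad_ones r u) l)) \<longlongrightarrow> blim r \<delta> m n (\<lambda>u. sgf N \<rho> (pad_ones r u))) ?F"
    by (rule blim_tendsto[OF \<delta>(1,3) r(1) lim ev' sc])
  moreover have "\<forall>\<^sub>F F in ?F. blim r \<delta> m n (\<lambda>u. \<Sum>l\<in>F. sgf_term N \<rho> (pad_ones r u) l) =
      (\<Sum>l\<in>F. bracket r m n (\<lambda>u. sgf_term N \<rho> (pad_ones r u) l))"
    using ev
  proof eventually_elim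
    case (elim F)
    then have F: "finite F" "F \<subseteq> signatures N" by auto
    have "blim r \<delta> m n (\<lambda>u. \<Sum>l\<in>F. sgf_term N \<rho> (pad_ones r u) l) = bracket r m n (\<lambda>u. \<Sum>l\<in>F. sgf_term N \<rho> (pad_ones r u) l)"
      by (rule blim_sym[OF \<delta>(1,3) r(1) sy[OF F(2)]])
    also have "\<dots> = (\<Sum>l\<in>F. bracket r m n (\<lambda>u. sgf_term N \<rho> (pad_ones r u) l))"
      using F(2) by (intro bracket_sum[OF F(1) _ r(1)] sym_laurent_sgf_term r(2)) auto
    finally show ?case .
  qed
  ultimately show "((\<lambda>l. bracket r m n (\<lambda>u. sgf_term N \<rho> (pad_ones r u) l)) has_sum
       blim r \<delta> m n (\<lambda>u. sgf N \<rho> (pad_ones r u))) (signatures N)"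
    unfolding has_sum_def by (simp add: tendsto_cong)
qed

text \<open>The exact formula for Schur functions, averaged over the random signature.\<close>

lemma falling_moment_has_sum:
  assumes B: "\<And>j. j \<le> m \<Longrightarrow> Suc j \<le> N \<Longrightarrow>
     ((\<lambda>l. bracket (Suc j) m (m - j) (\<lambda>u. sgf_term N \<rho> (pad_ones (Suc j) u) l)) has_sum V j) (signatures N)"
  shows "((\<lambda>l. of_real (pmf \<rho> l) * (\<Sum>q<N. ffact m (of_int (sig_exp N l q)))) has_sum
     (\<Sum>j\<le>m. of_nat (m choose j) * fact j * of_nat (N choose Suc j) * V j)) (signatures N)"
proof -
  have tm: "of_real (pmf \<rho> l) * (\<Sum>q<N. ffact m (of_int (sig_exp N l q))) =
      (\<Sum>j\<le>m. of_nat (m choose j) * fact j * of_nat (N choose Suc j) *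
        bracket (Suc j) m (m - j) (\<lambda>u. sgf_term N \<rho> (pad_ones (Suc j) u) l))"
    if l: "l \<in> signatures N" for l
  proof -
    let ?g = "gt_schur N (sig_exp N l)"
    have sd: "strict_dec N (sig_exp N l)" by (rule strict_dec_sig_exp[OF l])
    have g1: "?g (\<lambda>_. 1) \<noteq> 0" using gt_schur_one_pos[OF sd] by auto
    have br: "bracket (Suc j) m (m - j) (\<lambda>u. sgf_term N \<rho> (pad_ones (Suc j) u) l) =
       of_real (pmf \<rho> l) / ?g (\<lambda>_. 1) * bracket (Suc j) m (m - j) (\<lambda>u. ?g (pad_ones (Suc j) u))" if "Suc j \<le> N" for j
      using bracket_cmult[OF sym_laurent_pad[OF sym_gt_schur[OF sd] that], of m "m - j" "of_real (pmf \<rho> l) / ?g (\<lambda>_. 1)"]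
      by (simp add: sgf_term_gt_schur[OF l])
    have "of_real (pmf \<rho> l) * (\<Sum>q<N. ffact m (of_int (sig_exp N l q))) =
       of_real (pmf \<rho> l) / ?g (\<lambda>_. 1) * ((\<Sum>q<N. ffact m (of_int (sig_exp N l q))) * ?g (\<lambda>_. 1))"
      using g1 by simp
    also have "\<dots> = (\<Sum>j\<le>m. of_real (pmf \<rho> l) / ?g (\<lambda>_. 1) * (of_nat (m choose j) * fact j * of_nat (N choose Suc j) *
        bracket (Suc j) m (m - j) (\<lambda>u. ?g (pad_ones (Suc j) u))))"
      by (simp only: gt_schur_eigen_expansion[OF sd] sum_distrib_left)
    also have "\<dots> = (\<Sum>j\<le>m. of_nat (m choose j) * fact j * of_nat (N choose Suc j) *
        bracket (Suc j) m (m - j) (\<lambda>u. sgf_term N \<rho> (pad_ones (Suc j) u) l))"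
    proof (rule sum.cong)
      fix j
      show "of_real (pmf \<rho> l) / ?g (\<lambda>_. 1) * (of_nat (m choose j) * fact j * of_nat (N choose Suc j) *
        bracket (Suc j) m (m - j) (\<lambda>u. ?g (pad_ones (Suc j) u))) = of_nat (m choose j) * fact j * of_nat (N choose Suc j) *
        bracket (Suc j) m (m - j) (\<lambda>u. sgf_term N \<rho> (pad_ones (Suc j) u) l)"
      proof (cases "Suc j \<le> N")
        case True
        then show ?thesis unfolding br[OF True] by (simp only: mult_ac)
      qed (simp add: binomial_eq_0)
    qed simp
    finally show ?thesis .
  qed
  have "((\<lambda>l. \<Sum>j\<le>m. of_nat (m choose j) * fact j * of_nat (N choose Suc j) *
        bracket (Suc j) m (m - j) (\<lambda>u. sgf_term N \<rho> (pad_ones (Suc j) u) l)) has_sum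
     (\<Sum>j\<le>m. of_nat (m choose j) * fact j * of_nat (N choose Suc j) * V j)) (signatures N)"
  proof (rule has_sum_finite_sum)
    fix j assume "j \<in> {..m}"
    show "((\<lambda>l. of_nat (m choose j) * fact j * of_nat (N choose Suc j) *
        bracket (Suc j) m (m - j) (\<lambda>u. sgf_term N \<rho> (pad_ones (Suc j) u) l)) has_sum
        of_nat (m choose j) * fact j * of_nat (N choose Suc j) * V j) (signatures N)"
    proof (cases "Suc j \<le> N")
      case True
      show ?thesis by (rule has_sum_cmult_right, rule B) (use True \<open>j \<in> {..m}\<close> in auto)
    qed (simp add: binomial_eq_0)
  qed simp
  from iffD2[OF has_sum_cong, OF tm this] show ?thesis .
qed

lemma uniform_limit_exp:
  fixes R :: "'n \<Rightarrow> 'a \<Rightarrow> complex"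
  assumes lim: "uniform_limit X R b F" and bd: "bounded (b ` X)"
  shows "uniform_limit X (\<lambda>n u. exp (R n u)) (\<lambda>u. exp (b u)) F"
proof (rule uniform_limitI)
  fix e :: real assume e: "0 < e"
  obtain B where B: "\<And>u. u \<in> X \<Longrightarrow> norm (b u) \<le> B" using bd unfolding bounded_iff by blast
  have pos: "0 < e / exp B" using e by simp
  have "isCont exp (0::complex)" by simp
  then obtain d where d: "0 < d" "\<And>h. norm h < d \<Longrightarrow> norm (exp h - 1 :: complex) < e / exp B"
    using pos unfolding continuous_at_eps_delta by (metis dist_norm diff_zero exp_zero)
  show "\<forall>\<^sub>F n in F. \<forall>u\<in>X. dist (exp (R n u)) (exp (b u)) < e"
    using uniform_limitD[OF lim d(1)]
  proof eventually_elim
    case (elim n)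
    show ?case
    proof
      fix u assume u: "u \<in> X"
      have eq: "exp (R n u) - exp (b u) = exp (b u) * (exp (R n u - b u) - 1)"
        by (simp add: algebra_simps flip: exp_add)
      have n1: "norm (exp (b u)) \<le> exp B"
        using order_trans[OF complex_Re_le_cmod B[OF u]] by simp
      have n2: "norm (exp (R n u - b u) - 1) < e / exp B"
        using elim u by (intro d(2)) (simp add: dist_norm)
      have "norm (exp (R n u) - exp (b u)) < exp B * (e / exp B)"
        unfolding eq norm_mult by (rule mult_le_less_imp_less[OF n1 n2]) auto
      then show "dist (exp (R n u)) (exp (b u)) < e" by (simp add: dist_norm)
    qed
  qed
qed

text \<open>Up to \<open>o(N\<^bsup>n-1\<^esup>)\<close> the bracket of the Schur generating function equals the bracket of the product of
  the functions \<open>exp (N \<Psi>(u\<^sub>i) + \<Phi>(u\<^sub>i))\<close>, which is a polynomial in \<open>N\<close> with known leading coefficients.\<close>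

lemma bracket_sum_expansion:
  fixes \<rho> :: "nat \<Rightarrow> int list pmf" and \<Psi> \<Phi> :: "complex \<Rightarrow> complex"
  assumes \<epsilon>: "0 < \<epsilon>"
    and L: "\<forall>\<^sub>F N in sequentially. is_log_sgf (Suc j) \<epsilon> N (\<rho> N) (L N)"
    and lim: "uniform_limit (polydisc (Suc j) \<epsilon>)
             (\<lambda>N u. of_nat N * (1 / of_nat N * L N u - (\<Sum>i<Suc j. \<Psi> (u i))))
             (\<lambda>u. \<Sum>i<Suc j. \<Phi> (u i)) sequentially"
    and \<Psi>: "\<Psi> analytic_on {1}" "(\<lambda>x. \<Psi> (1 + x)) has_fps_expansion S"
    and \<Phi>: "\<Phi> analytic_on {1}" "(\<lambda>x. \<Phi> (1 + x)) has_fps_expansion T"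
  shows "\<exists>V. (\<forall>\<^sub>F N in sequentially.
      ((\<lambda>l. bracket (Suc j) m n (\<lambda>u. sgf_term N (\<rho> N) (pad_ones (Suc j) u) l)) has_sum V N) (signatures N)) \<and>
     expansion2 V n (fps_nth ((1 + fps_X) ^ m * fps_deriv S ^ n) j)
       (fps_nth ((1 + fps_X) ^ m * (of_nat n * fps_deriv S ^ (n - 1) * fps_deriv T
            + of_nat (n choose 2) * fps_deriv S ^ (n - 2) * fps_deriv (fps_deriv S))) j)"
proof -
  define r where "r = Suc j"
  obtain e1 where e1: "0 < e1" "\<Psi> holomorphic_on ball 1 e1" using \<Psi>(1) unfolding analytic_on_def by auto
  obtain e2 where e2: "0 < e2" "\<Phi> holomorphic_on ball 1 e2" using \<Phi>(1) unfolding analytic_on_def by auto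
  define \<delta> where "\<delta> = min (min \<epsilon> 1) (min e1 e2) / 2"
  have \<delta>: "0 < \<delta>" "\<delta> < \<epsilon>" "\<delta> < 1" "\<delta> < e1" "\<delta> < e2" using \<epsilon> e1 e2 by (auto simp: \<delta>_def)
  have r: "0 < r" by (simp add: r_def)
  define a where "a u = (\<Sum>i<r. \<Psi> (u i))" for u
  define b where "b u = (\<Sum>i<r. \<Phi> (u i))" for u
  define SN where "SN N u = sgf N (\<rho> N) (pad_ones r u)" for N u
  define res where "res u = restrict u {..<r}" for u :: "nat \<Rightarrow> complex"
  let ?K = "polyball r \<delta>"
  have res: "res u \<in> polydisc r \<epsilon>" if "u \<in> ?K" for u
    using that \<delta> by (auto simp: res_def polydisc_def polyball_def dist_norm intro: le_less_trans)
  have pad_res: "pad_ones r (res u) = pad_ones r u" for u by (auto simp: pad_ones_def res_def)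
  have one: "(\<lambda>_. 1) \<in> ?K" by (rule ones_polyball[OF \<delta>(1)])
  define R where "R N u = L N (res u) - of_nat N * a u" for N u
  have Rlim: "uniform_limit ?K R b sequentially"
  proof (rule uniform_limitI)
    fix e :: real assume "0 < e"
    from uniform_limitD[OF lim this] eventually_gt_at_top[of 0]
    show "\<forall>\<^sub>F N in sequentially. \<forall>u\<in>?K. dist (R N u) (b u) < e"
    proof eventually_elim
      case (elim N)
      show ?case
      proof
        fix u assume u: "u \<in> ?K"
        have "(\<Sum>i<Suc j. \<Psi> (res u i)) = a u" "(\<Sum>i<Suc j. \<Phi> (res u i)) = b u"
          by (simp_all add: a_def b_def res_def r_def)
        then have "dist (of_nat N * (1 / of_nat N * L N (res u) - a u)) (b u) < e"
          using elim res[OF u] by (auto simp: r_def)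
        moreover have "of_nat N * (1 / of_nat N * L N (res u) - a u) = R N u"
          using elim by (simp add: R_def algebra_simps)
        ultimately show "dist (R N u) (b u) < e" by simp
      qed
    qed
  qed
  have L': "\<forall>\<^sub>F N in sequentially. is_log_sgf r \<epsilon> N (\<rho> N) (L N)" using L by (simp add: r_def)
  \<comment> \<open>At the base point the logarithm vanishes, so \<open>N r \<Psi>(1)\<close> has a finite limit. This forces
    \<open>\<Psi>(1) = 0\<close>, and then the limit \<open>- r \<Phi>(1)\<close> is \<open>0\<close> as well.\<close>
  have R1: "(\<lambda>N. R N (\<lambda>_. 1)) \<longlonglongrightarrow> of_nat r * \<Phi> 1"
    using tendsto_uniform_limitI[OF Rlim one] by (simp add: b_def)
  have "\<forall>\<^sub>F N in sequentially. R N (\<lambda>_. 1) = - (of_nat N * (of_nat r * \<Psi> 1))"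
    using L' by eventually_elim (simp add: R_def a_def res_def is_log_sgf_def)
  from tendsto_cong[OF this] R1 have R1': "(\<lambda>N. - (of_nat N * (of_nat r * \<Psi> 1))) \<longlonglongrightarrow> of_nat r * \<Phi> 1" by simp
  have \<Psi>1: "\<Psi> 1 = 0"
  proof -
    have t: "(\<lambda>N. inverse (of_nat N) * (- (of_nat N * (of_nat r * \<Psi> 1)))) \<longlonglongrightarrow> 0 * (of_nat r * \<Phi> 1)"
      by (rule tendsto_mult[OF lim_inverse_n R1'])
    have "\<forall>\<^sub>F N in sequentially. inverse (of_nat N) * (- (of_nat N * (of_nat r * \<Psi> 1))) = - (of_nat r * \<Psi> 1)"
      using eventually_gt_at_top[of 0] by eventually_elim simp
    from iffD1[OF tendsto_cong[OF this] t] have "(\<lambda>N::nat. - (of_nat r * \<Psi> 1)) \<longlonglongrightarrow> 0" by simp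
    then have "- (of_nat r * \<Psi> 1) = 0" by (simp add: tendsto_const_iff)
    then show ?thesis using r by simp
  qed
  have \<Phi>1: "\<Phi> 1 = 0"
  proof -
    have "(\<lambda>N::nat. 0) \<longlonglongrightarrow> of_nat r * \<Phi> 1" using R1' \<Psi>1 by simp
    then have "of_nat r * \<Phi> 1 = 0" by (simp add: tendsto_const_iff)
    then show ?thesis using r by simp
  qed
  have a1: "a (\<lambda>_. 1) = 0" and b1: "b (\<lambda>_. 1) = 0" by (simp_all add: a_def b_def \<Psi>1 \<Phi>1)
  have sca: "sym_closure r \<delta> a" unfolding a_def[abs_def] by (rule sym_closure_sum_coord[OF e1(2) \<delta>(4,1)])
  have scb: "sym_closure r \<delta> b" unfolding b_def[abs_def] by (rule sym_closure_sum_coord[OF e2(2) \<delta>(5,1)])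
  define W where "W N u = exp (- of_nat N * a u) * SN N u" for N u
  have big: "\<forall>\<^sub>F N in sequentially. r \<le> N" by (rule eventually_ge_at_top)
  have scS: "\<forall>\<^sub>F N in sequentially. sym_closure r \<delta> (SN N) \<and>
     ((\<lambda>l. bracket r m n (\<lambda>u. sgf_term N (\<rho> N) (pad_ones r u) l)) has_sum blim r \<delta> m n (SN N)) (signatures N)"
    using L' big
  proof eventually_elim
    case (elim N)
    have "\<And>u. u \<in> polydisc r \<epsilon> \<Longrightarrow> sgf_converges N (\<rho> N) (pad_ones r u)"
      using elim by (auto simp: is_log_sgf_def)
    from sgf_sym_closure[OF r elim(2) \<delta>(1-3) this]
    show ?case unfolding SN_def by blast
  qed
  have expL: "\<forall>\<^sub>F N in sequentially. \<forall>u\<in>?K. W N u = exp (R N u)"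
    using L'
  proof eventually_elim
    case (elim N)
    show ?case
    proof
      fix u assume "u \<in> ?K"
      then have "exp (L N (res u)) = SN N u"
        using elim res pad_res by (auto simp: is_log_sgf_def SN_def)
      then show "W N u = exp (R N u)" by (simp add: W_def R_def exp_diff exp_minus field_simps)
    qed
  qed
  have Wlim: "uniform_limit ?K W (\<lambda>u. exp (b u)) sequentially"
  proof -
    have "uniform_limit ?K (\<lambda>N u. exp (R N u)) (\<lambda>u. exp (b u)) sequentially"
      by (rule uniform_limit_exp[OF Rlim sym_closure_bounded[OF \<delta>(3) scb]])
    then show ?thesis
      unfolding uniform_limit_iff
    proof (intro allI impI)
      fix e :: real assume *: "\<forall>e>0. \<forall>\<^sub>F N in sequentially. \<forall>u\<in>?K. dist (exp (R N u)) (exp (b u)) < e" "0 < e"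
      then have "\<forall>\<^sub>F N in sequentially. \<forall>u\<in>?K. dist (exp (R N u)) (exp (b u)) < e" by blast
      with expL show "\<forall>\<^sub>F N in sequentially. \<forall>u\<in>?K. dist (W N u) (exp (b u)) < e"
        by eventually_elim simp
    qed
  qed
  have scW: "\<forall>\<^sub>F N in sequentially. sym_closure r \<delta> (W N) \<and> W N (\<lambda>_. 1) = 1"
    using scS expL L'
  proof eventually_elim
    case (elim N)
    have "sym_closure r \<delta> (\<lambda>u. exp (- of_nat N * a u))"
      by (intro sym_closure_exp sym_closure_cmult \<delta> sca)
    then have "sym_closure r \<delta> (W N)"
      unfolding W_def[abs_def] using elim by (intro sym_closure_mult \<delta>) auto
    moreover have "R N (\<lambda>_. 1) = 0"
      using elim a1 by (simp add: R_def res_def is_log_sgf_def)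
    then have "W N (\<lambda>_. 1) = 1" using elim one by auto
    ultimately show ?case by blast
  qed
  define V where "V N = blim r \<delta> m n (SN N)" for N
  define G where "G N = blim r \<delta> m n (\<lambda>u. exp (of_nat N * a u) * exp (b u))" for N
  have "(\<lambda>N. of_nat N * ((blim r \<delta> m n (\<lambda>u. exp (of_nat N * a u) * W N u) -
     blim r \<delta> m n (\<lambda>u. exp (of_nat N * a u) * exp (b u))) / of_nat N ^ n)) \<longlonglongrightarrow> 0"
    by (rule blim_exp_perturb[OF \<delta>(1,3) r sca a1 sym_closure_exp[OF \<delta>(3) scb] _ scW Wlim]) (simp add: b1)
  moreover have "(\<lambda>u. exp (of_nat N * a u) * W N u) = SN N" for N
    by (simp add: W_def fun_eq_iff exp_minus field_simps)
  ultimately have diff: "(\<lambda>N. of_nat N * ((V N - G N) / of_nat N ^ n)) \<longlonglongrightarrow> 0"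
    by (simp add: V_def G_def)
  obtain c where c: "\<And>z F. fps_deriv F = (fps_const z * fps_deriv S + fps_deriv T) * F \<Longrightarrow> fps_nth F 0 \<noteq> 0 \<Longrightarrow>
       log_deriv_fps 0 n F = (\<Sum>q\<le>n. fps_const (z ^ q) * c q)" "c n = fps_deriv S ^ n"
     "n \<noteq> 0 \<Longrightarrow> c (n - 1) = of_nat n * fps_deriv S ^ (n - 1) * fps_deriv T +
        of_nat (n choose 2) * fps_deriv S ^ (n - 2) * fps_deriv (fps_deriv S)"
    using log_deriv_polynomial[of "fps_deriv S" "fps_deriv T" n] by blast
  define \<beta> where "\<beta> q = fps_nth ((1 + fps_X) ^ m * c q) j" for q
  have G: "G N = (\<Sum>q\<le>n. of_nat N ^ q * \<beta> q)" for N
  proof -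
    define \<phi> where "\<phi> x = exp (of_nat N * \<Psi> x + \<Phi> x)" for x
    define F where "F = fps_exp 1 oo (fps_const (of_nat N) * S + T)"
    have S0: "fps_nth S 0 = 0" and T0: "fps_nth T 0 = 0"
      using has_fps_expansion_imp_0_eq_fps_nth_0[OF \<Psi>(2)] has_fps_expansion_imp_0_eq_fps_nth_0[OF \<Phi>(2)] \<Psi>1 \<Phi>1 by auto
    have NS0: "fps_nth (fps_const (of_nat N) * S + T) 0 = 0" using S0 T0 by simp
    have "(exp \<circ> (\<lambda>x. of_nat N * \<Psi> (1 + x) + \<Phi> (1 + x))) has_fps_expansion F"
      unfolding F_def using NS0
      by (intro has_fps_expansion_compose has_fps_expansion_exp1 has_fps_expansion_add has_fps_expansion_cmult_left \<Psi> \<Phi>)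
    then have F: "(\<lambda>x. \<phi> (1 + x)) has_fps_expansion F" by (simp add: \<phi>_def o_def)
    have F': "fps_deriv F = (fps_const (of_nat N) * fps_deriv S + fps_deriv T) * F"
      unfolding F_def using fps_compose_deriv[OF NS0, of "fps_exp 1"] by (simp add: mult.commute)
    have F0: "fps_nth F 0 \<noteq> 0" by (simp add: F_def)
    define e where "e = min e1 e2"
    have "\<Psi> holomorphic_on ball 1 e" "\<Phi> holomorphic_on ball 1 e"
      using holomorphic_on_subset[OF e1(2), of "ball 1 e"] holomorphic_on_subset[OF e2(2), of "ball 1 e"]
      by (auto simp: e_def subset_ball)
    then have "\<phi> holomorphic_on ball 1 e"
      unfolding \<phi>_def[abs_def] by (intro holomorphic_intros)
    moreover have "\<delta> < e" using \<delta> by (simp add: e_def)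
    moreover have \<phi>1: "\<phi> 1 = 1" by (simp add: \<phi>_def \<Psi>1 \<Phi>1)
    ultimately have "blim r \<delta> m n (\<lambda>u. \<Prod>i<r. \<phi> (u i)) = \<phi> 1 ^ r * fps_nth (log_deriv_fps m n F) (r - 1)"
      by (intro blim_prod[OF _ _ \<delta>(1,3) r _ F]) auto
    moreover have "(\<lambda>u. \<Prod>i<r. \<phi> (u i)) = (\<lambda>u. exp (of_nat N * a u) * exp (b u))"
      by (simp add: \<phi>_def a_def b_def sum_distrib_left sum.distrib exp_sum[symmetric] flip: exp_add)
    moreover have "log_deriv_fps m n F = (\<Sum>q\<le>n. fps_const (of_nat N ^ q) * ((1 + fps_X) ^ m * c q))"
      using log_deriv_fps_rec(3)[OF F' F0, of m n] c(1)[OF F' F0] by (simp add: sum_distrib_left mult.left_commute)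
    ultimately show ?thesis
      by (simp add: G_def \<phi>1 r_def fps_sum_nth \<beta>_def)
  qed
  have "expansion2 G n (\<beta> n) (if n = 0 then 0 else \<beta> (n - 1))"
    using expansion2_polynomial[of \<beta> n] G by (simp add: G[abs_def])
  from expansion2_perturb[OF this diff]
  have "expansion2 V n (\<beta> n) (if n = 0 then 0 else \<beta> (n - 1))" .
  moreover have "(if n = 0 then 0 else \<beta> (n - 1)) = fps_nth ((1 + fps_X) ^ m * (of_nat n * fps_deriv S ^ (n - 1) * fps_deriv T
            + of_nat (n choose 2) * fps_deriv S ^ (n - 2) * fps_deriv (fps_deriv S))) j"
    using c(3) by (cases "n = 0") (simp_all add: \<beta>_def binomial_eq_0)
  moreover have "\<beta> n = fps_nth ((1 + fps_X) ^ m * fps_deriv S ^ n) j" by (simp add: \<beta>_def c(2))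
  moreover have "\<forall>\<^sub>F N in sequentially. ((\<lambda>l. bracket r m n (\<lambda>u. sgf_term N (\<rho> N) (pad_ones r u) l)) has_sum V N) (signatures N)"
    using scS by eventually_elim (simp add: V_def)
  ultimately show ?thesis unfolding r_def by auto
qed

lemma power_sum_has_sum:
  assumes N: "1 \<le> N" and c: "\<And>z. z ^ k = (\<Sum>m\<le>k. c m * ffact m z)"
    and M: "\<And>m. m \<le> k \<Longrightarrow> ((\<lambda>l. of_real (pmf \<rho> l) * (\<Sum>q<N. ffact m (of_int (sig_exp N l q)))) has_sum M m) (signatures N)"
  shows "(\<lambda>l. pmf \<rho> l * power_sum N k l) summable_on signatures N"
    "complex_of_real (\<Sum>\<^sub>\<infinity>l\<in>signatures N. pmf \<rho> l * power_sum N k l) = (\<Sum>m\<le>k. c m * M m) / of_nat N ^ k"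
proof -
  define f where "f l = pmf \<rho> l * power_sum N k l" for l
  have "complex_of_real (f l) = inverse (of_nat N ^ k) * (\<Sum>m\<le>k. c m * (of_real (pmf \<rho> l) * (\<Sum>q<N. ffact m (of_int (sig_exp N l q)))))" for l
  proof -
    have "(\<Sum>m\<le>k. c m * (of_real (pmf \<rho> l) * (\<Sum>q<N. ffact m (of_int (sig_exp N l q))))) =
      of_real (pmf \<rho> l) * (\<Sum>q<N. \<Sum>m\<le>k. c m * ffact m (of_int (sig_exp N l q)))"
      by (subst sum.swap) (simp add: sum_distrib_left mult_ac)
    also have "\<dots> = of_real (pmf \<rho> l) * (\<Sum>q<N. of_int (sig_exp N l q) ^ k)" by (simp only: c)
    finally show ?thesis
      by (simp add: f_def power_sum_def sig_exp_def power_divide sum_distrib_left divide_inverse power_mult_distrib power_inverse mult_ac)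
  qed
  moreover have "((\<lambda>l. inverse (of_nat N ^ k) * (\<Sum>m\<le>k. c m * (of_real (pmf \<rho> l) * (\<Sum>q<N. ffact m (of_int (sig_exp N l q)))))) has_sum
      inverse (of_nat N ^ k) * (\<Sum>m\<le>k. c m * M m)) (signatures N)"
    by (intro has_sum_cmult_right has_sum_finite_sum) (use M in auto)
  ultimately have 1: "((\<lambda>l. complex_of_real (f l)) has_sum inverse (of_nat N ^ k) * (\<Sum>m\<le>k. c m * M m)) (signatures N)"
    by simp
  then have 2: "(f has_sum Re (inverse (of_nat N ^ k) * (\<Sum>m\<le>k. c m * M m))) (signatures N)"
    using has_sum_Re[OF 1] by simp
  then show "(\<lambda>l. pmf \<rho> l * power_sum N k l) summable_on signatures N"
    unfolding f_def[symmetric] summable_on_def by blast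
  have "((\<lambda>l. complex_of_real (f l)) has_sum complex_of_real (infsum f (signatures N))) (signatures N)"
    using has_sum_of_real[OF 2] unfolding infsumI[OF 2] .
  then have "complex_of_real (infsum f (signatures N)) = inverse (of_nat N ^ k) * (\<Sum>m\<le>k. c m * M m)"
    using 1 has_sum_unique by blast
  then show "complex_of_real (\<Sum>\<^sub>\<infinity>l\<in>signatures N. pmf \<rho> l * power_sum N k l) = (\<Sum>m\<le>k. c m * M m) / of_nat N ^ k"
    by (simp add: f_def[abs_def] divide_inverse mult.commute)
qed

section \<open>Cutting a non-crossing partition at its first block\<close>

definition noncrossing :: "nat set set \<Rightarrow> bool" where
  "noncrossing \<pi> \<longleftrightarrow> \<not> (\<exists>V\<in>\<pi>. \<exists>W\<in>\<pi>. V \<noteq> W \<and>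
     (\<exists>a b c d. a < b \<and> b < c \<and> c < d \<and> a \<in> V \<and> c \<in> V \<and> b \<in> W \<and> d \<in> W))"

lemma noncrossingI:
  "(\<And>V W p q r s. V \<in> \<pi> \<Longrightarrow> W \<in> \<pi> \<Longrightarrow> V \<noteq> W \<Longrightarrow> p < q \<Longrightarrow> q < r \<Longrightarrow> r < s \<Longrightarrow>
     p \<in> V \<Longrightarrow> r \<in> V \<Longrightarrow> q \<in> W \<Longrightarrow> s \<in> W \<Longrightarrow> False) \<Longrightarrow> noncrossing \<pi>"
  unfolding noncrossing_def by blast

lemma noncrossingD:
  "noncrossing \<pi> \<Longrightarrow> V \<in> \<pi> \<Longrightarrow> W \<in> \<pi> \<Longrightarrow> V \<noteq> W \<Longrightarrow> p < q \<Longrightarrow> q < r \<Longrightarrow> r < s \<Longrightarrow>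
     p \<in> V \<Longrightarrow> r \<in> V \<Longrightarrow> q \<in> W \<Longrightarrow> s \<in> W \<Longrightarrow> False"
  unfolding noncrossing_def by blast

text \<open>Half-open intervals make the empty interval available, which the recursion on intervals needs.\<close>

definition NC :: "nat \<Rightarrow> nat \<Rightarrow> nat set set set" where
  "NC a b = {\<pi>. partition_on {a..<b} \<pi> \<and> noncrossing \<pi>}"

text \<open>This is empty if \<open>x\<close> lies outside the ground set. That case occurs below for \<open>x = b\<close>, when a block
  has no element after its first one.\<close>

definition blk :: "nat set set \<Rightarrow> nat \<Rightarrow> nat set" where
  "blk \<pi> x = \<Union>{T\<in>\<pi>. x \<in> T}"

definition others :: "nat set set \<Rightarrow> nat \<Rightarrow> nat set set" where
  "others \<pi> x = {T\<in>\<pi>. x \<notin> T}"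

lemma NC_D:
  assumes "\<pi> \<in> NC a b"
  shows "\<Union>\<pi> = {a..<b}" "{} \<notin> \<pi>" "\<And>V W x. V \<in> \<pi> \<Longrightarrow> W \<in> \<pi> \<Longrightarrow> x \<in> V \<Longrightarrow> x \<in> W \<Longrightarrow> V = W"
    "noncrossing \<pi>"
  using assms by (auto simp: NC_def partition_on_def disjoint_def)

lemma NC_I:
  assumes "\<Union>\<pi> = {a..<b}" "{} \<notin> \<pi>" "\<And>V W x. V \<in> \<pi> \<Longrightarrow> W \<in> \<pi> \<Longrightarrow> x \<in> V \<Longrightarrow> x \<in> W \<Longrightarrow> V = W"
    "noncrossing \<pi>"
  shows "\<pi> \<in> NC a b"
  using assms unfolding NC_def partition_on_def disjoint_def by blast

lemma finite_NC [simp]: "finite (NC a b)"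
  by (rule finite_subset[of _ "Pow (Pow {a..<b})"]) (auto simp: NC_def partition_on_def)

lemma NC_finite:
  assumes "\<pi> \<in> NC a b" shows "finite \<pi>" "\<And>V. V \<in> \<pi> \<Longrightarrow> finite V"
proof -
  have "\<pi> \<subseteq> Pow {a..<b}" using NC_D(1)[OF assms] by auto
  then show "finite \<pi>" "\<And>V. V \<in> \<pi> \<Longrightarrow> finite V" by (auto intro: finite_subset)
qed

lemma NC_empty: "a \<ge> b \<Longrightarrow> NC a b = {{}}"
  by (auto simp: NC_def partition_on_def noncrossing_def disjoint_def)

lemma blk_in:
  assumes "\<pi> \<in> NC a b" "a \<le> x" "x < b"
  shows "blk \<pi> x \<in> \<pi>" "x \<in> blk \<pi> x"
proof -
  have "x \<in> \<Union>\<pi>" using NC_D(1)[OF assms(1)] assms by auto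
  then obtain T where T: "T \<in> \<pi>" "x \<in> T" by auto
  then have "{T\<in>\<pi>. x \<in> T} = {T}" using NC_D(3)[OF assms(1)] by blast
  then have "blk \<pi> x = T" by (auto simp: blk_def)
  then show "blk \<pi> x \<in> \<pi>" "x \<in> blk \<pi> x" using T by auto
qed

lemma blk_notin:
  assumes "\<pi> \<in> NC a b" "b \<le> x" shows "blk \<pi> x = {} \<and> others \<pi> x = \<pi>"
proof -
  have "x \<notin> \<Union>\<pi>" using NC_D(1)[OF assms(1)] assms(2) by simp
  then show ?thesis unfolding blk_def others_def by blast
qed

lemma blk_eq:
  assumes "\<pi> \<in> NC a b" "T \<in> \<pi>" "x \<in> T" shows "blk \<pi> x = T"
proof -
  have "{T\<in>\<pi>. x \<in> T} = {T}" using NC_D(3)[OF assms(1)] assms by blast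
  then show ?thesis by (simp add: blk_def)
qed

lemma others_eq:
  assumes "\<pi> \<in> NC a b" "a \<le> x" "x < b"
  shows "others \<pi> x = \<pi> - {blk \<pi> x}" "\<pi> = insert (blk \<pi> x) (others \<pi> x)"
  using blk_in[OF assms] blk_eq[OF assms(1)] unfolding others_def by blast+

text \<open>The inverse of cutting a partition of \<open>{a..<b}\<close> at the second element \<open>c\<close> of the block of \<open>a\<close>: the
  point \<open>a\<close> joins the block of \<open>c\<close> in \<open>\<tau>\<close>, and \<open>\<sigma>\<close> fills the gap between \<open>a\<close> and \<open>c\<close>. The value \<open>c = b\<close>
  encodes that \<open>{a}\<close> is a block.\<close>

definition glue :: "nat \<Rightarrow> nat \<times> nat set set \<times> nat set set \<Rightarrow> nat set set" where
  "glue a = (\<lambda>(c, \<sigma>, \<tau>). \<sigma> \<union> others \<tau> c \<union> {insert a (blk \<tau> c)})"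

definition unglue :: "nat \<Rightarrow> nat \<Rightarrow> nat set set \<Rightarrow> nat \<times> nat set set \<times> nat set set" where
  "unglue a b \<pi> = (let B = blk \<pi> a; c = Min (insert b (B - {a})) in
     (c, {T\<in>\<pi>. T \<subseteq> {Suc a..<c}}, {T\<in>\<pi>. T \<subseteq> {c..<b}} \<union> ({B - {a}} - {{}})))"

lemma glue_facts:
  assumes ac: "a < c" "c \<le> b" and s: "\<sigma> \<in> NC (Suc a) c" and t: "\<tau> \<in> NC c b"
  shows "\<And>T. T \<in> \<sigma> \<Longrightarrow> T \<subseteq> {Suc a..<c} \<and> T \<noteq> {}"
    "\<And>T. T \<in> others \<tau> c \<Longrightarrow> T \<subseteq> {Suc c..<b} \<and> T \<noteq> {} \<and> T \<in> \<tau> \<and> T \<noteq> blk \<tau> c"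
    "blk \<tau> c \<subseteq> {c..<b}" "c < b \<Longrightarrow> c \<in> blk \<tau> c \<and> blk \<tau> c \<in> \<tau>" "c = b \<Longrightarrow> blk \<tau> c = {}"
    "\<tau> = others \<tau> c \<union> ({blk \<tau> c} - {{}})"
proof -
  show "\<And>T. T \<in> \<sigma> \<Longrightarrow> T \<subseteq> {Suc a..<c} \<and> T \<noteq> {}"
    using NC_D(1,2)[OF s] by auto
  show bb: "c < b \<Longrightarrow> c \<in> blk \<tau> c \<and> blk \<tau> c \<in> \<tau>" using blk_in[OF t] by auto
  show bc: "c = b \<Longrightarrow> blk \<tau> c = {}" using blk_notin[OF t] by auto
  show "blk \<tau> c \<subseteq> {c..<b}" using NC_D(1)[OF t] by (auto simp: blk_def)
  show "T \<subseteq> {Suc c..<b} \<and> T \<noteq> {} \<and> T \<in> \<tau> \<and> T \<noteq> blk \<tau> c" if "T \<in> others \<tau> c" for T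
  proof -
    have T: "T \<in> \<tau>" "c \<notin> T" using that by (auto simp: others_def)
    then have sub: "T \<subseteq> {c..<b}" "T \<noteq> {}" using NC_D(1,2)[OF t] by auto
    have "T \<subseteq> {Suc c..<b}"
    proof
      fix x assume "x \<in> T"
      then have "x \<in> {c..<b}" "x \<noteq> c" using sub T by auto
      then show "x \<in> {Suc c..<b}" by auto
    qed
    moreover have "c < b" using sub by (metis atLeastLessThan_empty bot.extremum_uniqueI not_le_imp_less)
    then have "T \<noteq> blk \<tau> c" using bb T by auto
    ultimately show ?thesis using T sub by auto
  qed
  show "\<tau> = others \<tau> c \<union> ({blk \<tau> c} - {{}})"
  proof (cases "c < b")
    case True
    then show ?thesis using others_eq(2)[OF t _ True] bb by auto
  next
    case False
    then show ?thesis using blk_notin[OF t] by auto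
  qed
qed

text \<open>A crossing cannot involve blocks on both sides of \<open>c\<close>, and adding \<open>a\<close> to the block of \<open>c\<close> creates
  none, because there are only whole blocks of \<open>\<sigma>\<close> between \<open>a\<close> and \<open>c\<close>.\<close>

lemma glue_NC:
  assumes ac: "a < c" "c \<le> b" and s: "\<sigma> \<in> NC (Suc a) c" and t: "\<tau> \<in> NC c b"
  shows "glue a (c, \<sigma>, \<tau>) \<in> NC a b"
proof -
  note f = glue_facts[OF assms]
  let ?T = "blk \<tau> c"
  have U: "\<Union>(others \<tau> c) \<union> ?T = {c..<b}" using NC_D(1)[OF t] f(6) by auto
  show ?thesis unfolding glue_def prod.case
  proof (rule NC_I)
    have "\<Union>(\<sigma> \<union> others \<tau> c \<union> {insert a ?T}) = insert a ({Suc a..<c} \<union> {c..<b})"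
      using U NC_D(1)[OF s] by auto
    also have "\<dots> = {a..<b}" using ac by auto
    finally show "\<Union>(\<sigma> \<union> others \<tau> c \<union> {insert a ?T}) = {a..<b}" .
    show "{} \<notin> \<sigma> \<union> others \<tau> c \<union> {insert a ?T}" using f(1,2) by blast
    fix V W x assume VW: "V \<in> \<sigma> \<union> others \<tau> c \<union> {insert a ?T}" "W \<in> \<sigma> \<union> others \<tau> c \<union> {insert a ?T}"
      "x \<in> V" "x \<in> W"
    show "V = W"
    proof (cases "x < c")
      case True
      have "T \<notin> others \<tau> c" if "x \<in> T" for T
      proof
        assume "T \<in> others \<tau> c"
        then have "x \<in> {Suc c..<b}" using f(2)[of T] that by blast
        then show False using True by simp
      qed
      moreover have "x \<notin> ?T" using f(3) True by auto
      moreover have "a \<notin> T" if "T \<in> \<sigma>" for T using f(1)[OF that] by auto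
      ultimately show ?thesis using VW NC_D(3)[OF s] by blast
    next
      case False
      have "T \<notin> \<sigma>" if "x \<in> T" for T
      proof
        assume "T \<in> \<sigma>"
        then have "x \<in> {Suc a..<c}" using f(1)[of T] that by blast
        then show False using False by simp
      qed
      moreover have "x \<noteq> a" using False ac by auto
      moreover have "T \<in> \<tau> \<and> T = ?T" if "x \<in> T" "x \<in> ?T" "T \<in> others \<tau> c" for T
      proof -
        have "?T \<in> \<tau>" using that f(4,5) ac(2) by (metis empty_iff le_neq_implies_less)
        then show ?thesis using f(2)[OF that(3)] NC_D(3)[OF t, of T ?T x] that by blast
      qed
      ultimately have V: "V \<in> others \<tau> c \<or> V = insert a ?T \<and> x \<in> ?T"
        and W: "W \<in> others \<tau> c \<or> W = insert a ?T \<and> x \<in> ?T"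
        and *: "\<And>T. x \<in> T \<Longrightarrow> x \<in> ?T \<Longrightarrow> T \<notin> others \<tau> c"
        using VW f(2) by blast+
      show ?thesis
      proof (cases "x \<in> ?T")
        case True
        then show ?thesis using V W * VW by metis
      next
        case False
        then show ?thesis using V W VW f(2)[of V] f(2)[of W] NC_D(3)[OF t, of V W x] by metis
      qed
    qed
  next
    show "noncrossing (\<sigma> \<union> others \<tau> c \<union> {insert a ?T})"
    proof (rule noncrossingI)
      fix V W p q r s'
      assume V: "V \<in> \<sigma> \<union> others \<tau> c \<union> {insert a ?T}" and W: "W \<in> \<sigma> \<union> others \<tau> c \<union> {insert a ?T}"
        and ne: "V \<noteq> W" and o: "p < q" "q < r" "r < s'" and m: "p \<in> V" "r \<in> V" "q \<in> W" "s' \<in> W"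
      have out: "x \<le> a \<or> c \<le> x" if "T \<in> others \<tau> c \<union> {insert a ?T}" "x \<in> T" for x T
        using that f(2,3) by fastforce
      show False
      proof (cases "V \<in> \<sigma>")
        case True
        show False
        proof (cases "W \<in> \<sigma>")
          case W': True
          show False using noncrossingD[OF NC_D(4)[OF s]] True W' ne o m by blast
        next
          case False
          have "a < p" "r < c" using f(1)[OF True] m by auto
          then show False using out[of W q] W False m o by auto
        qed
      next
        case False
        show False
        proof (cases "W \<in> \<sigma>")
          case True
          have "a < q" "s' < c" using f(1)[OF True] m by auto
          then show False using out[of V r] V False m o by auto
        next
          case W': False
          consider "V \<in> others \<tau> c" "W \<in> others \<tau> c" | "V \<in> others \<tau> c" "W = insert a ?T"
            | "V = insert a ?T" "W \<in> others \<tau> c" using V W False W' ne by blast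
          then show False
          proof cases
            case 1
            then show False using f(2) noncrossingD[OF NC_D(4)[OF t]] ne o m by blast
          next
            case 2
            then have "c < p" using f(2)[of V] m by auto
            then have "q \<in> ?T" "s' \<in> ?T" using 2 m o ac by auto
            moreover have "?T \<in> \<tau>" using calculation f(4,5) ac(2) by (metis empty_iff le_neq_implies_less)
            ultimately show False using f(2)[OF 2(1)] noncrossingD[OF NC_D(4)[OF t]] o m by blast
          next
            case 3
            then have q: "c < q" using f(2)[of W] m by auto
            then have r: "r \<in> ?T" using 3 m o ac by auto
            then have "c < b" using f(3) q o by auto
            then have T: "c \<in> ?T" "?T \<in> \<tau>" using f(4) by auto
            show False using f(2)[OF 3(2)] noncrossingD[OF NC_D(4)[OF t]] T q r o m by blast
          qed
        qed
      qed
    qed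
  qed
qed

lemma unglue_glue:
  assumes ac: "a < c" "c \<le> b" and s: "\<sigma> \<in> NC (Suc a) c" and t: "\<tau> \<in> NC c b"
  shows "unglue a b (glue a (c, \<sigma>, \<tau>)) = (c, \<sigma>, \<tau>)"
proof -
  note f = glue_facts[OF assms]
  let ?T = "blk \<tau> c"
  have 1: "blk (glue a (c, \<sigma>, \<tau>)) a = insert a ?T"
    by (rule blk_eq[OF glue_NC[OF assms]]) (auto simp: glue_def)
  have a: "a \<notin> ?T" using f(3) ac by auto
  have fin: "finite ?T" using f(3) finite_subset by blast
  have 2: "Min (insert b (insert a ?T - {a})) = c"
  proof (cases "c < b")
    case True
    then show ?thesis using a fin f(3,4) by (intro Min_eqI) auto
  next
    case False
    then show ?thesis using f(5) ac by simp
  qed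
  have 3: "{T \<in> glue a (c, \<sigma>, \<tau>). T \<subseteq> {Suc a..<c}} = \<sigma>"
    using f(1,2) ac unfolding glue_def by fastforce
  have 4: "{T \<in> glue a (c, \<sigma>, \<tau>). T \<subseteq> {c..<b}} = others \<tau> c"
  proof -
    have "\<not> T \<subseteq> {c..<b}" if "T \<in> \<sigma>" for T using f(1)[OF that] by fastforce
    moreover have "T \<subseteq> {c..<b}" if "T \<in> others \<tau> c" for T using f(2)[OF that] by auto
    moreover have "\<not> insert a ?T \<subseteq> {c..<b}" using ac by auto
    ultimately show ?thesis unfolding glue_def by blast
  qed
  have 5: "insert a ?T - {a} = ?T" using a by auto
  show ?thesis unfolding unglue_def Let_def 1 2 3 4 unfolding 5 using f(6) by simp
qed

text \<open>Since \<open>a\<close> and \<open>c\<close> lie in the same block, a further block with elements on both sides of \<open>c\<close> would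
  cross it. Hence the blocks on the two sides of \<open>c\<close> form two non-crossing partitions.\<close>

lemma unglue_facts:
  assumes p: "\<pi> \<in> NC a b" and ab: "a < b"
  obtains c \<sigma> \<tau> where "unglue a b \<pi> = (c, \<sigma>, \<tau>)" "a < c" "c \<le> b" "\<sigma> \<in> NC (Suc a) c" "\<tau> \<in> NC c b"
    "glue a (c, \<sigma>, \<tau>) = \<pi>"
proof -
  define B where "B = blk \<pi> a"
  define c where "c = Min (insert b (B - {a}))"
  define \<sigma> where "\<sigma> = {T\<in>\<pi>. T \<subseteq> {Suc a..<c}}"
  define \<tau> where "\<tau> = {T\<in>\<pi>. T \<subseteq> {c..<b}} \<union> ({B - {a}} - {{}})"
  have B: "B \<in> \<pi>" "a \<in> B" using blk_in[OF p _ ab] by (auto simp: B_def)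
  have Bsub: "B \<subseteq> {a..<b}" using B NC_D(1)[OF p] by auto
  have finB: "finite (insert b (B - {a}))" using Bsub finite_subset by auto
  have cin: "c \<in> insert b (B - {a})" unfolding c_def using finB by (intro Min_in) auto
  have cle: "c \<le> x" if "x \<in> insert b (B - {a})" for x unfolding c_def using finB that by (rule Min_le)
  have ac: "a < c" "c \<le> b" using cin cle Bsub ab by auto
  have Brest: "B - {a} \<subseteq> {c..<b}" proof
    fix x assume "x \<in> B - {a}"
    then show "x \<in> {c..<b}" using cle[of x] Bsub by auto
  qed
  \<comment> \<open>No other block has elements on both sides of \<open>c\<close>.\<close>
  have dich: "T \<subseteq> {Suc a..<c} \<or> T \<subseteq> {Suc c..<b}" if T: "T \<in> \<pi>" "T \<noteq> B" for T
  proof -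
    have sub: "T \<subseteq> {a..<b}" using T NC_D(1)[OF p] by auto
    have aT: "a \<notin> T" and cT: "c \<notin> T" 
    proof -
      show "a \<notin> T" using NC_D(3)[OF p T(1) B(1)] T B by blast
      show "c \<notin> T"
      proof
        assume "c \<in> T"
        then have "c \<in> B" using cin sub by auto
        then show False using NC_D(3)[OF p T(1) B(1)] T \<open>c \<in> T\<close> by blast
      qed
    qed
    show ?thesis
    proof (rule ccontr)
      assume "\<not> ?thesis"
      then obtain x y where xy: "x \<in> T" "y \<in> T" "x \<notin> {Suc a..<c}" "y \<notin> {Suc c..<b}" by blast
      have "x \<noteq> a" "x \<noteq> c" "y \<noteq> a" "y \<noteq> c" using aT cT xy by auto
      then have o: "a < y" "y < c" "c < x" "x < b" using xy sub by auto
      then have "c \<in> B" using cin by auto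
      then show False using noncrossingD[OF NC_D(4)[OF p]] B T xy o by blast
    qed
  qed
  have B_notsub: "\<not> B \<subseteq> {Suc a..<c}" "\<not> B \<subseteq> {c..<b}" using B ac by auto
  have disj: "\<And>V W x. V \<in> \<pi> \<Longrightarrow> W \<in> \<pi> \<Longrightarrow> x \<in> V \<Longrightarrow> x \<in> W \<Longrightarrow> V = W" by (rule NC_D(3)[OF p])
  have cover: "x \<in> {a..<b} \<longleftrightarrow> (\<exists>T\<in>\<pi>. x \<in> T)" for x using NC_D(1)[OF p] by auto
  have s: "\<sigma> \<in> NC (Suc a) c"
  proof (rule NC_I)
    show "\<Union>\<sigma> = {Suc a..<c}"
    proof
      show "\<Union>\<sigma> \<subseteq> {Suc a..<c}" by (auto simp: \<sigma>_def)
      show "{Suc a..<c} \<subseteq> \<Union>\<sigma>"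
      proof
        fix x assume x: "x \<in> {Suc a..<c}"
        then have "x \<in> {a..<b}" using ac by auto
        then obtain T where T: "T \<in> \<pi>" "x \<in> T" using cover by auto
        have "T \<noteq> B" using T x Brest by auto
        then have "T \<subseteq> {Suc a..<c}" using dich[OF T(1)] T x by auto
        then show "x \<in> \<Union>\<sigma>" using T by (auto simp: \<sigma>_def)
      qed
    qed
    show "{} \<notin> \<sigma>" using NC_D(2)[OF p] by (auto simp: \<sigma>_def)
    show "\<And>V W x. V \<in> \<sigma> \<Longrightarrow> W \<in> \<sigma> \<Longrightarrow> x \<in> V \<Longrightarrow> x \<in> W \<Longrightarrow> V = W" unfolding \<sigma>_def using disj by blast
    show "noncrossing \<sigma>" using NC_D(4)[OF p] unfolding noncrossing_def \<sigma>_def by blast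
  qed
  have t: "\<tau> \<in> NC c b"
  proof (rule NC_I)
    show "\<Union>\<tau> = {c..<b}"
    proof
      show "\<Union>\<tau> \<subseteq> {c..<b}" using Brest by (auto simp: \<tau>_def)
      show "{c..<b} \<subseteq> \<Union>\<tau>"
      proof
        fix x assume x: "x \<in> {c..<b}"
        then have "x \<in> {a..<b}" using ac by auto
        then obtain T where T: "T \<in> \<pi>" "x \<in> T" using cover by auto
        show "x \<in> \<Union>\<tau>"
        proof (cases "T = B")
          case True
          then have "x \<in> B - {a}" using T x ac by auto
          then show ?thesis by (auto simp: \<tau>_def)
        next
          case False
          then have "T \<subseteq> {Suc c..<b}" using dich[OF T(1)] T x by auto
          then have "T \<subseteq> {c..<b}" by auto
          then show ?thesis using T by (auto simp: \<tau>_def)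
        qed
      qed
    qed
    show "{} \<notin> \<tau>" using NC_D(2)[OF p] by (auto simp: \<tau>_def)
    have BT: "T = B" if "T \<in> \<pi>" "x \<in> T" "x \<in> B" for T x using disj[OF that(1) B(1) that(2,3)] .
    show "V = W" if "V \<in> \<tau>" "W \<in> \<tau>" "x \<in> V" "x \<in> W" for V W x
      using that disj BT B_notsub(2) unfolding \<tau>_def by blast
    show "noncrossing \<tau>"
    proof (rule noncrossingI)
      fix V W p' q r s'
      assume V: "V \<in> \<tau>" and W: "W \<in> \<tau>" and ne: "V \<noteq> W" and o: "p' < q" "q < r" "r < s'"
        and m: "p' \<in> V" "r \<in> V" "q \<in> W" "s' \<in> W"
      obtain V' where V': "V' \<in> \<pi>" "V \<subseteq> V'" "V' = V \<or> V = B - {a} \<and> V' = B"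
        using V B by (auto simp: \<tau>_def)
      obtain W' where W': "W' \<in> \<pi>" "W \<subseteq> W'" "W' = W \<or> W = B - {a} \<and> W' = B"
        using W B by (auto simp: \<tau>_def)
      have "V' \<noteq> W'" using V'(3) W'(3) ne V W B_notsub(2) unfolding \<tau>_def by blast
      then show False using noncrossingD[OF NC_D(4)[OF p]] V' W' o m by blast
    qed
  qed
  have bt: "blk \<tau> c = B - {a}"
  proof (cases "c = b")
    case True
    then show ?thesis using blk_notin[OF t] Brest by auto
  next
    case False
    then have "c \<in> B - {a}" using cin by auto
    then show ?thesis by (intro blk_eq[OF t]) (auto simp: \<tau>_def)
  qed
  have ot: "others \<tau> c = {T\<in>\<pi>. T \<subseteq> {c..<b}}"
  proof -
    have "c \<notin> T" if "T \<in> \<pi>" "T \<subseteq> {c..<b}" for T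
    proof -
      have "T \<noteq> B" using that B_notsub by auto
      then show ?thesis using dich[OF that(1)] ac by fastforce
    qed
    moreover have "c \<in> B - {a}" if ne: "B - {a} \<noteq> {}"
    proof -
      obtain x where "x \<in> B - {a}" using ne by blast
      then have "c < b" using Brest cle by fastforce
      then show ?thesis using cin by auto
    qed
    ultimately show ?thesis unfolding others_def \<tau>_def by blast
  qed
  have "glue a (c, \<sigma>, \<tau>) = \<pi>"
  proof -
    have i: "insert a (B - {a}) = B" using B by auto
    have "T \<subseteq> {Suc a..<c} \<or> T \<subseteq> {c..<b}" if "T \<in> \<pi>" "T \<noteq> B" for T
      using dich[OF that] by fastforce
    then show ?thesis unfolding glue_def prod.case bt ot \<sigma>_def i using B by blast
  qed
  moreover have "unglue a b \<pi> = (c, \<sigma>, \<tau>)"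
    unfolding unglue_def Let_def B_def[symmetric] c_def[symmetric] \<sigma>_def \<tau>_def by simp
  ultimately show ?thesis using that ac s t by blast
qed

section \<open>Weighted sums over non-crossing partitions\<close>

text \<open>The block of the first point gets its own weight \<open>f\<close>, which is what makes the recursion close up:
  removing the first point shifts \<open>f\<close> and leaves the other blocks alone. For an empty interval the
  value is \<open>f 0\<close>.\<close>

definition nc_weight :: "(nat \<Rightarrow> complex) \<Rightarrow> (nat \<Rightarrow> complex) \<Rightarrow> nat \<Rightarrow> nat \<Rightarrow> complex" where
  "nc_weight \<kappa> f a b = (\<Sum>\<pi>\<in>NC a b. f (card (blk \<pi> a)) * (\<Prod>W\<in>others \<pi> a. \<kappa> (card W)))"

lemma nc_weight_self:
  assumes "\<kappa> 0 = 1"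
  shows "nc_weight \<kappa> \<kappa> a b = (\<Sum>\<pi>\<in>NC a b. \<Prod>W\<in>\<pi>. \<kappa> (card W))"
proof (cases "a < b")
  case True
  show ?thesis unfolding nc_weight_def
  proof (rule sum.cong)
    fix \<pi> assume p: "\<pi> \<in> NC a b"
    have "(\<Prod>W\<in>insert (blk \<pi> a) (others \<pi> a). \<kappa> (card W)) = \<kappa> (card (blk \<pi> a)) * (\<Prod>W\<in>others \<pi> a. \<kappa> (card W))"
      using NC_finite(1)[OF p] blk_in[OF p _ True] by (subst prod.insert) (auto simp: others_def)
    then show "\<kappa> (card (blk \<pi> a)) * (\<Prod>W\<in>others \<pi> a. \<kappa> (card W)) = (\<Prod>W\<in>\<pi>. \<kappa> (card W))"
      using others_eq(2)[OF p _ True] by simp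
  qed simp
next
  case False
  then show ?thesis using assms by (simp add: nc_weight_def NC_empty blk_def others_def)
qed

lemma nc_weight_rec:
  assumes "a < b" "\<kappa> 0 = 1"
  shows "nc_weight \<kappa> f a b = (\<Sum>c\<in>{Suc a..b}. nc_weight \<kappa> \<kappa> (Suc a) c * nc_weight \<kappa> (\<lambda>i. f (Suc i)) c b)"
proof -
  let ?Y = "Sigma {Suc a..b} (\<lambda>c. NC (Suc a) c \<times> NC c b)"
  let ?w = "\<lambda>(c, \<sigma>, \<tau>). (\<Prod>W\<in>\<sigma>. \<kappa> (card W)) * (f (Suc (card (blk \<tau> c))) * (\<Prod>W\<in>others \<tau> c. \<kappa> (card W)))"
  have "nc_weight \<kappa> f a b = (\<Sum>y\<in>?Y. ?w y)"
    unfolding nc_weight_def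
  proof (rule sum.reindex_bij_witness[where i="glue a" and j="unglue a b"])
    fix \<pi> assume p: "\<pi> \<in> NC a b"
    obtain c \<sigma> \<tau> where u: "unglue a b \<pi> = (c, \<sigma>, \<tau>)" "a < c" "c \<le> b" "\<sigma> \<in> NC (Suc a) c" "\<tau> \<in> NC c b"
      "glue a (c, \<sigma>, \<tau>) = \<pi>" using unglue_facts[OF p assms(1)] .
    show "glue a (unglue a b \<pi>) = \<pi>" "unglue a b \<pi> \<in> ?Y" using u by auto
    note g = glue_facts[OF u(2-5)]
    have aT: "a \<notin> blk \<tau> c" using g(3) u by auto
    have "blk \<pi> a = insert a (blk \<tau> c)" using u(6) by (intro blk_eq[OF p]) (auto simp: glue_def)
    moreover have "card (insert a (blk \<tau> c)) = Suc (card (blk \<tau> c))"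
      using aT g(3) finite_subset by (subst card_insert_disjoint) auto
    moreover have "others \<pi> a = \<sigma> \<union> others \<tau> c"
    proof -
      have "a \<notin> T" if "T \<in> \<sigma> \<union> others \<tau> c" for T
        using that g(1)[of T] g(2)[of T] u(2) by fastforce
      moreover have "\<pi> = \<sigma> \<union> others \<tau> c \<union> {insert a (blk \<tau> c)}"
        using u(6) by (simp add: glue_def)
      ultimately show ?thesis unfolding others_def[of \<pi>] by blast
    qed
    moreover have "(\<Prod>W\<in>\<sigma> \<union> others \<tau> c. \<kappa> (card W)) = (\<Prod>W\<in>\<sigma>. \<kappa> (card W)) * (\<Prod>W\<in>others \<tau> c. \<kappa> (card W))"
    proof (rule prod.union_disjoint)
      show "finite \<sigma>" by (rule NC_finite(1)[OF u(4)])
      show "finite (others \<tau> c)" using NC_finite(1)[OF u(5)] by (auto simp: others_def)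
      show "\<sigma> \<inter> others \<tau> c = {}" using g(1,2) by fastforce
    qed
    ultimately show "?w (unglue a b \<pi>) = f (card (blk \<pi> a)) * (\<Prod>W\<in>others \<pi> a. \<kappa> (card W))"
      using u(1) by simp
  next
    fix y assume "y \<in> ?Y"
    then obtain c \<sigma> \<tau> where y: "y = (c, \<sigma>, \<tau>)" "a < c" "c \<le> b" "\<sigma> \<in> NC (Suc a) c" "\<tau> \<in> NC c b"
      by auto
    show "unglue a b (glue a y) = y" "glue a y \<in> NC a b"
      unfolding y(1) using unglue_glue[OF y(2-5)] glue_NC[OF y(2-5)] by auto
  qed
  also have "\<dots> = (\<Sum>c\<in>{Suc a..b}. \<Sum>(\<sigma>, \<tau>)\<in>NC (Suc a) c \<times> NC c b. ?w (c, \<sigma>, \<tau>))"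
    by (subst sum.Sigma) (auto simp: case_prod_unfold)
  also have "\<dots> = (\<Sum>c\<in>{Suc a..b}. nc_weight \<kappa> \<kappa> (Suc a) c * nc_weight \<kappa> (\<lambda>i. f (Suc i)) c b)"
    unfolding nc_weight_self[where \<kappa>=\<kappa>, OF assms(2)] unfolding nc_weight_def
    by (simp add: sum_product sum.cartesian_product)
  finally show ?thesis .
qed

text \<open>The recursion of \<open>nc_weight\<close> in terms of the length of the interval.\<close>

fun ncw :: "(nat \<Rightarrow> complex) \<Rightarrow> (nat \<Rightarrow> complex) \<Rightarrow> nat \<Rightarrow> complex" where
  "ncw \<kappa> f 0 = f 0"
| "ncw \<kappa> f (Suc n) = (\<Sum>g\<le>n. ncw \<kappa> \<kappa> g * ncw \<kappa> (\<lambda>i. f (Suc i)) (n - g))"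

lemma nc_weight_ncw: "\<kappa> 0 = 1 \<Longrightarrow> nc_weight \<kappa> f a (a + n) = ncw \<kappa> f n"
proof (induction n arbitrary: a f rule: less_induct)
  case (less n)
  show ?case
  proof (cases n)
    case 0
    then show ?thesis by (simp add: nc_weight_def NC_empty blk_def others_def)
  next
    case (Suc m)
    have "nc_weight \<kappa> f a (a + n) = (\<Sum>c\<in>{Suc a..a + n}. nc_weight \<kappa> \<kappa> (Suc a) c * nc_weight \<kappa> (\<lambda>i. f (Suc i)) c (a + n))"
      using Suc less.prems by (intro nc_weight_rec) auto
    also have "\<dots> = (\<Sum>g\<le>m. ncw \<kappa> \<kappa> g * ncw \<kappa> (\<lambda>i. f (Suc i)) (m - g))"
    proof (rule sum.reindex_bij_witness[where i="\<lambda>g. Suc a + g" and j="\<lambda>c. c - Suc a"])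
      fix c assume c: "c \<in> {Suc a..a + n}"
      define g where "g = c - Suc a"
      have "c = Suc a + g" "a + n = c + (m - g)" "g < n" "m - g < n" using c Suc by (auto simp: g_def)
      then show "ncw \<kappa> \<kappa> (c - Suc a) * ncw \<kappa> (\<lambda>i. f (Suc i)) (m - (c - Suc a)) =
         nc_weight \<kappa> \<kappa> (Suc a) c * nc_weight \<kappa> (\<lambda>i. f (Suc i)) c (a + n)"
        using less.IH[OF \<open>g < n\<close> less.prems, of \<kappa> "Suc a"]
          less.IH[OF \<open>m - g < n\<close> less.prems, of "\<lambda>i. f (Suc i)" c]
        unfolding g_def[symmetric] \<open>a + n = c + (m - g)\<close> by (simp only: \<open>c = Suc a + g\<close>)
    qed (use Suc in auto)
    finally show ?thesis using Suc by simp
  qed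
qed

lemma noncrossing_partitions_NC: "noncrossing_partitions k = NC 1 (1 + k)"
proof -
  have "{1..k} = {1..<1 + k}" by auto
  then show ?thesis unfolding noncrossing_partitions_def NC_def noncrossing_def by simp
qed

lemma ncw_moment:
  "\<kappa> 0 = 1 \<Longrightarrow> (\<Sum>\<pi>\<in>noncrossing_partitions k. \<Prod>W\<in>\<pi>. \<kappa> (card W)) = ncw \<kappa> \<kappa> k"
  using nc_weight_ncw[of \<kappa> \<kappa> 1 k] nc_weight_self[of \<kappa> 1 "1 + k"] noncrossing_partitions_NC by simp

section \<open>Lagrange inversion and first-order variation of cumulants\<close>

text \<open>The change of variables \<open>x = g(t)\<close> in the residue of \<open>P(x) / x\<^bsup>n+1\<^esup>\<close>. After splitting off the constant
  term of \<open>P\<close> repeatedly there remain \<open>g'/g\<close>, whose residue is the order of \<open>g\<close>, and \<open>g'/g\<^bsup>n+2\<^esup>\<close>, which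
  is a derivative and so has residue \<open>0\<close>.\<close>

lemma residue_substitution:
  fixes P g :: "complex fps"
  assumes g0: "fps_nth g 0 = 0" and g1: "fps_nth g 1 \<noteq> 0"
  shows "fls_residue (fps_to_fls ((P oo g) * fps_deriv g) * inverse (fps_to_fls g) ^ Suc n) = fps_nth P n"
proof (induction n arbitrary: P)
  case (0 P)
  define G where "G = fps_to_fls g"
  have split: "P = fps_const (fps_nth P 0) + fps_X * fps_shift 1 P"
    by (simp add: fps_eq_iff fps_X_mult_nth) 
  have "(P oo g) = fps_const (fps_nth P 0) + g * (fps_shift 1 P oo g)"
    using g0 by (subst split) (simp add: fps_compose_add_distrib fps_compose_mult_distrib)
  moreover have "G * inverse G = 1" using g1 unfolding G_def
    by (intro right_inverse) (metis fps_to_fls_eq_0_iff fps_zero_nth)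
  ultimately have "fps_to_fls ((P oo g) * fps_deriv g) * inverse G ^ Suc 0 =
     fls_const (fps_nth P 0) * (fls_deriv G * inverse G) + fps_to_fls ((fps_shift 1 P oo g) * fps_deriv g)"
    by (simp add: G_def fls_times_fps_to_fls fls_deriv_fps_to_fls algebra_simps)
  moreover have "subdegree g = 1" using g0 g1 by (intro subdegreeI) auto
  then have "fls_residue (fls_deriv G * inverse G) = 1"
    by (subst fls_residue_deriv_times_inverse_eq_subdegree) (simp add: G_def fls_subdegree_fls_to_fps)
  ultimately show ?case
    by (simp only: G_def fls_residue_add fls_residue_fls_const_times) simp
next
  case (Suc n P)
  define G where "G = fps_to_fls g"
  define J where "J = inverse G"
  have GJ: "G * J = 1" using g1 unfolding G_def J_def
    by (intro right_inverse) (metis fps_to_fls_eq_0_iff fps_zero_nth)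
  have split: "P = fps_const (fps_nth P 0) + fps_X * fps_shift 1 P"
    by (simp add: fps_eq_iff fps_X_mult_nth)
  have "(P oo g) = fps_const (fps_nth P 0) + g * (fps_shift 1 P oo g)"
    using g0 by (subst split) (simp add: fps_compose_add_distrib fps_compose_mult_distrib)
  then have "fps_to_fls ((P oo g) * fps_deriv g) * J ^ Suc (Suc n) =
     fls_const (fps_nth P 0) * (fls_deriv G * J ^ Suc (Suc n)) +
     (G * J) * (fps_to_fls ((fps_shift 1 P oo g) * fps_deriv g) * J ^ Suc n)"
    by (simp add: G_def fls_times_fps_to_fls fls_deriv_fps_to_fls algebra_simps)
  moreover have "fls_residue (fls_deriv G * J ^ Suc (Suc n)) = 0"
  proof -
    have "fls_deriv G * J + G * fls_deriv J = 0"
      using arg_cong[OF GJ, of fls_deriv] by (simp add: algebra_simps)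
    then have "J * (fls_deriv G * J + G * fls_deriv J) = 0" by simp
    then have "fls_deriv G * J ^ 2 + (G * J) * fls_deriv J = 0"
      by (simp only: distrib_left power2_eq_square mult_ac)
    then have J': "fls_deriv J = - (fls_deriv G * J ^ 2)"
      unfolding GJ by (simp add: eq_neg_iff_add_eq_0 add.commute)
    have "fls_deriv (J ^ Suc n) = of_nat (Suc n) * (fls_deriv J * J ^ n)"
      by (subst fls_deriv_power) (simp add: mult_ac)
    also have "\<dots> = of_int (- int (Suc n)) * (fls_deriv G * J ^ Suc (Suc n))"
      by (simp add: J' power2_eq_square algebra_simps)
    finally have "of_int (- int (Suc n)) * fls_residue (fls_deriv G * J ^ Suc (Suc n)) = 0"
      using fls_residue_deriv[of "J ^ Suc n"] by (simp only: fls_residue_of_int_times)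
    then show ?thesis by (simp only: mult_eq_0_iff of_int_eq_0_iff) auto
  qed
  moreover have "fls_residue (fps_to_fls ((fps_shift 1 P oo g) * fps_deriv g) * J ^ Suc n) = fps_nth (fps_shift 1 P) n"
    unfolding J_def G_def by (rule Suc.IH)
  ultimately show ?case
    unfolding G_def[symmetric] J_def[symmetric]
    by (simp only: fls_residue_add fls_residue_fls_const_times GJ mult_1) simp
qed

text \<open>The functional equation \<open>M(x) = K(x M(x))\<close> in a form with general \<open>f\<close> that can be proved by
  induction.\<close>

lemma ncw_compose:
  assumes k0: "\<kappa> 0 = 1"
  shows "ncw \<kappa> f n = fps_nth (Abs_fps f oo (fps_X * Abs_fps (ncw \<kappa> \<kappa>))) n"
proof (induction n arbitrary: f rule: less_induct)
  case (less n)
  let ?M = "Abs_fps (ncw \<kappa> \<kappa>)"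
  show ?case
  proof (cases n)
    case (Suc m)
    have split: "Abs_fps f = fps_const (f 0) + fps_X * Abs_fps (\<lambda>i. f (Suc i))"
      by (auto simp: fps_eq_iff fps_X_mult_nth)
    have "Abs_fps f oo (fps_X * ?M) = fps_const (f 0) + (fps_X * ?M) * (Abs_fps (\<lambda>i. f (Suc i)) oo (fps_X * ?M))"
      by (subst split) (simp add: fps_compose_add_distrib fps_compose_mult_distrib)
    then have "fps_nth (Abs_fps f oo (fps_X * ?M)) n = fps_nth (?M * (Abs_fps (\<lambda>i. f (Suc i)) oo (fps_X * ?M))) m"
      using Suc by (simp add: mult.assoc fps_X_mult_nth)
    also have "\<dots> = (\<Sum>g\<le>m. ncw \<kappa> \<kappa> g * ncw \<kappa> (\<lambda>i. f (Suc i)) (m - g))"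
      unfolding fps_mult_nth atLeast0AtMost
      by (intro sum.cong refl arg_cong2[where f="(*)"]) (use less Suc in auto)
    finally show ?thesis using Suc by simp
  qed simp
qed

text \<open>Lagrange inversion: in the residue of \<open>K(y)\<^bsup>k+1\<^esup> / y\<^bsup>k+1\<^esup>\<close> substitute \<open>y = x M(x)\<close>, for which
  \<open>K(y) / y = 1 / x\<close>.\<close>

lemma ncw_lagrange:
  assumes k0: "\<kappa> 0 = 1"
  shows "of_nat (Suc k) * ncw \<kappa> \<kappa> k = fps_nth (Abs_fps \<kappa> ^ Suc k) k"
proof -
  let ?M = "Abs_fps (ncw \<kappa> \<kappa>)" and ?K = "Abs_fps \<kappa>"
  define y where "y = fps_X * ?M"
  have KM: "?K oo y = ?M"
    using ncw_compose[of \<kappa> \<kappa>] k0 by (simp add: fps_eq_iff y_def)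
  have M0: "?M \<noteq> 0" using k0 by (metis fps_nth_Abs_fps fps_zero_nth ncw.simps(1) zero_neq_one)
  have "fps_nth (?K ^ Suc k) k =
      fls_residue (fps_to_fls ((?K ^ Suc k oo y) * fps_deriv y) * inverse (fps_to_fls y) ^ Suc k)"
    by (rule residue_substitution[symmetric]) (simp_all add: y_def fps_X_mult_nth k0)
  also have "(?K ^ Suc k oo y) = ?M ^ Suc k"
  proof -
    have "fps_nth y 0 = 0" by (simp add: y_def)
    then show ?thesis by (simp only: fps_compose_power[symmetric] KM)
  qed
  also have "fps_to_fls (?M ^ Suc k * fps_deriv y) * inverse (fps_to_fls y) ^ Suc k =
      (fps_to_fls ?M * inverse (fps_to_fls ?M)) ^ Suc k * (fls_X_inv ^ Suc k * fps_to_fls (fps_deriv y))"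
    by (simp only: y_def fls_times_fps_to_fls fps_to_fls_power fps_X_to_fls inverse_mult_distrib
        power_mult_distrib fls_inverse_X) (simp only: algebra_simps)
  also have "\<dots> = fls_X_inv ^ Suc k * fps_to_fls (fps_deriv y)"
    using M0 by simp
  also have "fls_residue \<dots> = fps_nth (fps_deriv y) k"
    by (simp only: fls_residue_def fls_X_inv_power_times_conv_shift) simp
  also have "\<dots> = of_nat (Suc k) * ncw \<kappa> \<kappa> k" by (simp add: y_def fps_X_mult_nth algebra_simps)
  finally show ?thesis ..
qed

lemma nc_moment_formula:
  fixes \<kappa> :: "nat \<Rightarrow> complex"
  assumes "\<kappa> 0 = 1"
  shows "of_nat (Suc k) * (\<Sum>\<pi>\<in>noncrossing_partitions k. \<Prod>W\<in>\<pi>. \<kappa> (card W)) = fps_nth (Abs_fps \<kappa> ^ Suc k) k"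
  using ncw_lagrange[where \<kappa>=\<kappa> and k=k, OF assms] ncw_moment[where \<kappa>=\<kappa> and k=k, OF assms] by simp

lemma deriv_prod_linear:
  fixes a b :: "'x \<Rightarrow> complex"
  assumes "finite S"
  shows "((\<lambda>e. \<Prod>x\<in>S. a x + e * b x) has_field_derivative (\<Sum>x\<in>S. b x * (\<Prod>y\<in>S - {x}. a y))) (at 0)"
  using assms
proof (induction S rule: finite_induct)
  case (insert x S)
  have 1: "((\<lambda>e. a x + e * b x) has_field_derivative b x) (at 0)"
    by (auto intro!: derivative_eq_intros)
  have "((\<lambda>e. (a x + e * b x) * (\<Prod>x\<in>S. a x + e * b x)) has_field_derivative
     b x * (\<Prod>x\<in>S. a x) + (\<Sum>x\<in>S. b x * (\<Prod>y\<in>S - {x}. a y)) * a x) (at 0)"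
    using DERIV_mult[OF 1 insert.IH] by simp
  moreover have "(\<Sum>z\<in>insert x S. b z * (\<Prod>y\<in>insert x S - {z}. a y)) =
     b x * (\<Prod>x\<in>S. a x) + (\<Sum>x\<in>S. b x * (\<Prod>y\<in>S - {x}. a y)) * a x"
  proof -
    have "(\<Prod>y\<in>insert x S - {z}. a y) = a x * (\<Prod>y\<in>S - {z}. a y)" if "z \<in> S" for z
    proof -
      have "insert x S - {z} = insert x (S - {z})" using insert that by auto
      then show ?thesis using insert by simp
    qed
    moreover have "insert x S - {x} = S" using insert by auto
    ultimately show ?thesis using insert by (simp add: sum_distrib_left sum_distrib_right algebra_simps)
  qed
  ultimately show ?case using insert by simp
qed auto

text \<open>The derivative at \<open>e = 0\<close> of the moment formula for the cumulants \<open>a + e b\<close>. On the series side the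
  derivative of \<open>K\<^bsup>k+1\<^esup>\<close> cancels the factor \<open>k + 1\<close>.\<close>

lemma nc_first_order:
  fixes a b :: "nat \<Rightarrow> complex"
  defines "C \<equiv> Abs_fps (\<lambda>n. if n = 0 then 1 else a n)" and "B \<equiv> Abs_fps (\<lambda>n. if n = 0 then 0 else b n)"
  shows "(\<Sum>\<pi>\<in>noncrossing_partitions k. \<Sum>V\<in>\<pi>. b (card V) * (\<Prod>W\<in>\<pi> - {V}. a (card W))) = fps_nth (C ^ k * B) k"
proof -
  define \<kappa> where "\<kappa> e n = (if n = 0 then 1 else a n + e * b n)" for e n
  have fin: "finite \<pi>" "\<And>W. W \<in> \<pi> \<Longrightarrow> card W \<noteq> 0" if "\<pi> \<in> noncrossing_partitions k" for \<pi>
  proof -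
    have p: "\<pi> \<in> NC 1 (1 + k)" using that by (simp add: noncrossing_partitions_NC)
    show "finite \<pi>" by (rule NC_finite(1)[OF p])
    show "card W \<noteq> 0" if "W \<in> \<pi>" for W
    proof -
      have "finite W" "W \<noteq> {}" using NC_finite(2)[OF p that] NC_D(2)[OF p] that by auto
      then show ?thesis by simp
    qed
  qed
  have lhs: "(\<Sum>\<pi>\<in>noncrossing_partitions k. \<Prod>W\<in>\<pi>. \<kappa> e (card W)) =
      (\<Sum>\<pi>\<in>noncrossing_partitions k. \<Prod>W\<in>\<pi>. a (card W) + e * b (card W))" for e
    by (intro sum.cong prod.cong refl) (simp add: \<kappa>_def fin(2) del: card_0_eq card_eq_0_iff)
  have "((\<lambda>e. \<Sum>\<pi>\<in>noncrossing_partitions k. \<Prod>W\<in>\<pi>. a (card W) + e * b (card W)) has_field_derivative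
     (\<Sum>\<pi>\<in>noncrossing_partitions k. \<Sum>V\<in>\<pi>. b (card V) * (\<Prod>W\<in>\<pi> - {V}. a (card W)))) (at 0)"
    using fin by (intro DERIV_sum deriv_prod_linear) auto
  then have "((\<lambda>e. of_nat (Suc k) * (\<Sum>\<pi>\<in>noncrossing_partitions k. \<Prod>W\<in>\<pi>. \<kappa> e (card W))) has_field_derivative
     of_nat (Suc k) * (\<Sum>\<pi>\<in>noncrossing_partitions k. \<Sum>V\<in>\<pi>. b (card V) * (\<Prod>W\<in>\<pi> - {V}. a (card W)))) (at 0)"
    unfolding lhs by (rule DERIV_cmult)
  moreover have "of_nat (Suc k) * (\<Sum>\<pi>\<in>noncrossing_partitions k. \<Prod>W\<in>\<pi>. \<kappa> e (card W)) =
      (\<Sum>i\<le>Suc k. of_nat (Suc k choose i) * fps_nth (B ^ i * C ^ (Suc k - i)) k * e ^ i)" for e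
  proof -
    have "Abs_fps (\<kappa> e) = fps_const e * B + C"
      by (auto simp: fps_eq_iff \<kappa>_def B_def C_def)
    then have "Abs_fps (\<kappa> e) ^ Suc k = (\<Sum>i\<le>Suc k. of_nat (Suc k choose i) * (fps_const e * B) ^ i * C ^ (Suc k - i))"
      by (simp only: binomial_ring)
    moreover have "of_nat (Suc k choose i) * (fps_const e * B) ^ i * C ^ (Suc k - i) =
       fps_const (of_nat (Suc k choose i) * e ^ i) * (B ^ i * C ^ (Suc k - i))" for i
      by (simp add: power_mult_distrib fps_const_power fps_of_nat[symmetric] fps_const_mult[symmetric] algebra_simps del: fps_const_mult)
    ultimately have "fps_nth (Abs_fps (\<kappa> e) ^ Suc k) k =
      (\<Sum>i\<le>Suc k. of_nat (Suc k choose i) * fps_nth (B ^ i * C ^ (Suc k - i)) k * e ^ i)"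
      by (simp only: fps_sum_nth fps_mult_left_const_nth) (simp add: algebra_simps)
    then show ?thesis using nc_moment_formula[of "\<kappa> e" k] by (simp add: \<kappa>_def)
  qed
  moreover have "((\<lambda>e. \<Sum>i\<le>Suc k. of_nat (Suc k choose i) * fps_nth (B ^ i * C ^ (Suc k - i)) k * e ^ i) has_field_derivative
      of_nat (Suc k) * fps_nth (B * C ^ k) k) (at 0)"
  proof -
    have "((\<lambda>e. \<Sum>i\<le>Suc k. of_nat (Suc k choose i) * fps_nth (B ^ i * C ^ (Suc k - i)) k * e ^ i) has_field_derivative
      (\<Sum>i\<le>Suc k. of_nat (Suc k choose i) * fps_nth (B ^ i * C ^ (Suc k - i)) k * (of_nat i * 0 ^ (i - 1)))) (at 0)"
      by (intro DERIV_sum DERIV_cmult) (auto intro!: derivative_eq_intros)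
    also have "(\<Sum>i\<le>Suc k. of_nat (Suc k choose i) * fps_nth (B ^ i * C ^ (Suc k - i)) k * (of_nat i * 0 ^ (i - 1)))
      = (\<Sum>i\<le>Suc k. if i = 1 then of_nat (Suc k) * fps_nth (B * C ^ k) k else (0::complex))"
      by (intro sum.cong refl) (auto simp: power_0_left)
    also have "\<dots> = of_nat (Suc k) * fps_nth (B * C ^ k) k"
      by (simp only: sum.delta finite_atMost atMost_iff) simp
    finally show ?thesis .
  qed
  ultimately have eq: "of_nat (Suc k) * (\<Sum>\<pi>\<in>noncrossing_partitions k. \<Sum>V\<in>\<pi>. b (card V) * (\<Prod>W\<in>\<pi> - {V}. a (card W)))
     = of_nat (Suc k) * fps_nth (B * C ^ k) k"
    using DERIV_unique by (simp only:) blast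
  have "of_nat (Suc k) \<noteq> (0 :: complex)" by (simp only: of_nat_eq_0_iff)
  from iffD1[OF mult_left_cancel[OF this] eq] show ?thesis by (simp only: mult.commute[of B])
qed

section \<open>From cumulant series to derivatives at one\<close>

text \<open>With \<open>E = e\<^sup>u - 1\<close>, the summand \<open>log (E / u)\<close> of \<open>H\<close> is what makes \<open>1 + u H'\<close> a multiple of \<open>u / E\<close>:
  it is \<open>(u / E) E' W(E)\<close>. So the coefficient is a residue in which \<open>x = E(u)\<close> can be substituted,
  and \<open>E' = X(E)\<close> is the exponential function in the new variable.\<close>

lemma nc_series_change_variable:
  fixes S T Lg :: "complex fps"
  defines "E \<equiv> fps_exp 1 - 1"
  assumes Lg: "fps_deriv Lg * fps_shift 1 E = fps_deriv (fps_shift 1 E)"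
  defines "H \<equiv> (S oo E) + Lg" and "H1 \<equiv> (T oo E) - fps_const (1/2) * fps_X"
  defines "W \<equiv> 1 + fps_X * fps_deriv S" and "X \<equiv> 1 + fps_X"
  assumes k: "k = Suc n"
  shows "fps_nth ((1 + fps_X * fps_deriv H) ^ k * (fps_X * fps_deriv H1)) k =
    fps_nth (X ^ k * W ^ k * fps_deriv T) n - 1/2 * fps_nth (X ^ n * W ^ k) n"
proof -
  have E0: "fps_nth E 0 = 0" and E1: "fps_nth E 1 = 1" by (simp_all add: E_def)
  define E' where "E' = fps_deriv E"
  have E': "E' = X oo E" by (simp add: E'_def E_def X_def fps_compose_add_distrib E0[unfolded E_def])
  have Eshift: "E = fps_X * fps_shift 1 E"
    using E0 by (auto simp: fps_eq_iff fps_X_mult_nth)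
  have dE: "E' = fps_shift 1 E + fps_X * fps_deriv (fps_shift 1 E)"
    unfolding E'_def by (subst Eshift) (simp add: algebra_simps)
  define C where "C = 1 + fps_X * fps_deriv H"
  have H': "fps_deriv H = (fps_deriv S oo E) * E' + fps_deriv Lg"
    unfolding H_def E'_def using fps_compose_deriv[OF E0, of S] by simp
  have WE: "W oo E = 1 + E * (fps_deriv S oo E)"
    unfolding W_def using E0 by (simp add: fps_compose_add_distrib fps_compose_mult_distrib)
  \<comment> \<open>This is \<open>1 + u H' = (u / E) E' W(E)\<close> without denominators.\<close>
  have EC: "E * C = fps_X * (E' * (W oo E))"
  proof -
    have "E * (fps_X * fps_deriv Lg) = fps_X * (fps_X * (fps_deriv Lg * fps_shift 1 E))"
      by (subst Eshift) (simp only: mult_ac)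
    also have "\<dots> = fps_X * (E' - fps_shift 1 E)" by (simp only: Lg dE add_diff_cancel_left')
    also have "\<dots> = fps_X * E' - E" using Eshift by (simp add: algebra_simps)
    finally have "E * (fps_X * fps_deriv Lg) = fps_X * E' - E" .
    moreover have "E * C = E + E * (fps_X * fps_deriv Lg) + fps_X * (E * (fps_deriv S oo E) * E')"
      unfolding C_def H' by (simp add: algebra_simps)
    ultimately show ?thesis unfolding WE by (simp add: algebra_simps)
  qed
  define e where "e = fps_to_fls E"
  have e0: "e \<noteq> 0" using E1 by (auto simp: e_def)
  have ee: "e * inverse e = 1" using e0 by simp
  have Cfls: "fps_to_fls C = fls_X * (fps_to_fls (E' * (W oo E)) * inverse e)"
  proof -
    have "e * fps_to_fls C = fls_X * fps_to_fls (E' * (W oo E))"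
      using arg_cong[OF EC, of fps_to_fls] by (simp add: e_def fls_times_fps_to_fls)
    then have "inverse e * (e * fps_to_fls C) = fls_X * (fps_to_fls (E' * (W oo E)) * inverse e)"
      by (simp only: mult_ac)
    then show ?thesis using ee by (simp add: mult.assoc[symmetric] mult.commute)
  qed
  have res: "fls_residue ((A1 - fls_const c * A2) * J) = fls_residue (A1 * J) - c * fls_residue (A2 * J)"
    for A1 A2 J :: "complex fls" and c
  proof -
    have "(A1 - fls_const c * A2) * J = A1 * J - fls_const c * (A2 * J)" by (simp add: algebra_simps)
    then show ?thesis by simp
  qed
  define R where "R = fps_deriv H1"
  have R: "R = (fps_deriv T oo E) * E' - fps_const (1/2)"
    unfolding R_def H1_def E'_def using fps_compose_deriv[OF E0, of T] by simp
  have "fps_nth (C ^ k * (fps_X * R)) k = fps_nth (C ^ k * R) n"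
    unfolding k by (simp only: mult.left_commute[of _ fps_X] fps_X_mult_nth) simp
  also have "\<dots> = fls_residue (fls_X_inv ^ k * fps_to_fls (C ^ k * R))"
    by (simp only: k fls_residue_def fls_X_inv_power_times_conv_shift) simp
  also have "fls_X_inv ^ k * fps_to_fls (C ^ k * R) =
     (fls_X_inv * fls_X) ^ k * (fps_to_fls ((E' * (W oo E)) ^ k * R) * inverse e ^ k)"
    by (simp only: fls_times_fps_to_fls fps_to_fls_power Cfls power_mult_distrib) (simp only: mult_ac)
  also have "fls_X_inv * fls_X = (1 :: complex fls)" by (simp flip: fls_inverse_X)
  also have "(E' * (W oo E)) ^ k * R =
     ((X ^ k * W ^ k * fps_deriv T) oo E) * fps_deriv E - fps_const (1/2) * (((X ^ n * W ^ k) oo E) * fps_deriv E)"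
    unfolding R using E0
    by (simp add: fps_compose_mult_distrib fps_compose_power[symmetric] E'[symmetric] E'_def[symmetric] k
        power_mult_distrib algebra_simps)
  also have "fps_to_fls \<dots> = fps_to_fls (((X ^ k * W ^ k * fps_deriv T) oo E) * fps_deriv E)
     - fls_const (1/2) * fps_to_fls (((X ^ n * W ^ k) oo E) * fps_deriv E)"
    by (simp add: fls_times_fps_to_fls)
  also have "fls_residue (1 ^ k * (\<dots> * inverse e ^ k)) =
     fls_residue (fps_to_fls (((X ^ k * W ^ k * fps_deriv T) oo E) * fps_deriv E) * inverse e ^ Suc n)
     - 1/2 * fls_residue (fps_to_fls (((X ^ n * W ^ k) oo E) * fps_deriv E) * inverse e ^ Suc n)"
    unfolding k power_one mult_1 by (rule res)
  also have "\<dots> = fps_nth (X ^ k * W ^ k * fps_deriv T) n - 1/2 * fps_nth (X ^ n * W ^ k) n"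
    unfolding e_def using E0 E1 by (simp only: residue_substitution zero_neq_one[symmetric] not_False_eq_True)
  finally show ?thesis unfolding C_def R_def .
qed

lemma fps_nth_mult_binomial:
  fixes G P :: "complex fps"
  shows "fps_nth (G * (1 + fps_X * P) ^ Suc n) n =
    (\<Sum>j\<le>n. of_nat (Suc n choose Suc j) * fps_nth (G * P ^ (n - j)) j)"
proof -
  have "G * (1 + fps_X * P) ^ Suc n = (\<Sum>i\<le>Suc n. of_nat (Suc n choose i) * (fps_X ^ i * (G * P ^ i)))"
    using binomial_ring[of "fps_X * P" 1 "Suc n"]
    by (simp add: add.commute sum_distrib_left power_mult_distrib algebra_simps del: binomial_Suc_Suc power_Suc sum.atMost_Suc)
  then have "fps_nth (G * (1 + fps_X * P) ^ Suc n) n =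
      (\<Sum>i\<le>Suc n. of_nat (Suc n choose i) * (if n < i then 0 else fps_nth (G * P ^ i) (n - i)))"
    by (simp only: fps_sum_nth fps_mult_left_const_nth fps_of_nat[symmetric] fps_X_power_mult_nth)
  also have "\<dots> = (\<Sum>i\<le>n. of_nat (Suc n choose i) * fps_nth (G * P ^ i) (n - i))"
    by (simp del: binomial_Suc_Suc)
  also have "\<dots> = (\<Sum>j\<le>n. of_nat (Suc n choose Suc j) * fps_nth (G * P ^ (n - j)) j)"
  proof (rule sum.reindex_bij_witness[where i="\<lambda>j. n - j" and j="\<lambda>j. n - j"])
    fix i assume i: "i \<in> {..n}"
    then have "Suc n choose Suc (n - i) = Suc n choose i"
      using binomial_symmetric[of i "Suc n"] by (simp add: Suc_diff_le)
    then show "of_nat (Suc n choose Suc (n - i)) * fps_nth (G * P ^ (n - (n - i))) (n - i) =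
         of_nat (Suc n choose i) * fps_nth (G * P ^ i) (n - i)" using i by simp
  qed auto
  finally show ?thesis .
qed

lemma double_choose_two: "2 * (n choose 2) = n * (n - 1)"
proof -
  have "even (n * (n - 1))" by (cases n) auto
  then show ?thesis by (simp add: choose_two)
qed

text \<open>On the left is the second-order term that results from the expansions of the brackets, of
  \<open>C(N, j+1)\<close> and of \<open>z\<^sup>k\<close> in falling factorials; on the right is the residue form of the sum over
  non-crossing partitions. Differentiating \<open>X\<^sup>k P\<^bsup>n-j\<^esup>\<close> and comparing coefficients shows that the
  contributions with \<open>P'\<close> cancel, and what is left of the others is the term with the factor \<open>1/2\<close>.\<close>

lemma second_order_coefficient:
  fixes P F :: "complex fps"
  defines "X \<equiv> 1 + fps_X :: complex fps"
  assumes k: "k = Suc n"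
  shows "(\<Sum>j\<le>k. fact k / (fact (k - j) * fact (Suc j)) *
       (fps_nth (X ^ k * (of_nat (k - j) * P ^ (k - j - 1) * F
            + of_nat ((k - j) choose 2) * P ^ (k - j - 2) * fps_deriv P)) j
        - of_nat (j * (j + 1)) / 2 * fps_nth (X ^ k * P ^ (k - j)) j))
     + of_nat (k choose 2) * (\<Sum>j\<le>n. fact n / (fact (n - j) * fact (Suc j)) * fps_nth (X ^ n * P ^ (n - j)) j)
   = fps_nth (X ^ k * (1 + fps_X * P) ^ k * F) n - 1/2 * fps_nth (X ^ n * (1 + fps_X * P) ^ k) n"
proof -
  define c where "c j = (of_nat (k choose Suc j) :: complex)" for j
  have c: "c j = fact k / (fact (Suc j) * fact (n - j))" if "j \<le> n" for j
    unfolding c_def using that k binomial_fact[of "Suc j" k] by simp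
  define a where "a j = (fact k / (fact (k - j) * fact (Suc j)) :: complex)" for j
  have a1: "a j * of_nat (k - j) = c j" if "j \<le> n" for j
  proof -
    have kj: "k - j = Suc (n - j)" using that k by simp
    have f: "(fact (k - j) :: complex) = of_nat (k - j) * fact (n - j)"
      by (simp only: kj fact_Suc)
    have nz: "of_nat (k - j) \<noteq> (0 :: complex)"
      by (simp only: kj of_nat_eq_0_iff)
    show ?thesis unfolding a_def c[OF that] f using nz
      by (simp add: field_simps del: of_nat_Suc fact_Suc)
  qed
  have a2: "a j * of_nat ((k - j) choose 2) = c j * of_nat (n - j) / 2" if "j \<le> n" for j
  proof -
    have "2 * of_nat ((k - j) choose 2) = (of_nat (k - j) * of_nat (k - j - 1) :: complex)"
      using double_choose_two[of "k - j"] by (metis of_nat_mult of_nat_numeral)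
    moreover have "k - j - 1 = n - j" using k by simp
    ultimately have "of_nat ((k - j) choose 2) = (of_nat (k - j) * of_nat (n - j) / 2 :: complex)"
      by (metis nonzero_mult_div_cancel_left zero_neq_numeral)
    then show ?thesis by (simp only: times_divide_eq_right mult.assoc[symmetric] a1[OF that])
  qed
  have a3: "a (Suc j) * (of_nat (Suc j * (Suc j + 1)) / 2) = c j * of_nat (Suc j) / 2" if "j \<le> n" for j
  proof -
    have "k - Suc j = n - j" using k by simp
    moreover have "(fact (Suc (Suc j)) :: complex) = of_nat (Suc (Suc j)) * fact (Suc j)" by (rule fact_Suc)
    ultimately show ?thesis
      unfolding a_def c[OF that] by (simp add: divide_simps del: fact_Suc of_nat_Suc) (simp add: algebra_simps)
  qed
  have a4: "of_nat (k choose 2) * (fact n / (fact (n - j) * fact (Suc j))) = c j * of_nat n / 2" if "j \<le> n" for j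
  proof -
    have "(of_nat (k choose 2) :: complex) = of_nat k * of_nat n / 2"
    proof -
      have "2 * (k choose 2) = k * n" using double_choose_two[of k] k by simp
      then have "2 * (of_nat (k choose 2) :: complex) = of_nat k * of_nat n"
        by (metis of_nat_mult of_nat_numeral)
      then show ?thesis by (metis nonzero_mult_div_cancel_left zero_neq_numeral)
    qed
    moreover have "fact k = of_nat k * (fact n :: complex)" unfolding k by (rule fact_Suc)
    ultimately show ?thesis unfolding c[OF that] by (simp add: field_simps del: fact_Suc)
  qed
  define U where "U j = fps_nth (X ^ k * P ^ (n - j) * F) j" for j
  define V where "V j = fps_nth (X ^ k * P ^ (n - j - 1) * fps_deriv P) j" for j
  define Y where "Y j = fps_nth (X ^ n * P ^ (n - j)) j" for j
  define Z where "Z j = fps_nth (X ^ k * P ^ (k - j)) j" for j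
  \<comment> \<open>The coefficient of \<open>x\<^sup>j\<close> in the derivative of \<open>X\<^sup>k P\<^bsup>n-j\<^esup>\<close>, computed in two ways.\<close>
  have der: "of_nat (Suc j) * Z (Suc j) = of_nat k * Y j + of_nat (n - j) * V j" for j
  proof -
    have "fps_deriv (X ^ k * P ^ (n - j)) = of_nat k * (X ^ n * P ^ (n - j)) + of_nat (n - j) * (X ^ k * P ^ (n - j - 1) * fps_deriv P)"
    proof -
      have "fps_deriv (X ^ k) = of_nat k * X ^ n"
        by (subst fps_deriv_power') (simp add: X_def k)
      moreover have "fps_deriv (P ^ (n - j)) = of_nat (n - j) * (P ^ (n - j - 1) * fps_deriv P)"
        by (subst fps_deriv_power') (simp add: mult_ac)
      ultimately show ?thesis by (simp only: fps_deriv_mult) (simp only: mult_ac add_ac)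
    qed
    then have "fps_nth (fps_deriv (X ^ k * P ^ (n - j))) j = of_nat k * Y j + of_nat (n - j) * V j"
      by (simp add: Y_def V_def fps_mult_of_nat_nth)
    moreover have "fps_nth (fps_deriv (X ^ k * P ^ (n - j))) j = of_nat (Suc j) * Z (Suc j)"
      by (simp only: fps_deriv_nth Z_def k) simp
    ultimately show ?thesis by simp
  qed
  have main: "fps_nth (X ^ k * (of_nat (k - j) * P ^ (k - j - 1) * F
            + of_nat ((k - j) choose 2) * P ^ (k - j - 2) * fps_deriv P)) j
      = of_nat (k - j) * U j + of_nat ((k - j) choose 2) * V j" for j
  proof -
    have "X ^ k * (of_nat (k - j) * P ^ (k - j - 1) * F + of_nat ((k - j) choose 2) * P ^ (k - j - 2) * fps_deriv P)
      = of_nat (k - j) * (X ^ k * P ^ (n - j) * F) + of_nat ((k - j) choose 2) * (X ^ k * P ^ (n - j - 1) * fps_deriv P)"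
    proof -
      have "k - j - 1 = n - j" "k - j - 2 = n - j - 1" using k by auto
      then show ?thesis by (simp only: distrib_left mult_ac)
    qed
    then show ?thesis by (simp add: U_def V_def fps_mult_of_nat_nth)
  qed
  have "(\<Sum>j\<le>k. a j * ((of_nat (k - j) * U j + of_nat ((k - j) choose 2) * V j) - of_nat (j * (j + 1)) / 2 * Z j))
      = (\<Sum>j\<le>k. a j * (of_nat (k - j) * U j + of_nat ((k - j) choose 2) * V j)) - (\<Sum>j\<le>k. a j * (of_nat (j * (j + 1)) / 2) * Z j)"
    by (simp add: sum_subtractf[symmetric] algebra_simps)
  also have "(\<Sum>j\<le>k. a j * (of_nat (k - j) * U j + of_nat ((k - j) choose 2) * V j)) =
      (\<Sum>j\<le>n. a j * (of_nat (k - j) * U j + of_nat ((k - j) choose 2) * V j))"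
    unfolding k by simp
  also have "\<dots> = (\<Sum>j\<le>n. c j * U j + c j * of_nat (n - j) / 2 * V j)"
    using a1 a2 by (intro sum.cong refl) (simp add: distrib_left mult.assoc[symmetric])
  also have "(\<Sum>j\<le>k. a j * (of_nat (j * (j + 1)) / 2) * Z j) = (\<Sum>j\<le>n. a (Suc j) * (of_nat (Suc j * (Suc j + 1)) / 2) * Z (Suc j))"
    unfolding k by (subst sum.atMost_Suc_shift) simp
  also have "\<dots> = (\<Sum>j\<le>n. c j / 2 * (of_nat (Suc j) * Z (Suc j)))"
    using a3 by (intro sum.cong refl) simp
  finally have 1: "(\<Sum>j\<le>k. a j * ((of_nat (k - j) * U j + of_nat ((k - j) choose 2) * V j) - of_nat (j * (j + 1)) / 2 * Z j))
      = (\<Sum>j\<le>n. c j * U j + c j * of_nat (n - j) / 2 * V j) - (\<Sum>j\<le>n. c j / 2 * (of_nat k * Y j + of_nat (n - j) * V j))"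
    unfolding der .
  have 2: "of_nat (k choose 2) * (\<Sum>j\<le>n. fact n / (fact (n - j) * fact (Suc j)) * Y j) = (\<Sum>j\<le>n. c j * of_nat n / 2 * Y j)"
    unfolding sum_distrib_left
    by (intro sum.cong refl) (simp only: mult.assoc[symmetric] a4 atMost_iff)
  have ring_id: "c' * u + c' * d / 2 * v - c' / 2 * ((1 + n') * y + d * v) + c' * n' / 2 * y
      = c' * u - 1/2 * (c' * y)" for c' u d v y n' :: complex
    by (simp add: field_simps)
  have "(\<Sum>j\<le>n. c j * U j + c j * of_nat (n - j) / 2 * V j) - (\<Sum>j\<le>n. c j / 2 * (of_nat k * Y j + of_nat (n - j) * V j))
     + (\<Sum>j\<le>n. c j * of_nat n / 2 * Y j) = (\<Sum>j\<le>n. c j * U j) - 1/2 * (\<Sum>j\<le>n. c j * Y j)"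
    unfolding sum_subtractf[symmetric] sum.distrib[symmetric] sum_distrib_left
    by (intro sum.cong refl) (simp only: k of_nat_Suc ring_id)
  also have "(\<Sum>j\<le>n. c j * U j) = fps_nth (X ^ k * (1 + fps_X * P) ^ k * F) n"
    using fps_nth_mult_binomial[of "X ^ k * F" P n]
    by (simp add: c_def U_def k mult_ac del: binomial_Suc_Suc power_Suc)
  also have "(\<Sum>j\<le>n. c j * Y j) = fps_nth (X ^ n * (1 + fps_X * P) ^ k) n"
    using fps_nth_mult_binomial[of "X ^ n" P n]
    by (simp add: c_def Y_def k mult_ac del: binomial_Suc_Suc power_Suc)
  finally show ?thesis
    unfolding main Z_def[symmetric] Y_def[symmetric] a_def[symmetric] 2[symmetric] 1[symmetric] .
qed

section \<open>Cumulants and limit moments as power series coefficients\<close>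

text \<open>Only the logarithmic derivative of \<open>(e\<^sup>u - 1) / u\<close> matters, so the branch of the logarithm enters
  just through its continuity at \<open>1\<close>.\<close>

lemma log_expm1_div_expansion:
  obtains Lg where "log_expm1_div has_fps_expansion Lg"
    "fps_deriv Lg * fps_shift 1 (fps_exp 1 - 1) = fps_deriv (fps_shift 1 (fps_exp 1 - 1 :: complex fps))"
proof -
  define E where "E = (fps_exp 1 - 1 :: complex fps)"
  have E: "(\<lambda>u. exp u - 1 :: complex) has_fps_expansion E"
    unfolding E_def by (intro fps_expansion_intros)
  have E0: "fps_nth E 0 = 0" and E1: "fps_nth E 1 = 1" by (simp_all add: E_def)
  define g where "g u = (if u = 0 then 1 else (exp u - 1) / u)" for u :: complex
  have sd: "subdegree E = 1" using E0 E1 by (intro subdegreeI) auto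
  have g: "g has_fps_expansion fps_shift 1 E"
    using has_fps_expansion_shift[OF E, of 1 1] sd E1 by (simp add: g_def[abs_def] cong: if_cong)
  have g0: "g 0 = 1" by (simp add: g_def)
  have "g analytic_on {0}" using has_fps_expansion_imp_analytic_0[OF g] .
  then have "(\<lambda>u. Ln (g u)) analytic_on {0}" by (rule analytic_on_ln) (simp add: g0)
  then have "(Ln \<circ> g) analytic_on {0}" by (simp add: o_def)
  moreover have Ln_g: "Ln \<circ> g = log_expm1_div" by (auto simp: fun_eq_iff g_def log_expm1_div_def)
  ultimately have "log_expm1_div analytic_on {0}" by simp
  then have Lg: "log_expm1_div has_fps_expansion fps_expansion log_expm1_div 0"
    by (rule analytic_at_imp_has_fps_expansion_0)
  define Lg where "Lg = fps_expansion log_expm1_div 0"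
  have Lg0: "fps_nth Lg 0 = 0"
    using has_fps_expansion_imp_0_eq_fps_nth_0[OF Lg] by (simp add: Lg_def log_expm1_div_def)
  have "(exp \<circ> log_expm1_div) has_fps_expansion (fps_exp 1 oo Lg)"
    using Lg Lg0 unfolding Lg_def[symmetric] by (intro has_fps_expansion_compose has_fps_expansion_exp1)
  moreover have "\<forall>\<^sub>F u in nhds 0. (exp \<circ> log_expm1_div) u = g u"
  proof -
    have "isCont g 0" using has_fps_expansion_imp_continuous[OF g, of UNIV] by simp
    then have "(g \<longlongrightarrow> g 0) (nhds 0)" by (simp add: isCont_def tendsto_at_iff_tendsto_nhds)
    then have "\<forall>\<^sub>F u in nhds 0. g u \<noteq> 0" by (rule tendsto_imp_eventually_ne) (simp add: g0)
    then show ?thesis by eventually_elim (simp flip: Ln_g)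
  qed
  ultimately have "g has_fps_expansion (fps_exp 1 oo Lg)"
    using has_fps_expansion_cong[of "exp \<circ> log_expm1_div" g] by blast
  then have G: "fps_shift 1 E = fps_exp 1 oo Lg"
    using g fps_expansion_unique_complex by blast
  have "fps_deriv (fps_shift 1 E) = fps_shift 1 E * fps_deriv Lg"
    unfolding G using fps_compose_deriv[OF Lg0, of "fps_exp 1"] by simp
  then show thesis using Lg that unfolding Lg_def[symmetric] E_def by (simp add: mult.commute)
qed

lemma deriv_at_zero_expansion:
  fixes f :: "complex \<Rightarrow> complex"
  assumes "f has_fps_expansion F" "1 \<le> n"
  shows "1 / fact (n - 1) * (deriv ^^ n) f 0 = fps_nth (fps_X * fps_deriv F) n"
proof -
  obtain n' where n: "n = Suc n'" using assms(2) by (cases n) auto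
  have "fps_nth F n = (deriv ^^ n) f 0 / fact n" by (rule fps_nth_fps_expansion[OF assms(1)])
  then have "(deriv ^^ n) f 0 = fact n * fps_nth F n" by simp
  then show ?thesis by (simp add: n fps_X_mult_nth)
qed

lemma nc_sum_formula:
  assumes S: "(\<lambda>x. \<Psi> (1 + x)) has_fps_expansion S" and T: "(\<lambda>x. \<Phi> (1 + x)) has_fps_expansion T"
    and k: "k = Suc n"
  shows "(\<Sum>\<pi>\<in>noncrossing_partitions k. \<Sum>V\<in>\<pi>. kappa1 \<Phi> (card V) * (\<Prod>W\<in>\<pi> - {V}. kappa0 \<Psi> (card W))) =
    fps_nth ((1 + fps_X) ^ k * (1 + fps_X * fps_deriv S) ^ k * fps_deriv T) n
     - 1/2 * fps_nth ((1 + fps_X) ^ n * (1 + fps_X * fps_deriv S) ^ k) n"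
proof -
  define E where "E = (fps_exp 1 - 1 :: complex fps)"
  have E: "(\<lambda>u. exp u - 1 :: complex) has_fps_expansion E"
    unfolding E_def by (intro fps_expansion_intros)
  have E0: "fps_nth E 0 = 0" by (simp add: E_def)
  obtain Lg where Lg: "log_expm1_div has_fps_expansion Lg"
    "fps_deriv Lg * fps_shift 1 (fps_exp 1 - 1) = fps_deriv (fps_shift 1 (fps_exp 1 - 1 :: complex fps))"
    by (rule log_expm1_div_expansion)
  define H where "H = (S oo E) + Lg"
  define H1 where "H1 = (T oo E) - fps_const (1/2) * fps_X"
  have SE: "(\<lambda>u. \<Psi> (exp u)) has_fps_expansion (S oo E)"
    using has_fps_expansion_compose[OF S E E0] by (simp add: o_def)
  have TE: "(\<lambda>u. \<Phi> (exp u)) has_fps_expansion (T oo E)"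
    using has_fps_expansion_compose[OF T E E0] by (simp add: o_def)
  have H: "(\<lambda>u. \<Psi> (exp u) + log_expm1_div u) has_fps_expansion H"
    unfolding H_def by (intro has_fps_expansion_add SE Lg)
  have "(\<lambda>u. \<Phi> (exp u) - 1/2 * u) has_fps_expansion H1"
    unfolding H1_def by (intro has_fps_expansion_diff has_fps_expansion_cmult_left TE has_fps_expansion_fps_X)
  then have H1: "(\<lambda>u. \<Phi> (exp u) - u / 2) has_fps_expansion H1" by simp
  have "Abs_fps (\<lambda>n. if n = 0 then 1 else kappa0 \<Psi> n) = 1 + fps_X * fps_deriv H"
    using deriv_at_zero_expansion[OF H] by (auto simp: fps_eq_iff kappa0_def)
  moreover have "Abs_fps (\<lambda>n. if n = 0 then 0 else kappa1 \<Phi> n) = fps_X * fps_deriv H1"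
    using deriv_at_zero_expansion[OF H1] by (auto simp: fps_eq_iff kappa1_def)
  ultimately show ?thesis
    using nc_first_order[of "kappa1 \<Phi>" "kappa0 \<Psi>" k] nc_series_change_variable[OF Lg(2) k, of S T]
    by (simp add: H_def H1_def E_def)
qed

lemma limit_moment_expansion:
  assumes \<Psi>: "\<Psi> analytic_on {1}" and S: "(\<lambda>x. \<Psi> (1 + x)) has_fps_expansion S"
  shows "limit_moment \<Psi> k =
    (\<Sum>j\<le>k. fact k / (fact (k - j) * fact (Suc j)) * fps_nth ((1 + fps_X) ^ k * fps_deriv S ^ (k - j)) j)"
  unfolding limit_moment_def atLeast0AtMost
proof (rule sum.cong)
  fix j
  define h where "h x = x ^ k * deriv \<Psi> x ^ (k - j)" for x
  have "deriv (\<lambda>x. \<Psi> (1 + x)) = (\<lambda>x. deriv \<Psi> (1 + x))"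
  proof
    fix y show "deriv (\<lambda>x. \<Psi> (1 + x)) y = deriv \<Psi> (1 + y)"
      unfolding deriv_shift_0[where f="\<lambda>x. \<Psi> (1 + x)" and z=y] deriv_shift_0[where f=\<Psi> and z="1 + y"]
      by (simp only: o_def add.assoc)
  qed
  then have "(\<lambda>x. deriv \<Psi> (1 + x)) has_fps_expansion fps_deriv S"
    using has_fps_expansion_deriv[OF S] by simp
  then have "(\<lambda>x. h (1 + x)) has_fps_expansion (1 + fps_X) ^ k * fps_deriv S ^ (k - j)"
    unfolding h_def by (intro fps_expansion_intros)
  then have "fps_nth ((1 + fps_X) ^ k * fps_deriv S ^ (k - j)) j = (deriv ^^ j) (\<lambda>x. h (1 + x)) 0 / fact j"
    by (rule fps_nth_fps_expansion)
  also have "(deriv ^^ j) (\<lambda>x. h (1 + x)) 0 = (deriv ^^ j) h 1"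
    using higher_deriv_shift_0[of j h 1] by (simp add: o_def)
  finally have "(deriv ^^ j) h 1 = fact j * fps_nth ((1 + fps_X) ^ k * fps_deriv S ^ (k - j)) j" by simp
  then show "fact k / (fact j * fact (j + 1) * fact (k - j)) * (deriv ^^ j) (\<lambda>x. x ^ k * deriv \<Psi> x ^ (k - j)) 1 =
    fact k / (fact (k - j) * fact (Suc j)) * fps_nth ((1 + fps_X) ^ k * fps_deriv S ^ (k - j)) j"
    by (simp add: h_def[abs_def] field_simps del: fact_Suc)
qed simp

section \<open>The limit of the centred moments\<close>

text \<open>Only the first \<open>N\<close> coordinates matter, and \<open>r\<close> may be larger than \<open>N\<close>.\<close>

lemma sgf_converges_pad:
  assumes conv: "\<forall>u\<in>polydisc N \<epsilon>. sgf_converges N \<rho> u" and \<epsilon>: "0 < \<epsilon>" and u: "u \<in> polydisc r \<epsilon>"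
  shows "sgf_converges N \<rho> (pad_ones r u)"
proof -
  have "restrict (pad_ones r u) {..<N} \<in> polydisc N \<epsilon>"
    using u \<epsilon> by (auto simp: polydisc_def pad_ones_def PiE_iff)
  then have "sgf_converges N \<rho> (restrict (pad_ones r u) {..<N})" using conv by blast
  then show ?thesis by (subst sgf_converges_cong[where v="restrict (pad_ones r u) {..<N}"]) auto
qed

theorem theorem15:
  fixes \<rho> :: "nat \<Rightarrow> int list pmf"
    and \<Psi> \<Phi> :: "complex \<Rightarrow> complex"
    and k :: nat
  assumes "\<And>N. N \<ge> 1 \<Longrightarrow> set_pmf (\<rho> N) \<subseteq> signatures N"
    and "\<And>N. N \<ge> 1 \<Longrightarrow> \<exists>\<epsilon>>0. \<forall>u\<in>polydisc N \<epsilon>. sgf_converges N (\<rho> N) u"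
    and "\<Psi> analytic_on {1}"
    and "\<Phi> analytic_on {1}"
    and "\<And>r. r \<ge> 1 \<Longrightarrow> \<exists>\<epsilon>>0. \<exists>L.
           (\<forall>\<^sub>F N in sequentially. is_log_sgf r \<epsilon> N (\<rho> N) (L N)) \<and>
           uniform_limit (polydisc r \<epsilon>)
             (\<lambda>N u. of_nat N * (1 / of_nat N * L N u - (\<Sum>i<r. \<Psi> (u i))))
             (\<lambda>u. \<Sum>i<r. \<Phi> (u i)) sequentially"
    and "k \<ge> 1"
  shows "(\<forall>N\<ge>1. (\<lambda>l. pmf (\<rho> N) l * power_sum N k l) summable_on signatures N) \<and>
    (\<lambda>N. of_nat N *
           (1 / of_nat N *
              of_real (\<Sum>\<^sub>\<infinity>l\<in>signatures N. pmf (\<rho> N) l * power_sum N k l)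
            - limit_moment \<Psi> k))
      \<longlonglongrightarrow> (\<Sum>\<pi>\<in>noncrossing_partitions k. \<Sum>V\<in>\<pi>.
             kappa1 \<Phi> (card V) * (\<Prod>W\<in>\<pi> - {V}. kappa0 \<Psi> (card W)))"
proof
  obtain n where k: "k = Suc n" using assms(6) by (cases k) auto
  obtain c where c: "\<And>z. z ^ k = (\<Sum>m\<le>k. c m * ffact m z)" "c k = 1" "k \<noteq> 0 \<Longrightarrow> c (k - 1) = of_nat (k choose 2)"
    using power_ffact[of k] by blast
  show "\<forall>N\<ge>1. (\<lambda>l. pmf (\<rho> N) l * power_sum N k l) summable_on signatures N"
  proof (intro allI impI)
    fix N :: nat assume N: "1 \<le> N"
    obtain \<epsilon> where \<epsilon>: "0 < \<epsilon>" "\<forall>u\<in>polydisc N \<epsilon>. sgf_converges N (\<rho> N) u" using assms(2)[OF N] by blast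
    define \<delta> where "\<delta> = min \<epsilon> 1 / 2"
    have \<delta>: "0 < \<delta>" "\<delta> < \<epsilon>" "\<delta> < 1" using \<epsilon> by (auto simp: \<delta>_def)
    have "((\<lambda>l. of_real (pmf (\<rho> N) l) * (\<Sum>q<N. ffact m (of_int (sig_exp N l q)))) has_sum
       (\<Sum>j\<le>m. of_nat (m choose j) * fact j * of_nat (N choose Suc j) *
          blim (Suc j) \<delta> m (m - j) (\<lambda>u. sgf N (\<rho> N) (pad_ones (Suc j) u)))) (signatures N)" for m
      by (intro falling_moment_has_sum sgf_sym_closure(2)[OF _ _ \<delta> sgf_converges_pad[OF \<epsilon>(2,1)]]) auto
    then show "(\<lambda>l. pmf (\<rho> N) l * power_sum N k l) summable_on signatures N"
      by (rule power_sum_has_sum(1)[OF N c(1)])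
  qed
  obtain S where S: "(\<lambda>x. \<Psi> (1 + x)) has_fps_expansion S" using analytic_at_imp_has_fps_expansion[OF assms(3)] by blast
  obtain T where T: "(\<lambda>x. \<Phi> (1 + x)) has_fps_expansion T" using analytic_at_imp_has_fps_expansion[OF assms(4)] by blast
  define P where "P = fps_deriv S"
  define \<alpha> where "\<alpha> m j = fps_nth ((1 + fps_X) ^ m * P ^ (m - j)) j" for m j
  define \<beta> where "\<beta> m j = fps_nth ((1 + fps_X) ^ m * (of_nat (m - j) * P ^ (m - j - 1) * fps_deriv T
            + of_nat ((m - j) choose 2) * P ^ (m - j - 2) * fps_deriv P)) j" for m j
  \<comment> \<open>\<open>V m j N\<close> is the bracket of the Schur generating function in \<open>j + 1\<close> variables.\<close>
  define good where "good m j V \<longleftrightarrow> (\<forall>\<^sub>F N in sequentially.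
      ((\<lambda>l. bracket (Suc j) m (m - j) (\<lambda>u. sgf_term N (\<rho> N) (pad_ones (Suc j) u) l)) has_sum V N) (signatures N)) \<and>
     expansion2 V (m - j) (\<alpha> m j) (\<beta> m j)" for m j V
  have "\<exists>V. good m j V" for m j
  proof -
    obtain \<epsilon> L where "0 < \<epsilon>" "\<forall>\<^sub>F N in sequentially. is_log_sgf (Suc j) \<epsilon> N (\<rho> N) (L N)"
      "uniform_limit (polydisc (Suc j) \<epsilon>) (\<lambda>N u. of_nat N * (1 / of_nat N * L N u - (\<Sum>i<Suc j. \<Psi> (u i))))
             (\<lambda>u. \<Sum>i<Suc j. \<Phi> (u i)) sequentially"
      using assms(5)[of "Suc j"] by auto
    from bracket_sum_expansion[OF this assms(3) S assms(4) T, of m "m - j"] show ?thesis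
      unfolding good_def \<alpha>_def \<beta>_def P_def .
  qed
  then obtain V where V: "\<And>m j. good m j (V m j)" by metis
  define M where "M m N = (\<Sum>j\<le>m. of_nat (m choose j) * fact j * of_nat (N choose Suc j) * V m j N)" for m N
  have Mev: "\<forall>\<^sub>F N in sequentially. ((\<lambda>l. of_real (pmf (\<rho> N) l) * (\<Sum>q<N. ffact m (of_int (sig_exp N l q)))) has_sum M m N) (signatures N)" for m
  proof -
    have "\<forall>\<^sub>F N in sequentially. \<forall>j\<in>{..m}.
      ((\<lambda>l. bracket (Suc j) m (m - j) (\<lambda>u. sgf_term N (\<rho> N) (pad_ones (Suc j) u) l)) has_sum V m j N) (signatures N)"
      using V unfolding good_def by (intro eventually_ball_finite) auto
    then show ?thesis
      by eventually_elim (unfold M_def, rule falling_moment_has_sum, auto)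
  qed
  define A where "A m = (\<Sum>j\<le>m. fact m / (fact (m - j) * fact (Suc j)) * \<alpha> m j)" for m
  define B where "B m = (\<Sum>j\<le>m. fact m / (fact (m - j) * fact (Suc j)) * (\<beta> m j - of_nat (j * (j + 1)) / 2 * \<alpha> m j))" for m
  have Mexp: "expansion2 (M m) (Suc m) (A m) (B m)" for m
    unfolding M_def[abs_def] A_def B_def
  proof (rule expansion2_sum)
    fix j assume "j \<in> {..m}"
    then have j: "j \<le> m" by simp
    have "expansion2 (\<lambda>N. of_nat (m choose j) * fact j * (of_nat (N choose Suc j) * V m j N)) (Suc j + (m - j))
       (of_nat (m choose j) * fact j * (1 / fact (Suc j) * \<alpha> m j))
       (of_nat (m choose j) * fact j * (1 / fact (Suc j) * \<beta> m j + - (of_nat (j * (j + 1)) / 2) / fact (Suc j) * \<alpha> m j))"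
      using V unfolding good_def by (intro expansion2_cmult expansion2_mult expansion2_binomial) auto
    moreover have "Suc j + (m - j) = Suc m" using j by simp
    moreover have bf: "of_nat (m choose j) * fact j = (fact m / fact (m - j) :: complex)"
      using binomial_fact[OF j, where 'a=complex] by simp
    moreover have "fact m / fact (m - j) * (1 / fact (Suc j) * x) = fact m / (fact (m - j) * fact (Suc j)) * x" for x :: complex
      by simp
    moreover have "fact m / fact (m - j) * (1 / fact (Suc j) * y + - z / fact (Suc j) * x) =
        fact m / (fact (m - j) * fact (Suc j)) * (y - z * x)" for x y z :: complex
      by (simp add: field_simps del: fact_Suc)
    ultimately show "expansion2 (\<lambda>N. of_nat (m choose j) * fact j * of_nat (N choose Suc j) * V m j N) (Suc m)
       (fact m / (fact (m - j) * fact (Suc j)) * \<alpha> m j)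
       (fact m / (fact (m - j) * fact (Suc j)) * (\<beta> m j - of_nat (j * (j + 1)) / 2 * \<alpha> m j))"
      by (simp only: mult.assoc)
  qed simp
  \<comment> \<open>Since \<open>M m\<close> has order \<open>N\<^bsup>m+1\<^esup>\<close>, only the falling factorials of degree \<open>k\<close> and \<open>k - 1\<close> contribute
    to the two leading orders.\<close>
  define E where "E N = (\<Sum>m\<le>k. c m * M m N)" for N
  have Eexp: "expansion2 E (Suc k) (A k) (B k + of_nat (k choose 2) * A n)"
  proof -
    have "expansion2 (\<lambda>N. \<Sum>m<n. c m * M m N) (Suc k) (\<Sum>m<n. 0) (\<Sum>m<n. 0)"
      by (intro expansion2_sum expansion2_lower[OF expansion2_cmult[OF Mexp]]) (auto simp: k)
    moreover have "expansion2 (\<lambda>N. c n * M n N) (Suc k) 0 (c n * A n)"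
      using expansion2_raise[OF expansion2_cmult[OF Mexp[of n], of "c n"]] by (simp add: k)
    moreover have "expansion2 (\<lambda>N. c k * M k N) (Suc k) (c k * A k) (c k * B k)"
      by (rule expansion2_cmult[OF Mexp])
    ultimately have "expansion2 (\<lambda>N. (\<Sum>m<n. c m * M m N) + c n * M n N + c k * M k N) (Suc k)
       ((\<Sum>m<n. 0) + 0 + c k * A k) ((\<Sum>m<n. 0) + c n * A n + c k * B k)"
      by (intro expansion2_add)
    moreover have "(\<Sum>m<n. c m * M m N) + c n * M n N + c k * M k N = E N" for N
      unfolding E_def k by (simp add: lessThan_Suc_atMost[symmetric])
    moreover have "c n = of_nat (k choose 2)" using c(3) k by simp
    ultimately show ?thesis using c(2) by (simp add: add.commute)
  qed
  have "\<forall>\<^sub>F N in sequentially. \<forall>m\<in>{..k}. ((\<lambda>l. of_real (pmf (\<rho> N) l) * (\<Sum>q<N. ffact m (of_int (sig_exp N l q)))) has_sum M m N) (signatures N)"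
    using Mev by (intro eventually_ball_finite) auto
  then have ev: "\<forall>\<^sub>F N in sequentially. of_nat N * (1 / of_nat N *
        of_real (\<Sum>\<^sub>\<infinity>l\<in>signatures N. pmf (\<rho> N) l * power_sum N k l) - limit_moment \<Psi> k) =
      of_nat N * (E N / of_nat N ^ Suc k - A k)"
    using eventually_ge_at_top[of 1]
  proof eventually_elim
    case (elim N)
    have "complex_of_real (\<Sum>\<^sub>\<infinity>l\<in>signatures N. pmf (\<rho> N) l * power_sum N k l) = E N / of_nat N ^ k"
      unfolding E_def by (rule power_sum_has_sum(2)[OF elim(2) c(1)]) (use elim(1) in auto)
    moreover have "limit_moment \<Psi> k = A k"
      using limit_moment_expansion[OF assms(3) S, of k] by (simp add: A_def \<alpha>_def P_def)
    ultimately show ?case by simp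
  qed
  have "(\<lambda>N. of_nat N * (E N / of_nat N ^ Suc k - A k)) \<longlonglongrightarrow> B k + of_nat (k choose 2) * A n"
    using Eexp unfolding expansion2_def .
  moreover have "B k + of_nat (k choose 2) * A n = (\<Sum>\<pi>\<in>noncrossing_partitions k. \<Sum>V\<in>\<pi>.
             kappa1 \<Phi> (card V) * (\<Prod>W\<in>\<pi> - {V}. kappa0 \<Psi> (card W)))"
    unfolding nc_sum_formula[OF S T k] second_order_coefficient[OF k, of P "fps_deriv T", symmetric, unfolded P_def]
    by (simp only: A_def B_def \<alpha>_def \<beta>_def P_def)
  ultimately show "(\<lambda>N. of_nat N * (1 / of_nat N *
              of_real (\<Sum>\<^sub>\<infinity>l\<in>signatures N. pmf (\<rho> N) l * power_sum N k l) - limit_moment \<Psi> k))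
      \<longlonglongrightarrow> (\<Sum>\<pi>\<in>noncrossing_partitions k. \<Sum>V\<in>\<pi>.
             kappa1 \<Phi> (card V) * (\<Prod>W\<in>\<pi> - {V}. kappa0 \<Psi> (card W)))"
    by (intro iffD2[OF tendsto_cong[OF ev]]) simp
qed

end
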